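(* Let $n,m\ge1$, let $0\le k\le n$ with $k\equiv n\pmod 2$, and let $\mathbb{K}$ be a field containing a primitive $m$-th root of unity. Let $\zeta_m\in\mathbb{K}$ be an $m$-th root of unity (not necessarily primitive) with corresponding simple (one-dimensional) $\mathcal{C}_m$-representation $K$, on which the generator of the cyclic group $\mathcal{C}_m$ acts by $\zeta_m$. Let $L(k,K)$ be the simple $m\mathcal{TL}_n$-representation associated with the $k$-th cell and $K$, and let $L(k)$ be the $k$-th simple representation of the Temperley–Lieb algebra $\mathcal{TL}_n^{lin}(\zeta_m)$ over $\mathbb{K}$. Then $$\dim_{\mathbb{K}} L(k,K)=\dim_{\mathbb{K}}L(k).$$
   Context: For $p,q\ge 0$, let $C_p^q$ be the set of crossingless matchings from $p$ to $q$ points: non-crossing perfect matchings of the $p$ bottom points $(1,0),\dots,(p,0)$ and the $q$ top points $(1,1),\dots,(q,1)$, drawn by pairwise disjoint arcs in $\mathbb{R}\times[0,1]$ (identified if the same points are paired). For $a\in C_q^r$, $b\in C_p^q$, gluing $a$ on top of $b$ gives $ab\in C_p^r$ after deleting closed loops; $\Phi(a,b)$ is the number of closed loops deleted. A through strand is an arc joining a bottom point to a top point; a cap is an arc joining two bottom points. $x^*$ denotes the reflection of $x$ top to bottom. $B_k^n\subseteq C_k^n$ is the set of matchings without caps (so with exactly $k$ through strands). The $m$-cyclic Temperley–Lieb monoid is $m\mathcal{TL}_n=C_n^n\times\mathbb{Z}/m$ with $(a,i)(b,j)=(ab,i+j+\Phi(a,b))$. Let $\Delta(k)$ be the $\mathbb{K}$-vector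 space with basis $B_k^n\times \mathbb{Z}/m$, left $m\mathcal{TL}_n$-action $(a,i)\cdot(x,j)=(ax,i+j+\Phi(a,x))$ if $ax\in B_k^n$ and $0$ otherwise, and right $\mathcal{C}_m$-action in which the generator sends $(x,j)$ to $(x,j+1)$. For a simple $\mathcal{C}_m$-representation $K$, $L(k,K)$ is the head (quotient by the radical) of $\Delta(k)\otimes_{\mathbb{K}\mathcal{C}_m}K$; it is simple. For $\delta\in\mathbb{K}$, $\mathcal{TL}_n^{lin}(\delta)$ is the $\mathbb{K}$-algebra with basis $C_n^n$ and product $a\cdot b=\delta^{\Phi(a,b)}ab$. Its cell representation $W(k)$ has basis $B_k^n$ with $a\cdot x=\delta^{\Phi(a,x)}ax$ if $ax\in B_k^n$ and $0$ otherwise, and bilinear form $\langle x,y\rangle_k=\delta^{\Phi(x^*,y)}$ if $x^*y=\mathrm{id}_k$ and $0$ otherwise, for $x,y\in B_k^n$. $R(k)$ is the radical of this form and $L(k)=W(k)/R(k)$. *)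

theory Defs
  imports
    "HOL-Algebra.Elementary_Groups"
    "HOL-Algebra.AbelCoset"
    "HOL-Library.Disjoint_Sets"
    "Jordan_Normal_Form.Missing_VectorSpace"
begin

section \<open>Crossingless matchings\<close>

text \<open>The point \<open>Bot i\<close> is $(i,0)$ and \<open>Top i\<close> is $(i,1)$. A matching is the set of its arcs,
  each arc being recorded as the pair of its endpoints.\<close>

datatype pt = Bot nat | Top nat

type_synonym matching = "pt set set"

definition points :: "nat \<Rightarrow> nat \<Rightarrow> pt set" where
  "points p q = Bot ` {1..p} \<union> Top ` {1..q}"

text \<open>The order in which one meets the marked points when going around the boundary of the strip
  counterclockwise, starting at the far left: first the bottom line from left to right, then the
  top line from right to left. The endpoint pairs can be joined by pairwise disjoint arcs inside the
  strip if and only if no two of the pairs interlace in this order.\<close>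

fun bdry_less :: "pt \<Rightarrow> pt \<Rightarrow> bool" where
  "bdry_less (Bot i) (Bot j) \<longleftrightarrow> i < j"
| "bdry_less (Bot i) (Top j) \<longleftrightarrow> True"
| "bdry_less (Top i) (Bot j) \<longleftrightarrow> False"
| "bdry_less (Top i) (Top j) \<longleftrightarrow> j < i"

definition noncrossing :: "matching \<Rightarrow> bool" where
  "noncrossing M \<longleftrightarrow>
     \<not> (\<exists>e\<in>M. \<exists>f\<in>M. \<exists>x\<in>e. \<exists>x'\<in>e. \<exists>y\<in>f. \<exists>y'\<in>f.
          bdry_less x y \<and> bdry_less y x' \<and> bdry_less x' y')"

text \<open>\<open>crossingless p q\<close> is $C_p^q$: the first argument counts bottom points.\<close>

definition crossingless :: "nat \<Rightarrow> nat \<Rightarrow> matching set" where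
  "crossingless p q =
     {M. partition_on (points p q) M \<and> (\<forall>e\<in>M. card e = 2) \<and> noncrossing M}"

definition id_matching :: "nat \<Rightarrow> matching" where
  "id_matching k = {{Bot i, Top i} | i. i \<in> {1..k}}"

fun flip_pt :: "pt \<Rightarrow> pt" where
  "flip_pt (Bot i) = Top i"
| "flip_pt (Top i) = Bot i"

definition reflect :: "matching \<Rightarrow> matching" where
  "reflect x = (\<lambda>e. flip_pt ` e) ` x"

text \<open>\<open>cell k n\<close> is $B_k^n$.\<close>

definition is_cap :: "pt set \<Rightarrow> bool" where
  "is_cap e \<longleftrightarrow> e \<subseteq> range Bot"

definition cell :: "nat \<Rightarrow> nat \<Rightarrow> matching set" where
  "cell k n = {x \<in> crossingless k n. \<forall>e\<in>x. \<not> is_cap e}"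

subsection \<open>Gluing\<close>

text \<open>To glue \<open>a\<close> on top of \<open>b\<close>, the top points of \<open>b\<close> and the bottom points of \<open>a\<close> are identified
  with the points \<open>MiddlePt j\<close>. The connected components of the resulting diagram are arcs with two
  outer endpoints, which make up the product, and closed loops, which contain middle points only.\<close>

datatype glued_pt = LowerPt nat | MiddlePt nat | UpperPt nat

fun upper_half :: "pt \<Rightarrow> glued_pt" where
  "upper_half (Bot i) = MiddlePt i"
| "upper_half (Top i) = UpperPt i"

fun lower_half :: "pt \<Rightarrow> glued_pt" where
  "lower_half (Bot i) = LowerPt i"
| "lower_half (Top i) = MiddlePt i"

fun outer :: "pt \<Rightarrow> glued_pt" where
  "outer (Bot i) = LowerPt i"
| "outer (Top i) = UpperPt i"

definition glued :: "matching \<Rightarrow> matching \<Rightarrow> glued_pt set set" where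
  "glued a b = (\<lambda>e. upper_half ` e) ` a \<union> (\<lambda>e. lower_half ` e) ` b"

definition components :: "matching \<Rightarrow> matching \<Rightarrow> glued_pt set set" where
  "components a b = \<Union>(glued a b) // {(u, v). \<exists>e\<in>glued a b. u \<in> e \<and> v \<in> e}\<^sup>+"

definition diagram_mult :: "matching \<Rightarrow> matching \<Rightarrow> matching" where
  "diagram_mult a b = {outer -` C | C. C \<in> components a b \<and> outer -` C \<noteq> {}}"

definition loops :: "matching \<Rightarrow> matching \<Rightarrow> nat" where
  "loops a b = card {C \<in> components a b. outer -` C = {}}"

section \<open>The cyclic Temperley--Lieb monoid\<close>

text \<open>The library's \<open>integer_mod_group m\<close> has carrier \<open>{0..<m}\<close> in the integers for \<open>m > 0\<close>. It serves
  both as $\mathbb{Z}/m$ and as the cyclic group $\mathcal{C}_m$, whose generator is the class of 1.\<close>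

definition cyclic_TL :: "nat \<Rightarrow> nat \<Rightarrow> (matching \<times> int) monoid" where
  "cyclic_TL m n =
     \<lparr>carrier = crossingless n n \<times> carrier (integer_mod_group m),
      monoid.mult = (\<lambda>(a, i) (b, j). (diagram_mult a b, (i + j + int (loops a b)) mod int m)),
      one = (id_matching n, 0)\<rparr>"

section \<open>Vector spaces and representations\<close>

text \<open>A representation is a vector space with an action of elements of type \<open>'s\<close>. Which elements
  act (a monoid, a group, an algebra) is passed separately. The inherited ring fields
  \<open>mult\<close> and \<open>one\<close> of a module record carry no meaning for a vector space.\<close>

record ('k, 'v, 's) rep = "('k, 'v) module" +
  act :: "'s \<Rightarrow> 'v \<Rightarrow> 'v"

record ('k, 'v, 's, 'g) birep = "('k, 'v, 's) rep" +
  ract :: "'v \<Rightarrow> 'g \<Rightarrow> 'v"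

text \<open>The vector space with basis \<open>X\<close>, as finitely supported functions.\<close>

definition free_space :: "('k, 'r) ring_scheme \<Rightarrow> 'x set \<Rightarrow> ('k, 'x \<Rightarrow> 'k) module" where
  "free_space K X =
     (ring.func_space K X)
       \<lparr>carrier := {f \<in> X \<rightarrow>\<^sub>E carrier K. finite {x \<in> X. f x \<noteq> \<zero>\<^bsub>K\<^esub>}}\<rparr>"

definition basis_vec :: "('k, 'r) ring_scheme \<Rightarrow> 'x set \<Rightarrow> 'x \<Rightarrow> 'x \<Rightarrow> 'k" where
  "basis_vec K X x = (\<lambda>y\<in>X. if y = x then \<one>\<^bsub>K\<^esub> else \<zero>\<^bsub>K\<^esub>)"

text \<open>The linear extension to \<open>free_space K X\<close> of a map \<open>\<phi>\<close> from \<open>X\<close> to \<open>V\<close>.\<close>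

definition lin_ext ::
  "('k, 'r) ring_scheme \<Rightarrow> 'x set \<Rightarrow> ('k, 'v, 's) module_scheme \<Rightarrow> ('x \<Rightarrow> 'v) \<Rightarrow> ('x \<Rightarrow> 'k) \<Rightarrow> 'v"
  where
  "lin_ext K X V \<phi> u = (\<Oplus>\<^bsub>V\<^esub>x\<in>{x \<in> X. u x \<noteq> \<zero>\<^bsub>K\<^esub>}. u x \<odot>\<^bsub>V\<^esub> \<phi> x)"

text \<open>Quotients consist of cosets. Adding \<open>N\<close> to the image of a coset gives back a full coset (for
  instance after multiplication by the scalar zero).\<close>

definition quot_space :: "('k, 'v, 's) module_scheme \<Rightarrow> 'v set \<Rightarrow> ('k, 'v set) module" where
  "quot_space V N =
     \<lparr>carrier = a_rcosets\<^bsub>V\<^esub> N, monoid.mult = (\<lambda>_ _. N), one = N, zero = N,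
      add = (\<lambda>C D. C <+>\<^bsub>V\<^esub> D),
      smult = (\<lambda>c C. N <+>\<^bsub>V\<^esub> (\<lambda>v. c \<odot>\<^bsub>V\<^esub> v) ` C)\<rparr>"

definition quot_rep :: "('k, 'v, 's, 'e) rep_scheme \<Rightarrow> 'v set \<Rightarrow> ('k, 'v set, 's) rep" where
  "quot_rep V N =
     module.extend (quot_space V N) (rep.fields (\<lambda>s C. N <+>\<^bsub>V\<^esub> act V s ` C))"

definition subrep ::
  "('k, 'r) ring_scheme \<Rightarrow> 's set \<Rightarrow> ('k, 'v, 's, 'e) rep_scheme \<Rightarrow> 'v set \<Rightarrow> bool" where
  "subrep K S V N \<longleftrightarrow> subspace K N V \<and> (\<forall>s\<in>S. \<forall>v\<in>N. act V s v \<in> N)"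

definition maximal_subrep ::
  "('k, 'r) ring_scheme \<Rightarrow> 's set \<Rightarrow> ('k, 'v, 's, 'e) rep_scheme \<Rightarrow> 'v set \<Rightarrow> bool" where
  "maximal_subrep K S V N \<longleftrightarrow>
     subrep K S V N \<and> N \<noteq> carrier V \<and>
     (\<forall>N'. subrep K S V N' \<and> N \<subseteq> N' \<longrightarrow> N' = N \<or> N' = carrier V)"

definition rep_radical ::
  "('k, 'r) ring_scheme \<Rightarrow> 's set \<Rightarrow> ('k, 'v, 's, 'e) rep_scheme \<Rightarrow> 'v set" where
  "rep_radical K S V = carrier V \<inter> \<Inter>{N. maximal_subrep K S V N}"

definition rep_head ::
  "('k, 'r) ring_scheme \<Rightarrow> 's set \<Rightarrow> ('k, 'v, 's, 'e) rep_scheme \<Rightarrow> ('k, 'v set, 's) rep" where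
  "rep_head K S V = quot_rep V (rep_radical K S V)"

subsection \<open>Tensor product over a group algebra\<close>

text \<open>$V \otimes_{\mathbb{K}G} W$ is the vector space freely generated by all pairs \<open>(v, w)\<close> modulo
  bilinearity and the relations $(v g, w) = (v, g w)$ for \<open>g\<close> in \<open>G\<close>. By linearity these imply the
  same relation for all elements of the group algebra. The left action on \<open>V\<close> is retained.\<close>

definition tensor_rels ::
  "('k, 'r) ring_scheme \<Rightarrow> 'g set \<Rightarrow> ('k, 'v, 's, 'g) birep \<Rightarrow> ('k, 'w, 'g) rep
    \<Rightarrow> ('v \<times> 'w \<Rightarrow> 'k) set" where
  "tensor_rels K G V W =
     (let X = carrier V \<times> carrier W; F = free_space K X; t = (\<lambda>v w. basis_vec K X (v, w)) in
        {t (v \<oplus>\<^bsub>V\<^esub> v') w \<ominus>\<^bsub>F\<^esub> (t v w \<oplus>\<^bsub>F\<^esub> t v' w) | v v' w.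
           v \<in> carrier V \<and> v' \<in> carrier V \<and> w \<in> carrier W} \<union>
        {t v (w \<oplus>\<^bsub>W\<^esub> w') \<ominus>\<^bsub>F\<^esub> (t v w \<oplus>\<^bsub>F\<^esub> t v w') | v w w'.
           v \<in> carrier V \<and> w \<in> carrier W \<and> w' \<in> carrier W} \<union>
        {t (c \<odot>\<^bsub>V\<^esub> v) w \<ominus>\<^bsub>F\<^esub> c \<odot>\<^bsub>F\<^esub> t v w | c v w.
           c \<in> carrier K \<and> v \<in> carrier V \<and> w \<in> carrier W} \<union>
        {t v (c \<odot>\<^bsub>W\<^esub> w) \<ominus>\<^bsub>F\<^esub> c \<odot>\<^bsub>F\<^esub> t v w | c v w.
           c \<in> carrier K \<and> v \<in> carrier V \<and> w \<in> carrier W} \<union>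
        {t (ract V v g) w \<ominus>\<^bsub>F\<^esub> t v (act W g w) | g v w.
           g \<in> G \<and> v \<in> carrier V \<and> w \<in> carrier W})"

definition tensor ::
  "('k, 'r) ring_scheme \<Rightarrow> 'g set \<Rightarrow> ('k, 'v, 's, 'g) birep \<Rightarrow> ('k, 'w, 'g) rep
    \<Rightarrow> ('k, ('v \<times> 'w \<Rightarrow> 'k) set, 's) rep" where
  "tensor K G V W =
     (let X = carrier V \<times> carrier W; F = free_space K X in
        quot_rep
          (module.extend F
             (rep.fields (\<lambda>s. lin_ext K X F (\<lambda>(v, w). basis_vec K X (act V s v, w)))))
          (module.span K F (tensor_rels K G V W)))"

section \<open>Simple representations of the cyclic monoid\<close>

definition Delta ::
  "('k, 'r) ring_scheme \<Rightarrow> nat \<Rightarrow> nat \<Rightarrow> nat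
    \<Rightarrow> ('k, matching \<times> int \<Rightarrow> 'k, matching \<times> int, int) birep" where
  "Delta K m n k =
     (let X = cell k n \<times> carrier (integer_mod_group m); F = free_space K X in
        rep.extend
          (module.extend F
            (rep.fields
              (\<lambda>(a, i). lin_ext K X F
                 (\<lambda>(x, j). if diagram_mult a x \<in> cell k n
                    then basis_vec K X (diagram_mult a x, (i + j + int (loops a x)) mod int m)
                    else \<zero>\<^bsub>F\<^esub>))))
          (birep.fields
            (\<lambda>v g. lin_ext K X F (\<lambda>(x, j). basis_vec K X (x, (j + g) mod int m)) v)))"

text \<open>The one-dimensional representation of $\mathcal{C}_m$ on which the generator acts by \<open>\<zeta>\<close>.\<close>

definition cyclic_char :: "('k, 'r) ring_scheme \<Rightarrow> 'k \<Rightarrow> ('k, 'k, int) rep" where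
  "cyclic_char K \<zeta> =
     \<lparr>carrier = carrier K, monoid.mult = monoid.mult K, one = one K, zero = zero K, add = add K,
      smult = monoid.mult K, act = (\<lambda>g c. (\<zeta> [^]\<^bsub>K\<^esub> g) \<otimes>\<^bsub>K\<^esub> c)\<rparr>"

text \<open>\<open>L_cyclic K m n k \<zeta>\<close> is $L(k,K)$ for the $\mathcal{C}_m$-representation \<open>cyclic_char K \<zeta>\<close>.\<close>

definition L_cyclic ::
  "('k, 'r) ring_scheme \<Rightarrow> nat \<Rightarrow> nat \<Rightarrow> nat \<Rightarrow> 'k
    \<Rightarrow> ('k, ((matching \<times> int \<Rightarrow> 'k) \<times> 'k \<Rightarrow> 'k) set set, matching \<times> int) rep" where
  "L_cyclic K m n k \<zeta> =
     rep_head K (carrier (cyclic_TL m n))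
       (tensor K (carrier (integer_mod_group m)) (Delta K m n k) (cyclic_char K \<zeta>))"

section \<open>Simple representations of the Temperley--Lieb algebra\<close>

text \<open>As an algebra, \<open>TL_lin K n \<delta>\<close> makes use of the multiplication and unit of a module record. Its
  elements are what acts on \<open>W_TL K n k \<delta>\<close>.\<close>

definition TL_lin :: "('k, 'r) ring_scheme \<Rightarrow> nat \<Rightarrow> 'k \<Rightarrow> ('k, matching \<Rightarrow> 'k) module" where
  "TL_lin K n \<delta> =
     (let X = crossingless n n; F = free_space K X in
        F\<lparr>monoid.mult := (\<lambda>u v. lin_ext K X F
             (\<lambda>a. lin_ext K X F
               (\<lambda>b. (\<delta> [^]\<^bsub>K\<^esub> loops a b) \<odot>\<^bsub>F\<^esub> basis_vec K X (diagram_mult a b)) v) u),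
          one := basis_vec K X (id_matching n)\<rparr>)"

definition W_TL ::
  "('k, 'r) ring_scheme \<Rightarrow> nat \<Rightarrow> nat \<Rightarrow> 'k \<Rightarrow> ('k, matching \<Rightarrow> 'k, matching \<Rightarrow> 'k) rep" where
  "W_TL K n k \<delta> =
     (let X = cell k n; F = free_space K X in
        module.extend F
          (rep.fields
            (\<lambda>u v. lin_ext K (crossingless n n) F
               (\<lambda>a. lin_ext K X F
                 (\<lambda>x. if diagram_mult a x \<in> X
                    then (\<delta> [^]\<^bsub>K\<^esub> loops a x) \<odot>\<^bsub>F\<^esub> basis_vec K X (diagram_mult a x)
                    else \<zero>\<^bsub>F\<^esub>) v) u)))"

definition TL_form ::
  "('k, 'r) ring_scheme \<Rightarrow> nat \<Rightarrow> nat \<Rightarrow> 'k \<Rightarrow> (matching \<Rightarrow> 'k) \<Rightarrow> (matching \<Rightarrow> 'k) \<Rightarrow> 'k" where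
  "TL_form K n k \<delta> u v =
     (\<Oplus>\<^bsub>K\<^esub>x\<in>cell k n. \<Oplus>\<^bsub>K\<^esub>y\<in>cell k n. u x \<otimes>\<^bsub>K\<^esub> v y \<otimes>\<^bsub>K\<^esub>
        (if diagram_mult (reflect x) y = id_matching k
         then \<delta> [^]\<^bsub>K\<^esub> loops (reflect x) y else \<zero>\<^bsub>K\<^esub>))"

definition R_TL :: "('k, 'r) ring_scheme \<Rightarrow> nat \<Rightarrow> nat \<Rightarrow> 'k \<Rightarrow> (matching \<Rightarrow> 'k) set" where
  "R_TL K n k \<delta> =
     {u \<in> carrier (W_TL K n k \<delta>). \<forall>v\<in>carrier (W_TL K n k \<delta>). TL_form K n k \<delta> u v = \<zero>\<^bsub>K\<^esub>}"

definition L_TL ::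
  "('k, 'r) ring_scheme \<Rightarrow> nat \<Rightarrow> nat \<Rightarrow> 'k
    \<Rightarrow> ('k, (matching \<Rightarrow> 'k) set, matching \<Rightarrow> 'k) rep" where
  "L_TL K n k \<delta> = quot_rep (W_TL K n k \<delta>) (R_TL K n k \<delta>)"

section \<open>Roots of unity\<close>

definition primitive_root_of_unity :: "('k, 'r) ring_scheme \<Rightarrow> nat \<Rightarrow> 'k \<Rightarrow> bool" where
  "primitive_root_of_unity K m \<omega> \<longleftrightarrow>
     \<omega> \<in> carrier K \<and> \<omega> [^]\<^bsub>K\<^esub> m = \<one>\<^bsub>K\<^esub> \<and>
     (\<forall>j::nat. 0 < j \<and> j < m \<longrightarrow> \<omega> [^]\<^bsub>K\<^esub> j \<noteq> \<one>\<^bsub>K\<^esub>)"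

end

theory Submission
  imports Defs
begin

text \<open>
  The right action of the cyclic group on \<open>Delta K m n k\<close> is free, and balancing gives
  $(x,j)\otimes 1=\zeta^j\,(x,0)\otimes 1$. So $\Delta(k)\otimes K$ has the basis
  $(x,0)\otimes 1$ for $x\in B_k^n$. On this basis $(a,i)$ acts as $\zeta^i$ times the action of
  \<open>a\<close> on the cell representation $W(k)$ at $\delta=\zeta$, because a deleted loop shifts the
  $\mathbb{Z}/m$-component by one and hence contributes one factor $\zeta$. The map \<open>\<sigma>\<close> below is
  this isomorphism (lemmas \<open>\<sigma>_surj\<close>, \<open>\<sigma>_inj\<close>, \<open>act_\<sigma>\<close>).

  Under this isomorphism the radical of the representation is the radical $R(k)$ of the bilinear
  form. First, $R(k)$ is invariant, as $\langle y,ax\rangle=\langle a^*y,x\rangle$ (lemma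
  \<open>form_twisted_act\<close>). Secondly, the diagram $zy^*$ acts by $u\mapsto\langle y,u\rangle z$ (lemma
  \<open>sandwich_act\<close>), so that a vector outside $R(k)$ generates everything; every proper
  subrepresentation is therefore contained in $R(k)$. Thirdly, $R(k)$ is proper, since
  $x^*x=\mathrm{id}_k$ and $\langle x,x\rangle$ is a power of the unit $\zeta$. So $R(k)$ is the
  only maximal subrepresentation, and both dimensions are the dimension of $W(k)/R(k)$.

  On the side of diagrams this rests on three facts. Gluing is associative, and the numbers of
  deleted loops agree for both bracketings: one compares both with the connected components of
  the picture formed by all three diagrams (\<open>diagram_mult_assoc\<close>, \<open>loops_assoc\<close>).
  The product of crossingless matchings is crossingless (\<open>diagram_mult_crossingless\<close>); instead
  of planar topology the proof counts, modulo 2, pairs of boundary points in increasing order.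
  A cap of the lower factor survives in a product (\<open>no_cap_of_product\<close>), and the identity is the
  only cap-free matching from \<open>k\<close> to \<open>k\<close> points (\<open>cell_self\<close>).
\<close>

section \<open>Linear maps, free spaces, quotients and dimension\<close>

text \<open>The vector space axioms are equations, so they pass along a surjection that respects the
  operations. In this way quotients, and records that differ only in additional fields, become
  vector spaces.\<close>
lemma linear_map_of_surj:
  assumes V: "vectorspace K V"
    and surj: "q ` carrier V = carrier V'"
    and add: "\<And>u v. u \<in> carrier V \<Longrightarrow> v \<in> carrier V \<Longrightarrow> q (u \<oplus>\<^bsub>V\<^esub> v) = q u \<oplus>\<^bsub>V'\<^esub> q v"
    and smult: "\<And>c v. c \<in> carrier K \<Longrightarrow> v \<in> carrier V \<Longrightarrow> q (c \<odot>\<^bsub>V\<^esub> v) = c \<odot>\<^bsub>V'\<^esub> q v"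
    and zero: "q \<zero>\<^bsub>V\<^esub> = \<zero>\<^bsub>V'\<^esub>"
  shows "linear_map K V V' q"
proof -
  interpret V: vectorspace K V by (rule V)
  have ex: "\<exists>v\<in>carrier V. u = q v" if "u \<in> carrier V'" for u
    using that surj by blast
  have im: "q v \<in> carrier V'" if "v \<in> carrier V" for v
    using that surj by blast
  have vs: "vectorspace K V'"
  proof (rule vs_criteria)
    show "field K" by unfold_locales
    show "\<zero>\<^bsub>V'\<^esub> \<in> carrier V'" using im[of "\<zero>\<^bsub>V\<^esub>"] zero by simp
    show "\<forall>v w. v \<in> carrier V' \<and> w \<in> carrier V' \<longrightarrow> v \<oplus>\<^bsub>V'\<^esub> w \<in> carrier V'"
      by (metis ex im add V.M.add.m_closed)
    show "\<forall>v\<in>carrier V'. \<exists>neg_v\<in>carrier V'. v \<oplus>\<^bsub>V'\<^esub> neg_v = \<zero>\<^bsub>V'\<^esub>"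
    proof
      fix v assume "v \<in> carrier V'"
      then obtain u where u: "u \<in> carrier V" "v = q u" using ex by blast
      have "v \<oplus>\<^bsub>V'\<^esub> q (\<ominus>\<^bsub>V\<^esub> u) = \<zero>\<^bsub>V'\<^esub>"
        using u add[of u "\<ominus>\<^bsub>V\<^esub> u"] zero by (simp add: V.M.r_neg)
      then show "\<exists>neg_v\<in>carrier V'. v \<oplus>\<^bsub>V'\<^esub> neg_v = \<zero>\<^bsub>V'\<^esub>"
        using im u by (metis V.M.add.inv_closed)
    qed
    show "\<forall>c v. c \<in> carrier K \<and> v \<in> carrier V' \<longrightarrow> c \<odot>\<^bsub>V'\<^esub> v \<in> carrier V'"
      by (metis ex im smult V.smult_closed)
    show "\<forall>v w. v \<in> carrier V' \<and> w \<in> carrier V' \<longrightarrow> v \<oplus>\<^bsub>V'\<^esub> w = w \<oplus>\<^bsub>V'\<^esub> v"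
      by (metis ex add V.M.add.m_comm)
    show "\<forall>v w x. v \<in> carrier V' \<and> w \<in> carrier V' \<and> x \<in> carrier V' \<longrightarrow>
        (v \<oplus>\<^bsub>V'\<^esub> w) \<oplus>\<^bsub>V'\<^esub> x = v \<oplus>\<^bsub>V'\<^esub> (w \<oplus>\<^bsub>V'\<^esub> x)"
    proof (intro allI impI, elim conjE)
      fix v w x assume "v \<in> carrier V'" "w \<in> carrier V'" "x \<in> carrier V'"
      then obtain v' w' x' where "v' \<in> carrier V" "w' \<in> carrier V" "x' \<in> carrier V"
        "v = q v'" "w = q w'" "x = q x'" using ex by metis
      then show "(v \<oplus>\<^bsub>V'\<^esub> w) \<oplus>\<^bsub>V'\<^esub> x = v \<oplus>\<^bsub>V'\<^esub> (w \<oplus>\<^bsub>V'\<^esub> x)"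
        by (simp flip: add add: V.M.add.m_assoc)
    qed
    show "\<forall>v\<in>carrier V'. v \<oplus>\<^bsub>V'\<^esub> \<zero>\<^bsub>V'\<^esub> = v"
      by (metis ex add zero V.M.r_zero V.M.zero_closed)
    show "\<forall>a b v. a \<in> carrier K \<and> b \<in> carrier K \<and> v \<in> carrier V' \<longrightarrow>
        (a \<otimes>\<^bsub>K\<^esub> b) \<odot>\<^bsub>V'\<^esub> v = a \<odot>\<^bsub>V'\<^esub> (b \<odot>\<^bsub>V'\<^esub> v)"
      by (metis ex smult V.smult_assoc1 V.R.m_closed V.smult_closed)
    show "\<forall>v\<in>carrier V'. \<one>\<^bsub>K\<^esub> \<odot>\<^bsub>V'\<^esub> v = v"
      by (metis ex smult V.smult_one V.R.one_closed)
    show "\<forall>a b v. a \<in> carrier K \<and> b \<in> carrier K \<and> v \<in> carrier V' \<longrightarrow>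
        (a \<oplus>\<^bsub>K\<^esub> b) \<odot>\<^bsub>V'\<^esub> v = a \<odot>\<^bsub>V'\<^esub> v \<oplus>\<^bsub>V'\<^esub> b \<odot>\<^bsub>V'\<^esub> v"
      by (metis ex smult add V.smult_l_distr V.R.add.m_closed V.smult_closed)
    show "\<forall>a v w. a \<in> carrier K \<and> v \<in> carrier V' \<and> w \<in> carrier V' \<longrightarrow>
        a \<odot>\<^bsub>V'\<^esub> (v \<oplus>\<^bsub>V'\<^esub> w) = a \<odot>\<^bsub>V'\<^esub> v \<oplus>\<^bsub>V'\<^esub> a \<odot>\<^bsub>V'\<^esub> w"
    proof (intro allI impI, elim conjE)
      fix a v w assume a: "a \<in> carrier K" and "v \<in> carrier V'" "w \<in> carrier V'"
      then obtain v' w' where "v' \<in> carrier V" "w' \<in> carrier V" "v = q v'" "w = q w'"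
        using ex by metis
      then show "a \<odot>\<^bsub>V'\<^esub> (v \<oplus>\<^bsub>V'\<^esub> w) = a \<odot>\<^bsub>V'\<^esub> v \<oplus>\<^bsub>V'\<^esub> a \<odot>\<^bsub>V'\<^esub> w"
        using a by (simp flip: add smult add: V.smult_r_distr)
    qed
  qed
  then interpret V': vectorspace K V' .
  show ?thesis
    by (unfold_locales) (auto simp: module_hom_def im add smult)
qed

lemma linear_mapI:
  assumes "vectorspace K V" "vectorspace K V'"
    and "\<And>v. v \<in> carrier V \<Longrightarrow> f v \<in> carrier V'"
    and "\<And>u v. u \<in> carrier V \<Longrightarrow> v \<in> carrier V \<Longrightarrow> f (u \<oplus>\<^bsub>V\<^esub> v) = f u \<oplus>\<^bsub>V'\<^esub> f v"
    and "\<And>c v. c \<in> carrier K \<Longrightarrow> v \<in> carrier V \<Longrightarrow> f (c \<odot>\<^bsub>V\<^esub> v) = c \<odot>\<^bsub>V'\<^esub> f v"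
  shows "linear_map K V V' f"
proof -
  interpret V: vectorspace K V by fact
  interpret V': vectorspace K V' by fact
  show ?thesis by unfold_locales (auto simp: module_hom_def assms)
qed

lemma linear_map_vectorspaces:
  assumes "linear_map K V W f"
  shows "vectorspace K V" "vectorspace K W"
  using assms by (auto simp: linear_map_def)

lemma linear_map_comp:
  assumes "linear_map K U V f" "linear_map K V W g"
  shows "linear_map K U W (\<lambda>u. g (f u))"
proof -
  interpret f: linear_map K U V f by fact
  interpret g: linear_map K V W g by fact
  show ?thesis
    by (rule linear_mapI) (auto intro: f.V.vectorspace_axioms g.W.vectorspace_axioms)
qed

lemma linear_map_finsum:
  assumes "linear_map K V W f" "g \<in> A \<rightarrow> carrier V"
  shows "f (\<Oplus>\<^bsub>V\<^esub>x\<in>A. g x) = (\<Oplus>\<^bsub>W\<^esub>x\<in>A. f (g x))"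
proof -
  interpret V: vectorspace K V by (rule linear_map_vectorspaces(1)[OF assms(1)])
  interpret f: linear_map K V W f by fact
  show ?thesis using assms(2)
  proof (induction A rule: infinite_finite_induct)
    case (insert a A)
    then show ?case by (simp add: Pi_def V.M.finsum_closed)
  qed auto
qed

lemma free_space_sel:
  assumes "field K"
  shows "carrier (free_space K X) = {f \<in> X \<rightarrow>\<^sub>E carrier K. finite {x \<in> X. f x \<noteq> \<zero>\<^bsub>K\<^esub>}}"
    and "zero (free_space K X) = (\<lambda>x\<in>X. \<zero>\<^bsub>K\<^esub>)"
    and "f \<oplus>\<^bsub>free_space K X\<^esub> g = (\<lambda>x\<in>X. f x \<oplus>\<^bsub>K\<^esub> g x)"
    and "c \<odot>\<^bsub>free_space K X\<^esub> f = (\<lambda>x\<in>X. c \<otimes>\<^bsub>K\<^esub> f x)"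
proof -
  interpret field K by fact
  show "carrier (free_space K X) = {f \<in> X \<rightarrow>\<^sub>E carrier K. finite {x \<in> X. f x \<noteq> \<zero>\<^bsub>K\<^esub>}}"
    "zero (free_space K X) = (\<lambda>x\<in>X. \<zero>\<^bsub>K\<^esub>)"
    "f \<oplus>\<^bsub>free_space K X\<^esub> g = (\<lambda>x\<in>X. f x \<oplus>\<^bsub>K\<^esub> g x)"
    "c \<odot>\<^bsub>free_space K X\<^esub> f = (\<lambda>x\<in>X. c \<otimes>\<^bsub>K\<^esub> f x)"
    by (simp_all add: free_space_def func_space_def)
qed

lemma vectorspace_free_space:
  assumes "field K"
  shows "vectorspace K (free_space K X)"
proof -
  interpret field K by fact
  interpret FS: module K "func_space X" by (rule func_space_is_module)
  have fin: "finite {x \<in> X. h x \<noteq> \<zero>\<^bsub>K\<^esub>}"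
    if "finite {x \<in> X. f x \<noteq> \<zero>\<^bsub>K\<^esub>}" "finite {x \<in> X. g x \<noteq> \<zero>\<^bsub>K\<^esub>}"
      "\<And>x. x \<in> X \<Longrightarrow> f x = \<zero>\<^bsub>K\<^esub> \<Longrightarrow> g x = \<zero>\<^bsub>K\<^esub> \<Longrightarrow> h x = \<zero>\<^bsub>K\<^esub>" for f g h :: "'c \<Rightarrow> 'a"
    using that(3) by (intro finite_subset[OF _ finite_UnI[OF that(1,2)]]) auto
  have "submodule K {f \<in> X \<rightarrow>\<^sub>E carrier K. finite {x \<in> X. f x \<noteq> \<zero>\<^bsub>K\<^esub>}} (func_space X)"
  proof (rule submodule.intro)
    show "module K (func_space X)" by (rule func_space_is_module)
  next
    fix v w assume vw: "v \<in> {f \<in> X \<rightarrow>\<^sub>E carrier K. finite {x \<in> X. f x \<noteq> \<zero>\<^bsub>K\<^esub>}}"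
      "w \<in> {f \<in> X \<rightarrow>\<^sub>E carrier K. finite {x \<in> X. f x \<noteq> \<zero>\<^bsub>K\<^esub>}}"
    have "finite {x \<in> X. (\<lambda>x\<in>X. v x \<oplus>\<^bsub>K\<^esub> w x) x \<noteq> \<zero>\<^bsub>K\<^esub>}"
      by (rule fin[of v w]) (use vw in auto)
    with vw show "v \<oplus>\<^bsub>func_space X\<^esub> w \<in> {f \<in> X \<rightarrow>\<^sub>E carrier K. finite {x \<in> X. f x \<noteq> \<zero>\<^bsub>K\<^esub>}}"
      by (auto simp: func_space_def)
  next
    fix c v assume c: "c \<in> carrier K"
      and v: "v \<in> {f \<in> X \<rightarrow>\<^sub>E carrier K. finite {x \<in> X. f x \<noteq> \<zero>\<^bsub>K\<^esub>}}"
    have "finite {x \<in> X. (\<lambda>x\<in>X. c \<otimes>\<^bsub>K\<^esub> v x) x \<noteq> \<zero>\<^bsub>K\<^esub>}"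
      by (rule fin[of v v]) (use v c in auto)
    with c v show "c \<odot>\<^bsub>func_space X\<^esub> v \<in> {f \<in> X \<rightarrow>\<^sub>E carrier K. finite {x \<in> X. f x \<noteq> \<zero>\<^bsub>K\<^esub>}}"
      by (auto simp: func_space_def)
  qed (auto simp: func_space_def cong: conj_cong)
  then have "module K (free_space K X)"
    unfolding free_space_def by (rule FS.submodule_is_module)
  then show ?thesis
    by (simp add: vectorspace_def field_axioms)
qed

lemma basis_vec_closed:
  assumes "field K"
  shows "basis_vec K X x \<in> carrier (free_space K X)"
proof -
  interpret field K by fact
  have "{y \<in> X. basis_vec K X x y \<noteq> \<zero>\<^bsub>K\<^esub>} \<subseteq> {x}" by (auto simp: basis_vec_def)
  then have "finite {y \<in> X. basis_vec K X x y \<noteq> \<zero>\<^bsub>K\<^esub>}" by (rule finite_subset) simp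
  then show ?thesis by (auto simp: free_space_sel[OF assms] basis_vec_def)
qed

context vectorspace begin

text \<open>The support in the definition of \<open>lin_ext\<close> varies with \<open>u\<close>; to add two values they are
  written as sums over a common finite set.\<close>
lemma lin_ext_superset:
  assumes "finite A" "{x \<in> X. u x \<noteq> \<zero>\<^bsub>K\<^esub>} \<subseteq> A" "A \<subseteq> X" "u \<in> X \<rightarrow> carrier K" "\<phi> \<in> X \<rightarrow> carrier V"
  shows "lin_ext K X V \<phi> u = (\<Oplus>\<^bsub>V\<^esub>x\<in>A. u x \<odot>\<^bsub>V\<^esub> \<phi> x)"
proof -
  have 0: "u x = \<zero>\<^bsub>K\<^esub>" if "x \<in> A - {x \<in> X. u x \<noteq> \<zero>\<^bsub>K\<^esub>}" for x using that assms(3) by blast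
  have cl: "u x \<in> carrier K" "\<phi> x \<in> carrier V" if "x \<in> A" for x using that assms(3-5) by blast+
  show ?thesis
    unfolding lin_ext_def
  proof (rule M.add.finprod_mono_neutral_cong_left[OF assms(1,2)])
    show "u x \<odot>\<^bsub>V\<^esub> \<phi> x = \<zero>\<^bsub>V\<^esub>" if "x \<in> A - {x \<in> X. u x \<noteq> \<zero>\<^bsub>K\<^esub>}" for x
      using 0[OF that] cl(2)[of x] that by simp
    show "(\<lambda>x. u x \<odot>\<^bsub>V\<^esub> \<phi> x) \<in> A \<rightarrow> carrier V" using cl by blast
  qed simp
qed

lemma linear_map_lin_ext:
  assumes "\<phi> \<in> X \<rightarrow> carrier V"
  shows "linear_map K (free_space K X) V (lin_ext K X V \<phi>)"
proof (rule linear_mapI)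
  have F: "field K" by unfold_locales
  note sel = free_space_sel[OF F]
  show "vectorspace K (free_space K X)" by (rule vectorspace_free_space[OF F])
  then interpret F: vectorspace K "free_space K X" .
  show "vectorspace K V" by unfold_locales
  have supp: "finite {x \<in> X. u x \<noteq> \<zero>\<^bsub>K\<^esub>}" "u \<in> X \<rightarrow> carrier K"
    if "u \<in> carrier (free_space K X)" for u
    using that by (auto simp: sel)
  show "lin_ext K X V \<phi> u \<in> carrier V" if "u \<in> carrier (free_space K X)" for u
    using supp[OF that] assms unfolding lin_ext_def
    by (intro M.finsum_closed) (auto simp: Pi_def)
  show "lin_ext K X V \<phi> (u \<oplus>\<^bsub>free_space K X\<^esub> v) = lin_ext K X V \<phi> u \<oplus>\<^bsub>V\<^esub> lin_ext K X V \<phi> v"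
    if u: "u \<in> carrier (free_space K X)" and v: "v \<in> carrier (free_space K X)" for u v
  proof -
    define A where "A = {x \<in> X. u x \<noteq> \<zero>\<^bsub>K\<^esub>} \<union> {x \<in> X. v x \<noteq> \<zero>\<^bsub>K\<^esub>}"
    have fin: "finite A" unfolding A_def using supp[OF u] supp[OF v] by simp
    have AX: "A \<subseteq> X" unfolding A_def by auto
    have uv: "u \<oplus>\<^bsub>free_space K X\<^esub> v \<in> X \<rightarrow> carrier K" using F.M.add.m_closed[OF u v] by (auto simp: sel)
    have 1: "lin_ext K X V \<phi> (u \<oplus>\<^bsub>free_space K X\<^esub> v)
        = (\<Oplus>\<^bsub>V\<^esub>x\<in>A. (u \<oplus>\<^bsub>free_space K X\<^esub> v) x \<odot>\<^bsub>V\<^esub> \<phi> x)"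
      by (rule lin_ext_superset) (use fin AX assms uv in \<open>auto simp: A_def sel\<close>)
    also have "\<dots> = (\<Oplus>\<^bsub>V\<^esub>x\<in>A. u x \<odot>\<^bsub>V\<^esub> \<phi> x \<oplus>\<^bsub>V\<^esub> v x \<odot>\<^bsub>V\<^esub> \<phi> x)"
    proof (rule M.add.finprod_cong')
      fix x assume "x \<in> A"
      then have x: "x \<in> X" using AX by blast
      then have "u x \<in> carrier K" "v x \<in> carrier K" "\<phi> x \<in> carrier V"
        using supp(2)[OF u] supp(2)[OF v] assms by blast+
      then show "(u \<oplus>\<^bsub>free_space K X\<^esub> v) x \<odot>\<^bsub>V\<^esub> \<phi> x = u x \<odot>\<^bsub>V\<^esub> \<phi> x \<oplus>\<^bsub>V\<^esub> v x \<odot>\<^bsub>V\<^esub> \<phi> x"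
        using x by (simp add: sel smult_l_distr)
    next
      show "(\<lambda>x. u x \<odot>\<^bsub>V\<^esub> \<phi> x \<oplus>\<^bsub>V\<^esub> v x \<odot>\<^bsub>V\<^esub> \<phi> x) \<in> A \<rightarrow> carrier V"
        using supp(2)[OF u] supp(2)[OF v] assms AX by blast
    qed simp
    also have "\<dots> = (\<Oplus>\<^bsub>V\<^esub>x\<in>A. u x \<odot>\<^bsub>V\<^esub> \<phi> x) \<oplus>\<^bsub>V\<^esub> (\<Oplus>\<^bsub>V\<^esub>x\<in>A. v x \<odot>\<^bsub>V\<^esub> \<phi> x)"
      using supp[OF u] supp[OF v] assms AX
      by (intro M.add.finprod_multf) (auto simp: Pi_def subset_iff)
    also have "(\<Oplus>\<^bsub>V\<^esub>x\<in>A. u x \<odot>\<^bsub>V\<^esub> \<phi> x) = lin_ext K X V \<phi> u"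
      by (rule lin_ext_superset[symmetric]) (use fin AX assms supp[OF u] in \<open>auto simp: A_def\<close>)
    also have "(\<Oplus>\<^bsub>V\<^esub>x\<in>A. v x \<odot>\<^bsub>V\<^esub> \<phi> x) = lin_ext K X V \<phi> v"
      by (rule lin_ext_superset[symmetric]) (use fin AX assms supp[OF v] in \<open>auto simp: A_def\<close>)
    finally show ?thesis .
  qed
  show "lin_ext K X V \<phi> (c \<odot>\<^bsub>free_space K X\<^esub> u) = c \<odot>\<^bsub>V\<^esub> lin_ext K X V \<phi> u"
    if c: "c \<in> carrier K" and u: "u \<in> carrier (free_space K X)" for c u
  proof -
    define A where "A = {x \<in> X. u x \<noteq> \<zero>\<^bsub>K\<^esub>}"
    have fin: "finite A" unfolding A_def using supp[OF u] by simp
    have AX: "A \<subseteq> X" unfolding A_def by auto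
    have cu: "c \<odot>\<^bsub>free_space K X\<^esub> u \<in> X \<rightarrow> carrier K" using F.smult_closed[OF c u] by (auto simp: sel)
    have 1: "lin_ext K X V \<phi> (c \<odot>\<^bsub>free_space K X\<^esub> u)
        = (\<Oplus>\<^bsub>V\<^esub>x\<in>A. (c \<odot>\<^bsub>free_space K X\<^esub> u) x \<odot>\<^bsub>V\<^esub> \<phi> x)"
      by (rule lin_ext_superset) (use fin AX assms cu c in \<open>auto simp: A_def sel\<close>)
    also have "\<dots> = (\<Oplus>\<^bsub>V\<^esub>x\<in>A. c \<odot>\<^bsub>V\<^esub> (u x \<odot>\<^bsub>V\<^esub> \<phi> x))"
      using supp[OF u] assms AX c
      by (intro M.add.finprod_cong') (auto simp: sel Pi_def subset_iff smult_assoc1)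
    also have "\<dots> = c \<odot>\<^bsub>V\<^esub> (\<Oplus>\<^bsub>V\<^esub>x\<in>A. u x \<odot>\<^bsub>V\<^esub> \<phi> x)"
      using supp[OF u] assms AX c fin
      by (intro finsum_smult[symmetric]) (auto simp: Pi_def subset_iff)
    finally show ?thesis by (simp add: A_def lin_ext_def)
  qed
qed

lemma lin_ext_basis_vec:
  assumes "\<phi> \<in> X \<rightarrow> carrier V" "x \<in> X"
  shows "lin_ext K X V \<phi> (basis_vec K X x) = \<phi> x"
proof -
  have "lin_ext K X V \<phi> (basis_vec K X x) = (\<Oplus>\<^bsub>V\<^esub>y\<in>{x}. basis_vec K X x y \<odot>\<^bsub>V\<^esub> \<phi> y)"
    by (rule lin_ext_superset) (use assms in \<open>auto simp: basis_vec_def\<close>)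
  also have "\<dots> = \<phi> x"
    using assms by (auto simp: basis_vec_def Pi_def)
  finally show ?thesis .
qed

end

lemma free_space_apply_finsum:
  assumes K: "field K" and f: "f \<in> A \<rightarrow> carrier (free_space K X)" and y: "y \<in> X"
  shows "(\<Oplus>\<^bsub>free_space K X\<^esub>x\<in>A. f x) y = (\<Oplus>\<^bsub>K\<^esub>x\<in>A. f x y)"
proof -
  interpret field K by fact
  interpret F: vectorspace K "free_space K X" by (rule vectorspace_free_space[OF K])
  show ?thesis using f
  proof (induction A rule: infinite_finite_induct)
    case (insert a A)
    have "f a y \<in> carrier K" "(\<lambda>x. f x y) \<in> A \<rightarrow> carrier K"
      using insert.prems y by (fastforce simp: free_space_sel[OF K])+
    then show ?case using insert y by (simp add: free_space_sel(3)[OF K])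
  qed (use y in \<open>simp_all add: free_space_sel(2)[OF K]\<close>)
qed

lemma free_space_basis_expansion:
  assumes K: "field K" and u: "u \<in> carrier (free_space K X)"
  shows "lin_ext K X (free_space K X) (basis_vec K X) u = u"
proof (rule ext)
  fix y
  interpret field K by fact
  interpret F: vectorspace K "free_space K X" by (rule vectorspace_free_space[OF K])
  define A where "A = {x \<in> X. u x \<noteq> \<zero>\<^bsub>K\<^esub>}"
  have A: "finite A" "A \<subseteq> X" and uK: "\<And>x. x \<in> X \<Longrightarrow> u x \<in> carrier K" "\<And>x. x \<notin> X \<Longrightarrow> u x = undefined"
    using u by (auto simp: A_def free_space_sel[OF K] PiE_def extensional_def)
  let ?s = "lin_ext K X (free_space K X) (basis_vec K X) u"
  have cl: "(\<lambda>x. u x \<odot>\<^bsub>free_space K X\<^esub> basis_vec K X x) \<in> A \<rightarrow> carrier (free_space K X)"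
    using A uK by (auto intro!: F.smult_closed basis_vec_closed[OF K])
  show "?s y = u y"
  proof (cases "y \<in> X")
    case True
    have "?s y = (\<Oplus>\<^bsub>K\<^esub>x\<in>A. (u x \<odot>\<^bsub>free_space K X\<^esub> basis_vec K X x) y)"
      unfolding lin_ext_def A_def[symmetric] by (rule free_space_apply_finsum[OF K cl True])
    also have "\<dots> = (\<Oplus>\<^bsub>K\<^esub>x\<in>A. if y = x then u x else \<zero>\<^bsub>K\<^esub>)"
      using A True uK by (intro add.finprod_cong') (auto simp: free_space_sel[OF K] basis_vec_def)
    also have "\<dots> = u y"
    proof (cases "y \<in> A")
      case True
      then show ?thesis using A uK by (intro add.finprod_singleton) auto
    next
      case False
      then have "(\<Oplus>\<^bsub>K\<^esub>x\<in>A. if y = x then u x else \<zero>\<^bsub>K\<^esub>) = (\<Oplus>\<^bsub>K\<^esub>x\<in>A. \<zero>\<^bsub>K\<^esub>)"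
        by (intro add.finprod_cong') auto
      then show ?thesis using False True by (simp add: A_def)
    qed
    finally show ?thesis .
  next
    case False
    have "?s \<in> carrier (free_space K X)"
      unfolding lin_ext_def A_def[symmetric] by (rule F.M.finsum_closed[OF cl])
    then show ?thesis using False uK by (auto simp: free_space_sel[OF K] PiE_def extensional_def)
  qed
qed

lemma linear_map_lin_ext_comp:
  assumes g: "linear_map K V W g" and \<phi>: "\<phi> \<in> X \<rightarrow> carrier V" and u: "u \<in> carrier (free_space K X)"
  shows "g (lin_ext K X V \<phi> u) = lin_ext K X W (\<lambda>x. g (\<phi> x)) u"
proof -
  interpret W: vectorspace K W by (rule linear_map_vectorspaces(2)[OF g])
  interpret g: linear_map K V W g by fact
  have K: "field K" by unfold_locales
  have uK: "u \<in> X \<rightarrow> carrier K" using u by (auto simp: free_space_sel[OF K])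
  have "g (lin_ext K X V \<phi> u) = (\<Oplus>\<^bsub>W\<^esub>x\<in>{x \<in> X. u x \<noteq> \<zero>\<^bsub>K\<^esub>}. g (u x \<odot>\<^bsub>V\<^esub> \<phi> x))"
    unfolding lin_ext_def using uK \<phi> by (intro linear_map_finsum[OF g]) auto
  also have "\<dots> = lin_ext K X W (\<lambda>x. g (\<phi> x)) u"
    unfolding lin_ext_def using uK \<phi> by (intro W.M.add.finprod_cong') (auto simp: Pi_def)
  finally show ?thesis .
qed

lemma linear_map_eq_lin_ext:
  assumes K: "linear_map K (free_space K X) V f" and u: "u \<in> carrier (free_space K X)"
  shows "f u = lin_ext K X V (\<lambda>x. f (basis_vec K X x)) u"
proof -
  interpret f: linear_map K "free_space K X" V f by fact
  have K: "field K" by unfold_locales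
  show ?thesis
    using linear_map_lin_ext_comp[OF assms(1) _ u, of "basis_vec K X"]
    by (simp add: free_space_basis_expansion[OF K u] basis_vec_closed[OF K])
qed

lemma linear_maps_eqI:
  assumes f: "linear_map K (free_space K X) V f" and g: "linear_map K (free_space K X) V g"
    and eq: "\<And>x. x \<in> X \<Longrightarrow> f (basis_vec K X x) = g (basis_vec K X x)"
    and u: "u \<in> carrier (free_space K X)"
  shows "f u = g u"
proof -
  interpret V: vectorspace K V by (rule linear_map_vectorspaces(2)[OF f])
  interpret f: linear_map K "free_space K X" V f by fact
  have K: "field K" by unfold_locales
  have uK: "u \<in> X \<rightarrow> carrier K" using u by (auto simp: free_space_sel[OF K])
  show ?thesis
    unfolding linear_map_eq_lin_ext[OF f u] linear_map_eq_lin_ext[OF g u] lin_ext_def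
    using uK eq by (intro V.M.add.finprod_cong') (auto simp: Pi_def basis_vec_closed[OF K] simp flip: eq)
qed

text \<open>The operations on cosets are induced by those on representatives. Hence the coset map respects
  them, and the quotient inherits its vector space structure from \<open>V\<close>.\<close>
lemma linear_map_quot_rep:
  assumes N: "subspace K N V"
  shows "linear_map K V (quot_rep V N) (\<lambda>v. N +>\<^bsub>V\<^esub> v)"
    and "(\<lambda>v. N +>\<^bsub>V\<^esub> v) ` carrier V = carrier (quot_rep V N)"
    and "v \<in> carrier V \<Longrightarrow> N +>\<^bsub>V\<^esub> v = \<zero>\<^bsub>quot_rep V N\<^esub> \<longleftrightarrow> v \<in> N"
proof -
  interpret V: vectorspace K V using N by (rule subspace.vs)
  have sub: "submodule K N V" using N by (rule subspace.submod)
  interpret N: submodule K N V by (rule sub)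
  have NV: "N \<subseteq> carrier V" by (rule N.subset)
  have "additive_subgroup N V"
  proof (rule additive_subgroup.intro, rule V.M.add.subgroupI)
    show "N \<subseteq> carrier V" by (rule NV)
    show "N \<noteq> {}" using N.zero_closed by blast
    show "\<ominus>\<^bsub>V\<^esub> a \<in> N" if "a \<in> N" for a
      using that NV N.smult_closed[of "\<ominus>\<^bsub>K\<^esub> \<one>\<^bsub>K\<^esub>" a] by (auto simp: V.smult_minus_1 subset_iff)
    show "a \<oplus>\<^bsub>V\<^esub> b \<in> N" if "a \<in> N" "b \<in> N" for a b using that by simp
  qed
  then interpret A: abelian_subgroup N V
    by (rule abelian_subgroupI3) unfold_locales
  show surj: "(\<lambda>v. N +>\<^bsub>V\<^esub> v) ` carrier V = carrier (quot_rep V N)"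
    by (auto simp: quot_rep_def quot_space_def module.defs A_RCOSETS_def' a_r_coset_def)
  have r: "c \<odot>\<^bsub>quot_rep V N\<^esub> C = N <+>\<^bsub>V\<^esub> (\<lambda>v. c \<odot>\<^bsub>V\<^esub> v) ` C"
    "C \<oplus>\<^bsub>quot_rep V N\<^esub> D = C <+>\<^bsub>V\<^esub> D" "\<zero>\<^bsub>quot_rep V N\<^esub> = N" for c C D
    by (auto simp: quot_rep_def quot_space_def module.defs)
  show "linear_map K V (quot_rep V N) (\<lambda>v. N +>\<^bsub>V\<^esub> v)"
  proof (rule linear_map_of_surj)
    show "vectorspace K V" by unfold_locales
    show "(\<lambda>v. N +>\<^bsub>V\<^esub> v) ` carrier V = carrier (quot_rep V N)" by (rule surj)
    show "N +>\<^bsub>V\<^esub> (u \<oplus>\<^bsub>V\<^esub> v) = (N +>\<^bsub>V\<^esub> u) \<oplus>\<^bsub>quot_rep V N\<^esub> (N +>\<^bsub>V\<^esub> v)"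
      if "u \<in> carrier V" "v \<in> carrier V" for u v
      using that by (simp add: r A.a_rcos_sum)
    show "N +>\<^bsub>V\<^esub> \<zero>\<^bsub>V\<^esub> = \<zero>\<^bsub>quot_rep V N\<^esub>"
      by (simp add: r V.M.a_coset_add_zero[OF NV])
    show "N +>\<^bsub>V\<^esub> (c \<odot>\<^bsub>V\<^esub> v) = c \<odot>\<^bsub>quot_rep V N\<^esub> (N +>\<^bsub>V\<^esub> v)"
      if c: "c \<in> carrier K" and v: "v \<in> carrier V" for c v
    proof -
      have "N +>\<^bsub>V\<^esub> (c \<odot>\<^bsub>V\<^esub> v) = N <+>\<^bsub>V\<^esub> (\<lambda>v. c \<odot>\<^bsub>V\<^esub> v) ` (N +>\<^bsub>V\<^esub> v)"
      proof (intro equalityI subsetI)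
        fix x assume "x \<in> N +>\<^bsub>V\<^esub> (c \<odot>\<^bsub>V\<^esub> v)"
        then obtain h where h: "h \<in> N" "x = h \<oplus>\<^bsub>V\<^esub> c \<odot>\<^bsub>V\<^esub> v" by (auto simp: a_r_coset_def')
        have "\<zero>\<^bsub>V\<^esub> \<oplus>\<^bsub>V\<^esub> v \<in> N +>\<^bsub>V\<^esub> v" using N.zero_closed unfolding a_r_coset_def' by blast
        then have "c \<odot>\<^bsub>V\<^esub> v \<in> (\<lambda>v. c \<odot>\<^bsub>V\<^esub> v) ` (N +>\<^bsub>V\<^esub> v)" using v by auto
        then show "x \<in> N <+>\<^bsub>V\<^esub> (\<lambda>v. c \<odot>\<^bsub>V\<^esub> v) ` (N +>\<^bsub>V\<^esub> v)"
          using h unfolding set_add_def' by blast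
      next
        fix x assume "x \<in> N <+>\<^bsub>V\<^esub> (\<lambda>v. c \<odot>\<^bsub>V\<^esub> v) ` (N +>\<^bsub>V\<^esub> v)"
        then obtain h h' where h: "h \<in> N" "h' \<in> N" "x = h \<oplus>\<^bsub>V\<^esub> c \<odot>\<^bsub>V\<^esub> (h' \<oplus>\<^bsub>V\<^esub> v)"
          by (auto simp: set_add_def' a_r_coset_def')
        have "x = (h \<oplus>\<^bsub>V\<^esub> c \<odot>\<^bsub>V\<^esub> h') \<oplus>\<^bsub>V\<^esub> c \<odot>\<^bsub>V\<^esub> v"
          unfolding h(3) using c v subsetD[OF NV h(1)] subsetD[OF NV h(2)]
          by (simp add: V.smult_r_distr V.M.add.m_assoc)
        then show "x \<in> N +>\<^bsub>V\<^esub> (c \<odot>\<^bsub>V\<^esub> v)" using h c unfolding a_r_coset_def' by blast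
      qed
      then show ?thesis by (simp add: r)
    qed
  qed
  show "N +>\<^bsub>V\<^esub> v = \<zero>\<^bsub>quot_rep V N\<^esub> \<longleftrightarrow> v \<in> N" if "v \<in> carrier V"
    using that A.a_rcos_self A.a_rcos_const by (auto simp: r)
qed

text \<open>Adding \<open>N\<close> in the definition of the quotient action completes the image of a coset, which may
  be smaller than a coset, and changes nothing else if \<open>N\<close> is invariant.\<close>
lemma act_quot_rep:
  assumes N: "subspace K N V" and f: "linear_map K V V (act V s)"
    and inv: "\<And>v. v \<in> N \<Longrightarrow> act V s v \<in> N" and v: "v \<in> carrier V"
  shows "act (quot_rep V N) s (N +>\<^bsub>V\<^esub> v) = N +>\<^bsub>V\<^esub> act V s v"
proof -
  interpret V: vectorspace K V using N by (rule subspace.vs)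
  interpret f: linear_map K V V "act V s" by fact
  interpret N: submodule K N V using N by (rule subspace.submod)
  have NV: "N \<subseteq> carrier V" by (rule N.subset)
  have "act (quot_rep V N) s (N +>\<^bsub>V\<^esub> v) = N <+>\<^bsub>V\<^esub> act V s ` (N +>\<^bsub>V\<^esub> v)"
    by (simp add: quot_rep_def module.defs rep.defs)
  also have "\<dots> = N +>\<^bsub>V\<^esub> act V s v"
  proof (intro equalityI subsetI)
    fix x assume "x \<in> N <+>\<^bsub>V\<^esub> act V s ` (N +>\<^bsub>V\<^esub> v)"
    then obtain h h' where h: "h \<in> N" "h' \<in> N" "x = h \<oplus>\<^bsub>V\<^esub> act V s (h' \<oplus>\<^bsub>V\<^esub> v)"
      by (auto simp: set_add_def' a_r_coset_def')
    have "x = (h \<oplus>\<^bsub>V\<^esub> act V s h') \<oplus>\<^bsub>V\<^esub> act V s v"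
      unfolding h(3) using v subsetD[OF NV h(1)] subsetD[OF NV h(2)]
      by (simp add: V.M.add.m_assoc)
    then show "x \<in> N +>\<^bsub>V\<^esub> act V s v" using h inv unfolding a_r_coset_def' by blast
  next
    fix x assume "x \<in> N +>\<^bsub>V\<^esub> act V s v"
    then obtain h where h: "h \<in> N" "x = h \<oplus>\<^bsub>V\<^esub> act V s v" by (auto simp: a_r_coset_def')
    have "\<zero>\<^bsub>V\<^esub> \<oplus>\<^bsub>V\<^esub> v \<in> N +>\<^bsub>V\<^esub> v" using N.zero_closed unfolding a_r_coset_def' by blast
    then have "act V s v \<in> act V s ` (N +>\<^bsub>V\<^esub> v)" using v by auto
    then show "x \<in> N <+>\<^bsub>V\<^esub> act V s ` (N +>\<^bsub>V\<^esub> v)"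
      using h unfolding set_add_def' by blast
  qed
  finally show ?thesis .
qed

lemma linear_image_span:
  assumes f: "linear_map K V W f" and A: "A \<subseteq> carrier V" "finite A"
  shows "f ` module.span K V A \<subseteq> module.span K W (f ` A)"
proof -
  interpret V: vectorspace K V by (rule linear_map_vectorspaces(1)[OF f])
  interpret W: vectorspace K W by (rule linear_map_vectorspaces(2)[OF f])
  interpret f: linear_map K V W f by fact
  have fA: "f ` A \<subseteq> carrier W" using A by auto
  have "submodule K {v \<in> carrier V. f v \<in> W.span (f ` A)} V"
  proof -
    interpret S: submodule K "W.span (f ` A)" W by (rule W.span_is_submodule[OF fA])
    show ?thesis by (rule submodule.intro) (auto intro: V.module_axioms)
  qed
  moreover have "A \<subseteq> {v \<in> carrier V. f v \<in> W.span (f ` A)}"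
    using A W.in_own_span[OF fA] by auto
  ultimately show ?thesis using V.span_is_subset by blast
qed

text \<open>Sending \<open>f u\<close> to \<open>g u\<close> is a well defined linear bijection. It carries generating sets to
  generating sets of the same size, and the dimension is by definition the least such size.\<close>
lemma dim_eq_of_same_kernel:
  assumes f: "linear_map K U V f" and f_surj: "f ` carrier U = carrier V"
    and g: "linear_map K U W g" and g_surj: "g ` carrier U = carrier W"
    and ker: "\<And>u. u \<in> carrier U \<Longrightarrow> f u = \<zero>\<^bsub>V\<^esub> \<longleftrightarrow> g u = \<zero>\<^bsub>W\<^esub>"
  shows "vectorspace.dim K V = vectorspace.dim K W"
proof -
  interpret V: vectorspace K V by (rule linear_map_vectorspaces(2)[OF f])
  interpret W: vectorspace K W by (rule linear_map_vectorspaces(2)[OF g])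
  interpret f: linear_map K U V f by fact
  interpret g: linear_map K U W g by fact
  have *: "\<exists>B. finite B \<and> card B = card A \<and> B \<subseteq> carrier W' \<and> module.span K W' B = carrier W'"
    if f': "linear_map K U V' f'" and f'_surj: "f' ` carrier U = carrier V'"
      and g': "linear_map K U W' g'" and g'_surj: "g' ` carrier U = carrier W'"
      and ker': "\<And>u. u \<in> carrier U \<Longrightarrow> f' u = \<zero>\<^bsub>V'\<^esub> \<longleftrightarrow> g' u = \<zero>\<^bsub>W'\<^esub>"
      and A: "finite A" "A \<subseteq> carrier V'" "module.span K V' A = carrier V'"
    for V' :: "('a, 'x, 'y) module_scheme" and W' :: "('a, 'z, 'w) module_scheme" and f' g' A
  proof -
    interpret V': vectorspace K V' by (rule linear_map_vectorspaces(2)[OF f'])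
    interpret W': vectorspace K W' by (rule linear_map_vectorspaces(2)[OF g'])
    interpret f': linear_map K U V' f' by (rule f')
    interpret g': linear_map K U W' g' by (rule g')
    define h where "h v = g' (SOME u. u \<in> carrier U \<and> f' u = v)" for v
    have eq: "f' u = f' u' \<longleftrightarrow> g' u = g' u'" if "u \<in> carrier U" "u' \<in> carrier U" for u u'
      using ker'[of "u \<ominus>\<^bsub>U\<^esub> u'"] that by simp
    have h: "h (f' u) = g' u" if u: "u \<in> carrier U" for u
    proof -
      have "(SOME u'. u' \<in> carrier U \<and> f' u' = f' u) \<in> carrier U \<and>
          f' (SOME u'. u' \<in> carrier U \<and> f' u' = f' u) = f' u"
        by (rule someI[of _ u]) (use u in simp)
      then show ?thesis unfolding h_def using eq u by blast
    qed
    have ex: "\<exists>u\<in>carrier U. v = f' u" if "v \<in> carrier V'" for v using that f'_surj by blast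
    have lin: "linear_map K V' W' h"
    proof (rule linear_mapI)
      show "vectorspace K V'" "vectorspace K W'" by unfold_locales
      show "h v \<in> carrier W'" if "v \<in> carrier V'" for v
        using ex[OF that] h by auto
      show "h (u \<oplus>\<^bsub>V'\<^esub> v) = h u \<oplus>\<^bsub>W'\<^esub> h v" if "u \<in> carrier V'" "v \<in> carrier V'" for u v
        using ex[OF that(1)] ex[OF that(2)] by (auto simp: h simp flip: f'.f_add)
      show "h (c \<odot>\<^bsub>V'\<^esub> v) = c \<odot>\<^bsub>W'\<^esub> h v" if "c \<in> carrier K" "v \<in> carrier V'" for c v
        using ex[OF that(2)] that(1) by (auto simp: h simp flip: f'.f_smult)
    qed
    have surj: "h ` carrier V' = carrier W'"
      using h by (auto simp flip: f'_surj g'_surj simp: image_image)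
    have inj: "inj_on h (carrier V')"
      unfolding inj_on_def using ex h eq by metis
    have hA: "h ` A \<subseteq> carrier W'" using A(2) surj by auto
    interpret h: linear_map K V' W' h by (rule lin)
    have "module.span K W' (h ` A) = carrier W'"
      using linear_image_span[OF lin A(2,1)] surj A(3) W'.span_is_subset2[OF hA] by auto
    moreover have "card (h ` A) = card A"
      using inj A(2) by (intro card_image) (auto intro: inj_on_subset)
    ultimately show ?thesis using A(1) hA by (intro exI[of _ "h ` A"]) auto
  qed
  have "(\<exists>A. finite A \<and> card A = n \<and> A \<subseteq> carrier V \<and> V.span A = carrier V) \<longleftrightarrow>
    (\<exists>A. finite A \<and> card A = n \<and> A \<subseteq> carrier W \<and> W.span A = carrier W)" for n
  proof (intro iffI; elim exE conjE)
    fix A assume A: "finite A" "card A = n" "A \<subseteq> carrier V" "V.span A = carrier V"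
    show "\<exists>A. finite A \<and> card A = n \<and> A \<subseteq> carrier W \<and> W.span A = carrier W"
      using *[OF f f_surj g g_surj ker A(1,3,4)] A(2) by metis
  next
    fix A assume A: "finite A" "card A = n" "A \<subseteq> carrier W" "W.span A = carrier W"
    show "\<exists>A. finite A \<and> card A = n \<and> A \<subseteq> carrier V \<and> V.span A = carrier V"
      using *[OF g g_surj f f_surj ker[symmetric] A(1,3,4)] A(2) by metis
  qed
  then show ?thesis by (simp add: V.dim_def W.dim_def)
qed

lemma linear_mapD:
  assumes "linear_map K V W f"
  shows "v \<in> carrier V \<Longrightarrow> f v \<in> carrier W"
    and "u \<in> carrier V \<Longrightarrow> v \<in> carrier V \<Longrightarrow> f (u \<oplus>\<^bsub>V\<^esub> v) = f u \<oplus>\<^bsub>W\<^esub> f v"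
    and "c \<in> carrier K \<Longrightarrow> v \<in> carrier V \<Longrightarrow> f (c \<odot>\<^bsub>V\<^esub> v) = c \<odot>\<^bsub>W\<^esub> f v"
    and "f \<zero>\<^bsub>V\<^esub> = \<zero>\<^bsub>W\<^esub>"
    and "u \<in> carrier V \<Longrightarrow> v \<in> carrier V \<Longrightarrow> f (u \<ominus>\<^bsub>V\<^esub> v) = f u \<ominus>\<^bsub>W\<^esub> f v"
proof -
  interpret linear_map K V W f by fact
  show "v \<in> carrier V \<Longrightarrow> f v \<in> carrier W"
    "u \<in> carrier V \<Longrightarrow> v \<in> carrier V \<Longrightarrow> f (u \<oplus>\<^bsub>V\<^esub> v) = f u \<oplus>\<^bsub>W\<^esub> f v"
    "c \<in> carrier K \<Longrightarrow> v \<in> carrier V \<Longrightarrow> f (c \<odot>\<^bsub>V\<^esub> v) = c \<odot>\<^bsub>W\<^esub> f v"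
    "f \<zero>\<^bsub>V\<^esub> = \<zero>\<^bsub>W\<^esub>"
    "u \<in> carrier V \<Longrightarrow> v \<in> carrier V \<Longrightarrow> f (u \<ominus>\<^bsub>V\<^esub> v) = f u \<ominus>\<^bsub>W\<^esub> f v"
    by auto
qed

lemma linear_map_scale:
  assumes f: "linear_map K U V f" and c: "c \<in> carrier K"
  shows "linear_map K U V (\<lambda>u. c \<odot>\<^bsub>V\<^esub> f u)"
proof -
  interpret V: vectorspace K V using linear_map_vectorspaces[OF f] by simp
  show ?thesis
    by (rule linear_mapI) (use c in \<open>simp_all add: linear_map_vectorspaces[OF f] linear_mapD[OF f]
        V.smult_r_distr V.smult_assoc1[symmetric] V.R.m_comm\<close>)
qed

lemma linear_map_zero:
  assumes "vectorspace K U" "vectorspace K V"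
  shows "linear_map K U V (\<lambda>u. \<zero>\<^bsub>V\<^esub>)"
proof -
  interpret V: vectorspace K V by fact
  show ?thesis by (rule linear_mapI) (simp_all add: assms)
qed

lemma linear_map_same_space:
  assumes V: "vectorspace K V" and "carrier V' = carrier V" "zero V' = zero V" "add V' = add V"
    "smult V' = smult V"
  shows "linear_map K V V' (\<lambda>v. v)" "linear_map K V' V (\<lambda>v. v)"
proof -
  show 1: "linear_map K V V' (\<lambda>v. v)"
    by (rule linear_map_of_surj[OF V]) (simp_all add: assms)
  show "linear_map K V' V (\<lambda>v. v)"
    by (rule linear_map_of_surj[OF linear_map_vectorspaces(2)[OF 1]]) (simp_all add: assms)
qed

lemma subspaceI:
  assumes V: "vectorspace K V" and "N \<subseteq> carrier V" "\<zero>\<^bsub>V\<^esub> \<in> N"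
    and "\<And>u v. u \<in> N \<Longrightarrow> v \<in> N \<Longrightarrow> u \<oplus>\<^bsub>V\<^esub> v \<in> N"
    and "\<And>c v. c \<in> carrier K \<Longrightarrow> v \<in> N \<Longrightarrow> c \<odot>\<^bsub>V\<^esub> v \<in> N"
  shows "subspace K N V"
proof (rule subspace.intro[OF V])
  interpret V: vectorspace K V by (rule V)
  show "submodule K N V" by (rule submodule.intro) (use assms in \<open>auto intro: V.module_axioms\<close>)
qed

lemma subspaceD:
  assumes "subspace K N V"
  shows "N \<subseteq> carrier V" "\<zero>\<^bsub>V\<^esub> \<in> N"
    "u \<in> N \<Longrightarrow> v \<in> N \<Longrightarrow> u \<oplus>\<^bsub>V\<^esub> v \<in> N"
    "c \<in> carrier K \<Longrightarrow> v \<in> N \<Longrightarrow> c \<odot>\<^bsub>V\<^esub> v \<in> N"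
proof -
  interpret submodule K N V using assms by (rule subspace.submod)
  show "N \<subseteq> carrier V" "\<zero>\<^bsub>V\<^esub> \<in> N"
    "u \<in> N \<Longrightarrow> v \<in> N \<Longrightarrow> u \<oplus>\<^bsub>V\<^esub> v \<in> N"
    "c \<in> carrier K \<Longrightarrow> v \<in> N \<Longrightarrow> c \<odot>\<^bsub>V\<^esub> v \<in> N"
    by (auto intro: subset[THEN subsetD])
qed

lemma subspace_finsum:
  assumes N: "subspace K N V" and f: "f \<in> A \<rightarrow> N"
  shows "(\<Oplus>\<^bsub>V\<^esub>x\<in>A. f x) \<in> N"
proof -
  interpret V: vectorspace K V using N by (rule subspace.vs)
  note N' = subspaceD[OF N]
  show ?thesis using f
  proof (induction A rule: infinite_finite_induct)
    case (insert a A)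
    then have "f \<in> A \<rightarrow> carrier V" "f a \<in> carrier V" using N'(1) by auto
    then show ?case using insert N'(3) by simp
  qed (simp_all add: N')
qed

lemma subspace_same_space:
  assumes N: "subspace K N V" and V': "vectorspace K V'"
    and "carrier V' = carrier V" "zero V' = zero V" "add V' = add V" "smult V' = smult V"
  shows "subspace K N V'"
  by (rule subspaceI[OF V']) (use subspaceD[OF N] in \<open>simp_all add: assms\<close>)

lemma rep_radical_unique_maximal:
  assumes M: "subrep K S V M" "M \<noteq> carrier V"
    and le: "\<And>N. subrep K S V N \<Longrightarrow> N \<noteq> carrier V \<Longrightarrow> N \<subseteq> M"
  shows "rep_radical K S V = M"
proof -
  have "maximal_subrep K S V M"
    using M le unfolding maximal_subrep_def by blast
  moreover have "N = M" if "maximal_subrep K S V N" for N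
    using that M le unfolding maximal_subrep_def by metis
  ultimately have "{N. maximal_subrep K S V N} = {M}" by blast
  moreover have "M \<subseteq> carrier V" using M(1) subspaceD(1) unfolding subrep_def by blast
  ultimately show ?thesis unfolding rep_radical_def by auto
qed

text \<open>Both quotients are images of \<open>W\<close>, and in both cases the kernel is \<open>R\<close>.\<close>
lemma dim_head_transfer:
  assumes \<sigma>: "linear_map K W T \<sigma>" and surj: "\<sigma> ` carrier W = carrier T"
    and inj: "inj_on \<sigma> (carrier W)"
    and R: "R \<subseteq> carrier W" and M: "subspace K (\<sigma> ` R) T"
    and W': "linear_map K W W' (\<lambda>v. v)" "carrier W' = carrier W" and R': "subspace K R W'"
  shows "vectorspace.dim K (quot_rep T (\<sigma> ` R)) = vectorspace.dim K (quot_rep W' R)"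
proof (rule dim_eq_of_same_kernel)
  show "linear_map K W (quot_rep T (\<sigma> ` R)) (\<lambda>w. \<sigma> ` R +>\<^bsub>T\<^esub> \<sigma> w)"
    by (rule linear_map_comp[OF \<sigma> linear_map_quot_rep(1)[OF M]])
  show "(\<lambda>w. \<sigma> ` R +>\<^bsub>T\<^esub> \<sigma> w) ` carrier W = carrier (quot_rep T (\<sigma> ` R))"
    unfolding linear_map_quot_rep(2)[OF M, symmetric] surj[symmetric] by (simp add: image_image)
  show "linear_map K W (quot_rep W' R) (\<lambda>w. R +>\<^bsub>W'\<^esub> w)"
    by (rule linear_map_comp[OF W'(1) linear_map_quot_rep(1)[OF R']])
  show "(\<lambda>w. R +>\<^bsub>W'\<^esub> w) ` carrier W = carrier (quot_rep W' R)"
    unfolding linear_map_quot_rep(2)[OF R', symmetric] W'(2) ..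
  show "\<sigma> ` R +>\<^bsub>T\<^esub> \<sigma> u = \<zero>\<^bsub>quot_rep T (\<sigma> ` R)\<^esub> \<longleftrightarrow> R +>\<^bsub>W'\<^esub> u = \<zero>\<^bsub>quot_rep W' R\<^esub>"
    if u: "u \<in> carrier W" for u
  proof -
    have "\<sigma> u \<in> \<sigma> ` R \<longleftrightarrow> u \<in> R" using inj_on_image_mem_iff[OF inj u R] .
    then show ?thesis
      using linear_map_quot_rep(3)[OF M linear_mapD(1)[OF \<sigma> u]] linear_map_quot_rep(3)[OF R', of u] u W'(2)
      by simp
  qed
qed

section \<open>Connected components of a family of sets\<close>

definition arc_rel :: "'a set set \<Rightarrow> 'a rel" where
  "arc_rel H = {(u, v). \<exists>e\<in>H. u \<in> e \<and> v \<in> e}"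

text \<open>The members of \<open>H\<close> are hyperedges, and these are the connected components of the hypergraph.\<close>
definition comps :: "'a set set \<Rightarrow> 'a set set" where
  "comps H = \<Union>H // (arc_rel H)\<^sup>+"

definition saturated :: "'a set set \<Rightarrow> 'a set \<Rightarrow> bool" where
  "saturated H T \<longleftrightarrow> (\<forall>e\<in>H. e \<inter> T \<noteq> {} \<longrightarrow> e \<subseteq> T)"

lemma components_eq: "components a b = comps (glued a b)"
  by (simp add: components_def comps_def arc_rel_def)

lemma equiv_arc_rel: "equiv (\<Union>H) ((arc_rel H)\<^sup>+)"
proof (rule equivI)
  show "(arc_rel H)\<^sup>+ \<subseteq> \<Union>H \<times> \<Union>H"
    by (rule trancl_subset_Sigma) (auto simp: arc_rel_def)
  show "refl_on (\<Union>H) ((arc_rel H)\<^sup>+)"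
    by (auto simp: refl_on_def arc_rel_def intro!: r_into_trancl)
  have "sym (arc_rel H)" by (auto simp: sym_def arc_rel_def)
  then show "sym ((arc_rel H)\<^sup>+)" by (rule sym_trancl)
  show "trans ((arc_rel H)\<^sup>+)" by (rule trans_trancl)
qed

lemma partition_on_comps: "partition_on (\<Union>H) (comps H)"
  unfolding comps_def by (rule partition_on_quotient[OF equiv_arc_rel])

lemma saturated_reach:
  assumes "(u, v) \<in> (arc_rel H)\<^sup>+" "saturated H T" "u \<in> T"
  shows "v \<in> T"
  using assms(1) by (induction rule: trancl_induct) (use assms(2,3) in \<open>auto simp: arc_rel_def saturated_def\<close>)

text \<open>The components are the minimal nonempty saturated sets. In what follows, two points are shown
  to be connected by constructing suitable saturated sets; this avoids inductions along paths.\<close>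
lemma comps_iff:
  "D \<in> comps H \<longleftrightarrow> D \<noteq> {} \<and> D \<subseteq> \<Union>H \<and> saturated H D \<and>
     (\<forall>T. saturated H T \<longrightarrow> D \<inter> T \<noteq> {} \<longrightarrow> D \<subseteq> T)" (is "_ \<longleftrightarrow> ?R D")
proof -
  have *: "?R ((arc_rel H)\<^sup>+ `` {u})" if u: "u \<in> \<Union>H" for u
  proof (intro conjI allI impI)
    have uu: "(u, u) \<in> (arc_rel H)\<^sup>+" using u by (auto simp: arc_rel_def)
    then show "(arc_rel H)\<^sup>+ `` {u} \<noteq> {}" by auto
    show "(arc_rel H)\<^sup>+ `` {u} \<subseteq> \<Union>H"
      using equiv_arc_rel[of H] by (auto simp: equiv_def)
    show "saturated H ((arc_rel H)\<^sup>+ `` {u})"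
      by (auto simp: saturated_def arc_rel_def intro: trancl_into_trancl)
    show "(arc_rel H)\<^sup>+ `` {u} \<subseteq> T"
      if T: "saturated H T" and ne: "(arc_rel H)\<^sup>+ `` {u} \<inter> T \<noteq> {}" for T
    proof -
      from ne obtain v where v: "(u, v) \<in> (arc_rel H)\<^sup>+" "v \<in> T" by auto
      have "(v, u) \<in> (arc_rel H)\<^sup>+"
        using equiv_arc_rel[of H] v by (auto simp: equiv_def dest: symD)
      then have "u \<in> T" using saturated_reach T v by metis
      then show ?thesis using saturated_reach T by (metis Image_singleton_iff subsetI)
    qed
  qed
  show ?thesis
  proof
    assume "D \<in> comps H"
    then show "?R D" using * unfolding comps_def by (metis quotientE)
  next
    assume D: "?R D"
    then obtain u where u: "u \<in> D" "u \<in> \<Union>H" by blast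
    let ?C = "(arc_rel H)\<^sup>+ `` {u}"
    have "u \<in> ?C" using u by (auto simp: arc_rel_def)
    then have "D = ?C" using D *[OF u(2)] u(1) by (metis disjoint_iff subset_antisym)
    then show "D \<in> comps H" unfolding comps_def using u(2) by (simp add: quotientI)
  qed
qed

lemma comps_saturated: "D \<in> comps H \<Longrightarrow> e \<in> H \<Longrightarrow> x \<in> e \<Longrightarrow> x \<in> D \<Longrightarrow> y \<in> e \<Longrightarrow> y \<in> D"
  by (auto simp: comps_iff saturated_def)

lemma comps_disjoint: "D \<in> comps H \<Longrightarrow> D' \<in> comps H \<Longrightarrow> x \<in> D \<Longrightarrow> x \<in> D' \<Longrightarrow> D = D'"
  using partition_on_comps[of H] by (auto simp: partition_on_def disjoint_def)

lemma comps_cover: "e \<in> H \<Longrightarrow> x \<in> e \<Longrightarrow> \<exists>D\<in>comps H. x \<in> D"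
  using partition_on_comps[of H] by (auto simp: partition_on_def)

lemma partition_on_subset_eq:
  assumes "partition_on A P" "partition_on A Q" "P \<subseteq> Q"
  shows "P = Q"
proof
  show "Q \<subseteq> P"
  proof
    fix X assume X: "X \<in> Q"
    then have "X \<noteq> {}" using partition_onD3[OF assms(2)] by metis
    then obtain x where x: "x \<in> X" by blast
    then have "x \<in> \<Union>P" using X partition_onD1[OF assms(1)] partition_onD1[OF assms(2)] by blast
    then obtain Y where Y: "Y \<in> P" "x \<in> Y" by blast
    then have "Y \<in> Q" using assms(3) by blast
    then have "X = Y" using partition_onD2[OF assms(2)] X x Y by (meson disjointD disjoint_iff)
    then show "X \<in> P" using Y by simp
  qed
qed fact

lemma finite_comps: "finite (\<Union>H) \<Longrightarrow> finite (comps H)"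
  using finite_elements[OF _ partition_on_comps] by metis

lemma comps_image:
  assumes g: "inj g"
  shows "comps ((`) g ` H) = (`) g ` comps H"
proof (rule sym, rule partition_on_subset_eq)
  show "partition_on (\<Union>((`) g ` H)) (comps ((`) g ` H))" by (rule partition_on_comps)
  have "partition_on (g ` \<Union>H) ((`) g ` comps H - {{}})"
    by (rule partition_on_inj_image[OF partition_on_comps inj_on_subset[OF g subset_UNIV]])
  moreover have "{} \<notin> (`) g ` comps H" by (auto simp: comps_iff)
  ultimately show "partition_on (\<Union>((`) g ` H)) ((`) g ` comps H)"
    by (simp add: image_Union)
  show "(`) g ` comps H \<subseteq> comps ((`) g ` H)"
  proof safe
    fix D assume D: "D \<in> comps H"
    have "g ` D \<subseteq> T" if T: "saturated ((`) g ` H) T" "g ` D \<inter> T \<noteq> {}" for T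
    proof -
      have "saturated H (g -` T)"
        unfolding saturated_def
      proof (intro ballI impI)
        fix e assume e: "e \<in> H" "e \<inter> g -` T \<noteq> {}"
        then have "g ` e \<inter> T \<noteq> {}" by blast
        then have "g ` e \<subseteq> T" using T(1) e(1) by (simp add: saturated_def)
        then show "e \<subseteq> g -` T" by blast
      qed
      moreover have "D \<inter> g -` T \<noteq> {}" using T(2) by auto
      ultimately have "D \<subseteq> g -` T" using D by (auto simp: comps_iff)
      then show ?thesis by auto
    qed
    moreover have "saturated ((`) g ` H) (g ` D)"
      unfolding saturated_def
    proof (intro ballI impI)
      fix f assume f: "f \<in> (`) g ` H" "f \<inter> g ` D \<noteq> {}"
      then obtain e x where e: "e \<in> H" "f = g ` e" "x \<in> e" "x \<in> D" using g by (auto dest: injD)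
      then have "e \<subseteq> D" using comps_saturated[OF D] by blast
      then show "f \<subseteq> g ` D" using e by blast
    qed
    moreover have "g ` D \<subseteq> \<Union>((`) g ` H)" "g ` D \<noteq> {}"
      using D image_mono[of D "\<Union>H" g] by (auto simp: comps_iff image_Union)
    ultimately show "g ` D \<in> comps ((`) g ` H)"
      unfolding comps_iff[of "g ` D"] by blast
  qed
qed

text \<open>The traces of the components on \<open>S\<close>. Deleting the middle points after gluing two diagrams is
  of this form, with \<open>S\<close> the set of outer points.\<close>
definition contract :: "'a set set \<Rightarrow> 'a set \<Rightarrow> 'a set set" where
  "contract H S = {D \<inter> S | D. D \<in> comps H \<and> D \<inter> S \<noteq> {}}"

text \<open>In a glued diagram with \<open>S\<close> the set of outer points, these are the closed loops.\<close>
definition inner :: "'a set set \<Rightarrow> 'a set \<Rightarrow> 'a set set" where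
  "inner H S = {D \<in> comps H. D \<inter> S = {}}"

lemma contract_altdef: "contract H S = (\<lambda>D. D \<inter> S) ` comps H - {{}}"
  by (auto simp: contract_def)

text \<open>If the hyperedges in \<open>G\<close> meet those in \<open>H\<close> only within \<open>S\<close>, then for connections between
  points of \<open>S\<close> and points of \<open>G\<close> only the traces on \<open>S\<close> of the components of \<open>H\<close> matter. So
  \<open>H\<close> may be contracted before \<open>G\<close> is attached. What gets lost are the components of \<open>H\<close> that
  miss \<open>S\<close>, and no others.\<close>
context
  fixes G H :: "'a set set" and S V :: "'a set"
  assumes GH: "\<Union>G \<inter> \<Union>H \<subseteq> S"
  defines "V \<equiv> (\<Union>H \<inter> S) \<union> \<Union>G"
begin

lemma Union_contract: "\<Union>(contract H S \<union> G) = V"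
proof -
  have "\<Union>(contract H S) = \<Union>(comps H) \<inter> S" unfolding contract_def by blast
  then show ?thesis using partition_onD1[OF partition_on_comps[of H]] by (simp add: V_def)
qed

lemma comps_contract_mem:
  assumes D: "D \<in> comps (H \<union> G)" and ne: "D \<inter> V \<noteq> {}"
  shows "D \<inter> V \<in> comps (contract H S \<union> G)"
  unfolding comps_iff
proof (intro conjI allI impI)
  show "D \<inter> V \<noteq> {}" by fact
  show "D \<inter> V \<subseteq> \<Union>(contract H S \<union> G)" unfolding Union_contract by simp
  have satH: "saturated H D" and satG: "saturated G D" using D by (auto simp: comps_iff saturated_def)
  show "saturated (contract H S \<union> G) (D \<inter> V)"
    unfolding saturated_def
  proof (intro ballI impI)
    fix f assume f: "f \<in> contract H S \<union> G" "f \<inter> (D \<inter> V) \<noteq> {}"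
    then have "f \<subseteq> V" using Union_contract by blast
    moreover have "f \<subseteq> D"
    proof (cases "f \<in> G")
      case True
      then show ?thesis using satG f(2) by (auto simp: saturated_def)
    next
      case False
      then obtain C where C: "C \<in> comps H" "f = C \<inter> S" using f(1) by (auto simp: contract_def)
      then have "C \<inter> D \<noteq> {}" using f(2) by blast
      then have "C \<subseteq> D" using C(1) satH by (auto simp: comps_iff)
      then show ?thesis using C by blast
    qed
    ultimately show "f \<subseteq> D \<inter> V" by blast
  qed
  fix T' assume T': "saturated (contract H S \<union> G) T'" and neT': "D \<inter> V \<inter> T' \<noteq> {}"
  \<comment> \<open>The least set saturated for \<open>H\<close> that contains the points of \<open>T'\<close> in \<open>V\<close>; it has
    no further points in \<open>V\<close>.\<close>
  define T where "T = (T' \<inter> V) \<union> \<Union>{C \<in> comps H. C \<inter> S \<inter> T' \<noteq> {}}"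
  have CT': "C \<inter> S \<subseteq> T'" if "C \<in> comps H" "C \<inter> S \<inter> T' \<noteq> {}" for C
  proof -
    have "C \<inter> S \<in> contract H S \<union> G" using that unfolding contract_def by blast
    from T'[unfolded saturated_def, THEN bspec, OF this] that(2) show ?thesis by simp
  qed
  have TV: "T \<inter> V \<subseteq> T'"
  proof
    fix v assume v: "v \<in> T \<inter> V"
    show "v \<in> T'"
    proof (cases "v \<in> T'")
      case False
      then obtain C where C: "C \<in> comps H" "C \<inter> S \<inter> T' \<noteq> {}" "v \<in> C" using v by (auto simp: T_def)
      have "v \<in> \<Union>H" using C by (auto simp: comps_iff)
      then have "v \<in> S" using v GH by (auto simp: V_def)
      then show ?thesis using CT'[OF C(1,2)] C(3) by auto
    qed
  qed
  have "saturated (H \<union> G) T"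
    unfolding saturated_def
  proof (intro ballI impI)
    fix f assume f: "f \<in> H \<union> G" "f \<inter> T \<noteq> {}"
    then obtain v where v: "v \<in> f" "v \<in> T" by auto
    show "f \<subseteq> T"
    proof (cases "f \<in> G")
      case True
      then have "v \<in> T'" using v TV by (auto simp: V_def)
      then have "f \<subseteq> T'" using True v T' by (auto simp: saturated_def)
      then show ?thesis using True by (auto simp: T_def V_def)
    next
      case False
      then have fH: "f \<in> H" using f by simp
      then obtain C where C: "C \<in> comps H" "v \<in> C" using v comps_cover by metis
      have "C \<inter> S \<inter> T' \<noteq> {}"
      proof (cases "v \<in> T' \<inter> V")
        case True
        then have "v \<in> S" using GH fH v by (auto simp: V_def)
        then show ?thesis using True C by auto
      next
        case False
        then obtain C' where "C' \<in> comps H" "C' \<inter> S \<inter> T' \<noteq> {}" "v \<in> C'" using v by (auto simp: T_def)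
        then show ?thesis using C comps_disjoint by metis
      qed
      moreover have "f \<subseteq> C" using C fH v comps_saturated by (metis subsetI)
      ultimately show ?thesis using C by (auto simp: T_def)
    qed
  qed
  moreover have "D \<inter> T \<noteq> {}" using neT' by (auto simp: T_def)
  ultimately have "D \<subseteq> T" using D by (auto simp: comps_iff)
  then show "D \<inter> V \<subseteq> T'" using TV by auto
qed

lemma comps_contract: "comps (contract H S \<union> G) = (\<lambda>D. D \<inter> V) ` comps (H \<union> G) - {{}}"
proof (intro equalityI subsetI)
  fix C assume C: "C \<in> comps (contract H S \<union> G)"
  then obtain v where v: "v \<in> C" "v \<in> V" using Union_contract unfolding comps_iff by blast
  then obtain D where D: "D \<in> comps (H \<union> G)" "v \<in> D"
    using comps_cover[of _ "H \<union> G" v] by (auto simp: V_def)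
  then have "C = D \<inter> V" using comps_contract_mem[OF D(1)] C v comps_disjoint by (metis Int_iff empty_iff)
  then show "C \<in> (\<lambda>D. D \<inter> V) ` comps (H \<union> G) - {{}}" using D v by auto
qed (use comps_contract_mem in auto)

lemma contract_contract:
  assumes W: "W \<inter> \<Union>H \<subseteq> S"
  shows "contract (contract H S \<union> G) W = contract (H \<union> G) W"
proof -
  have *: "D \<inter> W = D \<inter> V \<inter> W" if "D \<in> comps (H \<union> G)" for D
    using that W by (auto simp: comps_iff V_def)
  have "contract (contract H S \<union> G) W = (\<lambda>D. D \<inter> V \<inter> W) ` comps (H \<union> G) - {{}}"
    unfolding contract_altdef[of _ W] comps_contract by auto
  also have "\<dots> = contract (H \<union> G) W"
    unfolding contract_altdef by (rule arg_cong2[where f = "(-)"], rule image_cong) (simp_all flip: *)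
  finally show ?thesis .
qed

lemma inner_contract:
  assumes W: "W \<inter> \<Union>H \<subseteq> S" and fin: "finite (\<Union>(H \<union> G))"
  shows "card (inner (H \<union> G) W) = card (inner H S) + card (inner (contract H S \<union> G) W)"
proof -
  have *: "D \<inter> W = D \<inter> V \<inter> W" if "D \<in> comps (H \<union> G)" for D
    using that W by (auto simp: comps_iff V_def)
  have 1: "inner H S = {D \<in> comps (H \<union> G). D \<inter> V = {}}"
  proof (intro equalityI subsetI)
    fix D assume "D \<in> inner H S"
    then have D: "D \<in> comps H" "D \<inter> S = {}" by (auto simp: inner_def)
    have "D \<subseteq> \<Union>H" using D by (auto simp: comps_iff)
    then have DG: "D \<inter> \<Union>G = {}" using D GH by blast
    then have "D \<in> comps (H \<union> G)"
      unfolding comps_iff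
    proof (intro conjI allI impI)
      show "D \<noteq> {}" "D \<subseteq> \<Union>(H \<union> G)" using D by (auto simp: comps_iff)
      show "saturated (H \<union> G) D"
        unfolding saturated_def using DG comps_saturated[OF D(1)] by blast
      show "D \<subseteq> T" if "saturated (H \<union> G) T" "D \<inter> T \<noteq> {}" for T
      proof -
        have "saturated H T" using that(1) by (simp add: saturated_def)
        then show ?thesis using D(1) that(2) by (simp add: comps_iff)
      qed
    qed
    moreover have "D \<inter> V = {}" using D DG by (auto simp: V_def)
    ultimately show "D \<in> {D \<in> comps (H \<union> G). D \<inter> V = {}}" by simp
  next
    fix D assume "D \<in> {D \<in> comps (H \<union> G). D \<inter> V = {}}"
    then have D: "D \<in> comps (H \<union> G)" and DV: "D \<inter> V = {}" by auto
    have DG: "D \<inter> \<Union>G = {}" using DV by (auto simp: V_def)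
    have DH: "D \<subseteq> \<Union>H" using D DG by (auto simp: comps_iff)
    have satD: "saturated H D" using D by (auto simp: comps_iff saturated_def)
    have "D \<subseteq> T" if T: "saturated H T" "D \<inter> T \<noteq> {}" for T
    proof -
      have "saturated (H \<union> G) (D \<inter> T)"
        unfolding saturated_def
      proof (intro ballI impI)
        fix f assume f: "f \<in> H \<union> G" "f \<inter> (D \<inter> T) \<noteq> {}"
        then have "f \<in> H" using DG by blast
        then have "f \<subseteq> T" "f \<subseteq> D" using T(1) satD f(2) unfolding saturated_def by blast+
        then show "f \<subseteq> D \<inter> T" by blast
      qed
      moreover have "D \<inter> (D \<inter> T) \<noteq> {}" using T by auto
      ultimately have "D \<subseteq> D \<inter> T" using D unfolding comps_iff by blast
      then show ?thesis by auto
    qed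
    then have "D \<in> comps H" using D DH satD by (auto simp: comps_iff)
    moreover have "D \<inter> S = {}" using DV DH by (auto simp: V_def)
    ultimately show "D \<in> inner H S" by (simp add: inner_def)
  qed
  define B where "B = {D \<in> comps (H \<union> G). D \<inter> V \<noteq> {} \<and> D \<inter> W = {}}"
  have 2: "inner (H \<union> G) W = inner H S \<union> B"
  proof -
    have "D \<inter> V = {} \<Longrightarrow> D \<inter> W = {}" if "D \<in> comps (H \<union> G)" for D using *[OF that] by simp
    then show ?thesis unfolding 1 B_def unfolding inner_def by blast
  qed
  have "inner (contract H S \<union> G) W = (\<lambda>D. D \<inter> V) ` B"
  proof -
    have "inner (contract H S \<union> G) W
        = (\<lambda>D. D \<inter> V) ` {D \<in> comps (H \<union> G). D \<inter> V \<noteq> {} \<and> D \<inter> V \<inter> W = {}}"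
      unfolding inner_def comps_contract by blast
    also have "{D \<in> comps (H \<union> G). D \<inter> V \<noteq> {} \<and> D \<inter> V \<inter> W = {}} = B"
      unfolding B_def by (rule Collect_cong) (simp cong: conj_cong flip: *)
    finally show ?thesis .
  qed
  moreover have "inj_on (\<lambda>D. D \<inter> V) B"
  proof (rule inj_onI)
    fix D D' assume D: "D \<in> B" "D' \<in> B" "D \<inter> V = D' \<inter> V"
    have "D \<inter> V \<noteq> {}" using D(1) by (simp add: B_def)
    then obtain v where "v \<in> D" "v \<in> D'" using D(3) by blast
    moreover have "D \<in> comps (H \<union> G)" "D' \<in> comps (H \<union> G)" using D by (simp_all add: B_def)
    ultimately show "D = D'" using comps_disjoint by metis
  qed
  ultimately have 3: "card (inner (contract H S \<union> G) W) = card B" by (simp add: card_image)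
  have "finite (comps (H \<union> G))" by (rule finite_comps[OF fin])
  then have "finite (inner H S)" "finite B" by (auto simp: 1 B_def)
  moreover have "inner H S \<inter> B = {}" unfolding 1 B_def by auto
  ultimately show ?thesis unfolding 2 3 by (rule card_Un_disjoint)
qed

end

section \<open>Gluing is associative and counts loops consistently\<close>

fun place :: "nat \<Rightarrow> nat \<Rightarrow> pt \<Rightarrow> nat \<times> nat" where
  "place i j (Bot x) = (i, x)"
| "place i j (Top x) = (j, x)"

fun place_glued :: "nat \<Rightarrow> nat \<Rightarrow> nat \<Rightarrow> glued_pt \<Rightarrow> nat \<times> nat" where
  "place_glued i j k (LowerPt x) = (i, x)"
| "place_glued i j k (MiddlePt x) = (j, x)"
| "place_glued i j k (UpperPt x) = (k, x)"

text \<open>The end points of a diagram are put on numbered levels of $\mathbb{N}\times\mathbb{N}$. This gives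
  a common ambient type to stacks of any number of diagrams.\<close>
definition placed :: "nat \<Rightarrow> nat \<Rightarrow> matching \<Rightarrow> (nat \<times> nat) set set" where
  "placed i j a = (`) (place i j) ` a"

definition levels :: "nat \<Rightarrow> nat \<Rightarrow> (nat \<times> nat) set" where
  "levels i j = {i, j} \<times> UNIV"

lemma inj_place: "i \<noteq> j \<Longrightarrow> inj (place i j)"
proof (rule injI)
  fix x y assume "i \<noteq> j" "place i j x = place i j y"
  then show "x = y" by (cases x; cases y) auto
qed

lemma inj_place_glued: "i \<noteq> j \<Longrightarrow> j \<noteq> k \<Longrightarrow> i \<noteq> k \<Longrightarrow> inj (place_glued i j k)"
proof (rule injI)
  fix x y assume "i \<noteq> j" "j \<noteq> k" "i \<noteq> k" "place_glued i j k x = place_glued i j k y"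
  then show "x = y" by (cases x; cases y) auto
qed

lemma place_glued_halves:
  "place_glued i j k (upper_half x) = place j k x"
  "place_glued i j k (lower_half x) = place i j x"
  "place_glued i j k (outer x) = place i k x"
  by (cases x; simp)+

lemma placed_glued: "(`) (place_glued i j k) ` glued a b = placed j k a \<union> placed i j b"
  by (simp add: glued_def placed_def image_Un image_image place_glued_halves)

lemma place_outer:
  assumes "i \<noteq> j" "j \<noteq> k" "i \<noteq> k"
  shows "place_glued i j k ` C \<inter> levels i k = place i k ` (outer -` C)"
proof (intro equalityI subsetI)
  fix p assume "p \<in> place_glued i j k ` C \<inter> levels i k"
  then obtain c where c: "c \<in> C" "p = place_glued i j k c" "p \<in> levels i k" by auto
  then obtain x where "c = outer x"
    using assms by (cases c) (auto simp: levels_def, metis outer.simps(1), metis outer.simps(2))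
  then show "p \<in> place i k ` (outer -` C)" using c by (auto simp: place_glued_halves)
next
  fix p assume "p \<in> place i k ` (outer -` C)"
  then obtain x where x: "outer x \<in> C" "p = place i k x" by auto
  have "place i k x \<in> levels i k" by (cases x) (auto simp: levels_def)
  then show "p \<in> place_glued i j k ` C \<inter> levels i k"
    using x place_glued_halves(3)[of i j k x] by (metis IntI image_eqI)
qed

lemma placed_diagram_mult:
  assumes "i \<noteq> j" "j \<noteq> k" "i \<noteq> k"
  shows "placed i k (diagram_mult a b) = contract (placed j k a \<union> placed i j b) (levels i k)"
proof -
  have "diagram_mult a b = (\<lambda>C. outer -` C) ` comps (glued a b) - {{}}"
    by (auto simp: diagram_mult_def components_eq)
  then have "placed i k (diagram_mult a b)
      = (\<lambda>C. place i k ` (outer -` C)) ` comps (glued a b) - {{}}"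
    by (auto simp: placed_def)
  also have "\<dots> = contract ((`) (place_glued i j k) ` glued a b) (levels i k)"
    by (simp add: contract_altdef comps_image[OF inj_place_glued[OF assms]] image_image
        place_outer[OF assms])
  finally show ?thesis by (simp add: placed_glued)
qed

lemma loops_placed:
  assumes "i \<noteq> j" "j \<noteq> k" "i \<noteq> k"
  shows "loops a b = card (inner (placed j k a \<union> placed i j b) (levels i k))"
proof -
  have "inner (placed j k a \<union> placed i j b) (levels i k)
      = (`) (place_glued i j k) ` {C \<in> components a b. outer -` C = {}}"
  proof -
    have "{D \<in> f ` X. P D} = f ` {C \<in> X. P (f C)}" for f :: "glued_pt set \<Rightarrow> (nat \<times> nat) set" and X P
      by blast
    then show ?thesis
      by (simp add: inner_def placed_glued[symmetric] comps_image[OF inj_place_glued[OF assms]]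
          place_outer[OF assms] components_eq)
  qed
  moreover have "inj_on ((`) (place_glued i j k)) X" for X
    using inj_image_eq_iff[OF inj_place_glued[OF assms]] by (simp add: inj_on_def)
  ultimately show ?thesis by (simp add: loops_def card_image)
qed

lemma inj_placed: "i \<noteq> j \<Longrightarrow> placed i j a = placed i j b \<Longrightarrow> a = b"
proof -
  assume ij: "i \<noteq> j" and eq: "placed i j a = placed i j b"
  have "inj ((`) (place i j))"
    using inj_image_eq_iff[OF inj_place[OF ij]] by (simp add: inj_on_def)
  then show "a = b" using eq by (simp add: placed_def inj_image_eq_iff)
qed

lemma Union_placed_levels: "\<Union>(placed i j a) \<subseteq> levels i j"
proof -
  have "place i j x \<in> levels i j" for x by (cases x) (auto simp: levels_def)
  then show ?thesis by (auto simp: placed_def)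
qed

lemma finite_Union_placed: "finite (\<Union>a) \<Longrightarrow> finite (\<Union>(placed i j a))"
  by (simp add: placed_def flip: image_Union)

text \<open>Let \<open>a\<close>, \<open>b\<close> and \<open>c\<close> connect the levels 3, 2, 1 and 0, from top to bottom. Both bracketings
  describe the components of this picture, seen on the levels 0 and 3. A closed loop in it is
  deleted by the inner multiplication if it avoids the outer levels of this multiplication,
  and by the outer multiplication otherwise.\<close>
lemma diagram_mult_assoc:
  "diagram_mult (diagram_mult a b) c = diagram_mult a (diagram_mult b c)" (is ?mult)
  and loops_assoc:
  "\<lbrakk>finite (\<Union>a); finite (\<Union>b); finite (\<Union>c)\<rbrakk> \<Longrightarrow>
     loops a b + loops (diagram_mult a b) c = loops b c + loops a (diagram_mult b c)"
proof -
  define A where "A = placed 2 3 a"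
  define B where "B = placed 1 2 b"
  define C where "C = placed 0 1 c"
  have A: "\<Union>A \<subseteq> levels 2 3" and B: "\<Union>B \<subseteq> levels 1 2" and C: "\<Union>C \<subseteq> levels 0 1"
    unfolding A_def B_def C_def by (rule Union_placed_levels)+
  have 1: "\<Union>C \<inter> \<Union>(A \<union> B) \<subseteq> levels 1 3" "levels 0 3 \<inter> \<Union>(A \<union> B) \<subseteq> levels 1 3"
    and 2: "\<Union>A \<inter> \<Union>(B \<union> C) \<subseteq> levels 0 2" "levels 0 3 \<inter> \<Union>(B \<union> C) \<subseteq> levels 0 2"
  proof -
    have "levels 0 1 \<inter> (levels 2 3 \<union> levels 1 2) \<subseteq> levels 1 3"
      "levels 0 3 \<inter> (levels 2 3 \<union> levels 1 2) \<subseteq> levels 1 3"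
      "levels 2 3 \<inter> (levels 1 2 \<union> levels 0 1) \<subseteq> levels 0 2"
      "levels 0 3 \<inter> (levels 1 2 \<union> levels 0 1) \<subseteq> levels 0 2"
      by (auto simp: levels_def)
    then show "\<Union>C \<inter> \<Union>(A \<union> B) \<subseteq> levels 1 3" "levels 0 3 \<inter> \<Union>(A \<union> B) \<subseteq> levels 1 3"
      "\<Union>A \<inter> \<Union>(B \<union> C) \<subseteq> levels 0 2" "levels 0 3 \<inter> \<Union>(B \<union> C) \<subseteq> levels 0 2"
      unfolding Union_Un_distrib using A B C by blast+
  qed
  have ab: "placed 1 3 (diagram_mult a b) = contract (A \<union> B) (levels 1 3)"
    unfolding A_def B_def by (rule placed_diagram_mult) simp_all
  have bc: "placed 0 2 (diagram_mult b c) = contract (B \<union> C) (levels 0 2)"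
    unfolding B_def C_def by (rule placed_diagram_mult) simp_all
  have abc: "A \<union> B \<union> C = B \<union> C \<union> A" by auto
  have "placed 0 3 (diagram_mult (diagram_mult a b) c)
      = contract (contract (A \<union> B) (levels 1 3) \<union> C) (levels 0 3)"
    unfolding ab[symmetric] C_def by (rule placed_diagram_mult) simp_all
  also have "\<dots> = contract (A \<union> B \<union> C) (levels 0 3)"
    by (rule contract_contract[OF 1])
  also have "\<dots> = contract (contract (B \<union> C) (levels 0 2) \<union> A) (levels 0 3)"
    unfolding abc by (rule contract_contract[OF 2, symmetric])
  also have "\<dots> = placed 0 3 (diagram_mult a (diagram_mult b c))"
    unfolding bc[symmetric] A_def Un_commute[of _ "placed 2 3 a"]
    by (rule placed_diagram_mult[symmetric]) simp_all
  finally show ?mult by (rule inj_placed[rotated]) simp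
  assume fin: "finite (\<Union>a)" "finite (\<Union>b)" "finite (\<Union>c)"
  then have fin': "finite (\<Union>(A \<union> B \<union> C))" unfolding A_def B_def C_def
    by (simp add: finite_Union_placed del: finite_Union)
  have "loops a b + loops (diagram_mult a b) c = card (inner (A \<union> B) (levels 1 3))
      + card (inner (contract (A \<union> B) (levels 1 3) \<union> C) (levels 0 3))"
    unfolding ab[symmetric] unfolding A_def B_def C_def
    by (subst loops_placed[of 1 2 3], simp_all, subst loops_placed[of 0 1 3], simp_all)
  also have "\<dots> = card (inner (A \<union> B \<union> C) (levels 0 3))"
    by (rule inner_contract[OF 1 fin', symmetric])
  also have "\<dots> = card (inner (B \<union> C) (levels 0 2))
      + card (inner (contract (B \<union> C) (levels 0 2) \<union> A) (levels 0 3))"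
    unfolding abc by (rule inner_contract[OF 2 fin'[unfolded abc]])
  also have "\<dots> = loops b c + loops a (diagram_mult b c)"
    unfolding bc[symmetric] unfolding A_def B_def C_def Un_commute[of _ "placed 2 3 a"]
    by (subst loops_placed[of 0 1 2 b c], simp_all, subst loops_placed[of 0 2 3], simp_all)
  finally show "loops a b + loops (diagram_mult a b) c = loops b c + loops a (diagram_mult b c)" .
qed

lemma placed_reflect: "placed i j (reflect a) = placed j i a"
proof -
  have "place i j (flip_pt x) = place j i x" for x by (cases x) auto
  then show ?thesis by (simp add: placed_def reflect_def image_image)
qed

text \<open>Reflection reverses the numbering of the levels.\<close>
lemma reflect_diagram_mult: "reflect (diagram_mult a b) = diagram_mult (reflect b) (reflect a)"
  and loops_reflect: "loops (reflect b) (reflect a) = loops a b"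
proof -
  have lev: "levels 2 0 = levels 0 2" by (auto simp: levels_def)
  have "placed 0 2 (reflect (diagram_mult a b)) = placed 0 2 (diagram_mult (reflect b) (reflect a))"
    using placed_diagram_mult[of 2 1 0 a b] placed_diagram_mult[of 0 1 2 "reflect b" "reflect a"]
    by (simp add: placed_reflect lev Un_commute)
  then show "reflect (diagram_mult a b) = diagram_mult (reflect b) (reflect a)"
    by (rule inj_placed[rotated]) simp
  show "loops (reflect b) (reflect a) = loops a b"
    using loops_placed[of 2 1 0 a b] loops_placed[of 0 1 2 "reflect b" "reflect a"]
    by (simp add: placed_reflect lev Un_commute)
qed

lemma reflect_reflect [simp]: "reflect (reflect a) = a"
proof -
  have "flip_pt (flip_pt x) = x" for x by (cases x) auto
  then show ?thesis by (simp add: reflect_def image_image)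
qed

section \<open>Products of crossingless matchings are crossingless\<close>

text \<open>A connected graph with $v$ vertices has at least $v-1$ edges: after the choice of a root \<open>u\<close>, map
  every other vertex to the last edge of a shortest path from \<open>u\<close>. This map is injective, as
  the distances from \<open>u\<close> of the two end points of such an edge differ.\<close>
lemma card_component_le:
  assumes D: "D \<in> comps H" and fin: "finite D" and two: "\<And>e. e \<in> H \<Longrightarrow> card e = 2"
  shows "card D \<le> card {e \<in> H. e \<subseteq> D} + 1"
proof -
  obtain u where u: "u \<in> D" using D by (auto simp: comps_iff)
  define reach where "reach n v \<longleftrightarrow> (u, v) \<in> arc_rel H ^^ n" for n v
  define d where "d v = (LEAST n. reach n v)" for v
  have reach_d: "reach (d v) v" and d_le: "\<And>n. reach n v \<Longrightarrow> d v \<le> n" if "v \<in> D" for v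
  proof -
    have "saturated H {v. (u, v) \<in> (arc_rel H)\<^sup>*}"
      by (auto simp: saturated_def arc_rel_def intro: rtrancl_into_rtrancl)
    moreover have "u \<in> {v. (u, v) \<in> (arc_rel H)\<^sup>*}" by simp
    ultimately have "D \<subseteq> {v. (u, v) \<in> (arc_rel H)\<^sup>*}"
      using D u unfolding comps_iff by blast
    then have "\<exists>n. reach n v" using that by (auto simp: reach_def dest: rtrancl_imp_relpow)
    then show "reach (d v) v" unfolding d_def by (rule LeastI_ex)
    show "d v \<le> n" if "reach n v" for n using that unfolding d_def by (rule Least_le)
  qed
  have "\<exists>w. {v, w} \<in> H \<and> {v, w} \<subseteq> D \<and> d w < d v" if v: "v \<in> D - {u}" for v
  proof -
    have r: "(u, v) \<in> arc_rel H ^^ d v" using reach_d v by (simp add: reach_def)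
    then obtain m where m: "d v = Suc m" using v by (cases "d v") auto
    then obtain w where w: "reach m w" "(w, v) \<in> arc_rel H" using r by (auto simp: reach_def)
    then obtain e where e: "e \<in> H" "w \<in> e" "v \<in> e" by (auto simp: arc_rel_def)
    have eD: "e \<subseteq> D" using comps_saturated[OF D] e v by blast
    have dw: "d w < d v" using d_le[OF _ w(1)] e eD m by auto
    then have "w \<noteq> v" by auto
    then have "e = {v, w}"
      using two[OF e(1)] e by (auto simp: card_2_iff)
    then show ?thesis using e(1) eD dw by blast
  qed
  then obtain g where g: "\<And>v. v \<in> D - {u} \<Longrightarrow> {v, g v} \<in> H \<and> {v, g v} \<subseteq> D \<and> d (g v) < d v"
    by metis
  define f where "f v = {v, g v}" for v
  have "inj_on f (D - {u})"
  proof (rule inj_onI)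
    fix v w assume vw: "v \<in> D - {u}" "w \<in> D - {u}" "f v = f w"
    have "v = w \<or> (v = g w \<and> w = g v)"
      using vw(3) by (auto simp: f_def doubleton_eq_iff)
    moreover have "d (g v) < d v" "d (g w) < d w" using g vw(1,2) by blast+
    ultimately show "v = w" by (metis less_asym)
  qed
  moreover have "f ` (D - {u}) \<subseteq> {e \<in> H. e \<subseteq> D}"
    using g by (auto simp: f_def simp del: insert_subset)
  moreover have "finite {e \<in> H. e \<subseteq> D}" using fin by (auto intro: finite_subset[of _ "Pow D"])
  ultimately have "card (D - {u}) \<le> card {e \<in> H. e \<subseteq> D}" by (rule card_inj_on_le)
  then show ?thesis using u fin by simp
qed

lemma bdry_irrefl [simp]: "\<not> bdry_less x x"
  by (cases x) auto

lemma bdry_trans: "bdry_less x y \<Longrightarrow> bdry_less y z \<Longrightarrow> bdry_less x z"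
  by (cases x; cases y; cases z) auto

lemma bdry_total: "x \<noteq> y \<Longrightarrow> bdry_less x y \<or> bdry_less y x"
  by (cases x; cases y) auto

lemma bdry_not_less: "x \<noteq> y \<Longrightarrow> bdry_less y x \<longleftrightarrow> \<not> bdry_less x y"
  using bdry_total[of x y] bdry_trans[of x y x] by auto

text \<open>The parity of this number replaces planar topology. For two disjoint arcs it is odd if and
  only if they interlace on the boundary. As the number is additive in both arguments, its
  parity is also known for disjoint unions of arcs of one crossingless matching.\<close>
definition forward_pairs :: "pt set \<Rightarrow> pt set \<Rightarrow> nat" where
  "forward_pairs A B = (\<Sum>x\<in>A. \<Sum>y\<in>B. of_bool (bdry_less x y))"

lemma arc_ordered:
  assumes "card e = 2"
  obtains x x' where "e = {x, x'}" "bdry_less x x'" "x \<noteq> x'"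
  using assms bdry_total unfolding card_2_iff by (metis insert_commute)

lemma forward_pairs_arcs:
  "x \<noteq> x' \<Longrightarrow> y \<noteq> y' \<Longrightarrow> forward_pairs {x, x'} {y, y'} =
    of_bool (bdry_less x y) + of_bool (bdry_less x y') +
    (of_bool (bdry_less x' y) + of_bool (bdry_less x' y'))"
  by (simp add: forward_pairs_def)

lemma noncrossingD:
  assumes "noncrossing M" "e \<in> M" "f \<in> M" "x \<in> e" "x' \<in> e" "y \<in> f" "y' \<in> f"
  shows "\<not> (bdry_less x y \<and> bdry_less y x' \<and> bdry_less x' y')"
  using assms unfolding noncrossing_def by metis

lemma even_forward_pairs_arcs:
  assumes M: "noncrossing M" and e: "e \<in> M" "card e = 2" and f: "f \<in> M" "card f = 2"
    and disj: "e \<inter> f = {}"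
  shows "even (forward_pairs e f)"
proof -
  obtain x x' where x: "e = {x, x'}" "bdry_less x x'" "x \<noteq> x'" using arc_ordered[OF e(2)] .
  obtain y y' where y: "f = {y, y'}" "bdry_less y y'" "y \<noteq> y'" using arc_ordered[OF f(2)] .
  have 1: "\<not> (bdry_less x y \<and> bdry_less y x' \<and> bdry_less x' y')"
    and 2: "\<not> (bdry_less y x \<and> bdry_less x y' \<and> bdry_less y' x')"
    using noncrossingD[OF M e(1) f(1)] noncrossingD[OF M f(1) e(1)] x(1) y(1) by (metis insertCI)+
  have ne: "x \<noteq> y" "x \<noteq> y'" "x' \<noteq> y" "x' \<noteq> y'" using disj x(1) y(1) by auto
  have t: "bdry_less y x \<longleftrightarrow> \<not> bdry_less x y" "bdry_less y' x' \<longleftrightarrow> \<not> bdry_less x' y'"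
    "bdry_less y x' \<longleftrightarrow> \<not> bdry_less x' y"
    using bdry_not_less[OF ne(1)] bdry_not_less[OF ne(4)] bdry_not_less[OF ne(3)] by blast+
  have tr: "bdry_less x y \<Longrightarrow> bdry_less x y'" "bdry_less x' y \<Longrightarrow> bdry_less x' y'"
    "bdry_less x' y \<Longrightarrow> bdry_less x y" "bdry_less x' y' \<Longrightarrow> bdry_less x y'"
    using x(2) y(2) by (auto intro: bdry_trans)
  show ?thesis
    unfolding x(1) y(1) forward_pairs_arcs[OF x(3) y(3)]
    using 1 2 t tr
    by (cases "bdry_less x y"; cases "bdry_less x' y"; cases "bdry_less x y'"; cases "bdry_less x' y'") auto
qed

lemma odd_forward_pairs_crossing:
  assumes "bdry_less x y" "bdry_less y x'" "bdry_less x' y'" "card e = 2" "card f = 2"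
    "x \<in> e" "x' \<in> e" "y \<in> f" "y' \<in> f"
  shows "odd (forward_pairs e f)"
proof -
  have lt: "bdry_less x x'" "bdry_less y y'" "bdry_less x y'" using assms(1-3) bdry_trans by metis+
  have ne: "x \<noteq> x'" "y \<noteq> y'" using lt by auto
  have e: "e = {x, x'}" using assms(4,6,7) ne(1) by (auto simp: card_2_iff)
  have f: "f = {y, y'}" using assms(5,8,9) ne(2) by (auto simp: card_2_iff)
  have "\<not> bdry_less x' y" using assms(2) bdry_trans bdry_irrefl by metis
  then show ?thesis unfolding e f forward_pairs_arcs[OF ne] using assms(1-3) lt by simp
qed

lemma forward_pairs_Union:
  assumes "finite \<alpha>" "finite \<beta>" "disjoint \<alpha>" "disjoint \<beta>"
    "\<And>e. e \<in> \<alpha> \<union> \<beta> \<Longrightarrow> finite e"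
  shows "forward_pairs (\<Union>\<alpha>) (\<Union>\<beta>) = (\<Sum>e\<in>\<alpha>. \<Sum>f\<in>\<beta>. forward_pairs e f)"
proof -
  have U: "sum h (\<Union>\<gamma>) = (\<Sum>e\<in>\<gamma>. sum h e)" if "\<gamma> = \<alpha> \<or> \<gamma> = \<beta>" for h :: "pt \<Rightarrow> nat" and \<gamma>
  proof -
    have "disjoint \<gamma>" "\<forall>e\<in>\<gamma>. finite e" using that assms by auto
    then show ?thesis
      by (subst sum.Union_disjoint) (auto simp: disjoint_def)
  qed
  show ?thesis
    unfolding forward_pairs_def by (simp add: U) (simp add: sum.swap[of _ \<beta>])
qed

definition less_pairs :: "nat set \<Rightarrow> nat set \<Rightarrow> nat" where
  "less_pairs A B = (\<Sum>x\<in>A. \<Sum>y\<in>B. of_bool (x < y))"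

lemma less_pairs_swap:
  assumes "finite A" "finite B" "A \<inter> B = {}"
  shows "less_pairs A B + less_pairs B A = card A * card B"
proof -
  have "less_pairs A B + less_pairs B A = (\<Sum>x\<in>A. \<Sum>y\<in>B. of_bool (x < y) + of_bool (y < x))"
    unfolding less_pairs_def sum.swap[of _ A B] by (simp add: sum.distrib sum.swap[of _ B A])
  also have "\<dots> = (\<Sum>x\<in>A. \<Sum>y\<in>B. 1)"
    using assms(3) by (intro sum.cong refl) (auto simp: neq_iff)
  finally show ?thesis by simp
qed

text \<open>The boundary order runs through the top points backwards, which exchanges the arguments of
  the last term.\<close>
lemma forward_pairs_split:
  assumes "finite L" "finite M" "finite L'" "finite M'"
  shows "forward_pairs (Bot ` L \<union> Top ` M) (Bot ` L' \<union> Top ` M')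
    = less_pairs L L' + card L * card M' + less_pairs M' M"
proof -
  have S: "sum h (Bot ` X \<union> Top ` Y) = (\<Sum>x\<in>X. h (Bot x)) + (\<Sum>y\<in>Y. h (Top y))"
    if "finite X" "finite Y" for h :: "pt \<Rightarrow> nat" and X Y
    using that by (subst sum.union_disjoint) (auto simp: sum.reindex inj_on_def)
  show ?thesis
    unfolding forward_pairs_def less_pairs_def
    by (simp add: S assms sum.distrib sum.swap[of _ M M'] del: sum_of_bool_eq)
qed

lemma crossinglessD:
  assumes "x \<in> crossingless p q"
  shows "partition_on (points p q) x" "\<Union>x = points p q" "e \<in> x \<Longrightarrow> card e = 2" "noncrossing x"
    "finite x" "finite (\<Union>x)" "e \<in> x \<Longrightarrow> finite e" "disjoint x"
proof -
  show 1: "partition_on (points p q) x" and "e \<in> x \<Longrightarrow> card e = 2" "noncrossing x"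
    using assms by (auto simp: crossingless_def)
  show u: "\<Union>x = points p q" using partition_onD1[OF 1] by simp
  have fin: "finite (points p q)" by (simp add: points_def)
  show "finite x" using finite_elements[OF fin 1] .
  show "finite (\<Union>x)" unfolding u by (rule fin)
  then show "e \<in> x \<Longrightarrow> finite e" by (meson Union_upper finite_subset)
  show "disjoint x" using partition_onD2[OF 1] .
qed

lemma points_simps [simp]:
  "Bot i \<in> points p q \<longleftrightarrow> i \<in> {1..p}" "Top i \<in> points p q \<longleftrightarrow> i \<in> {1..q}"
  by (auto simp: points_def)

lemma inj_halves: "inj upper_half" "inj lower_half"
proof -
  show "inj upper_half"
  proof (rule injI)
    fix x y assume "upper_half x = upper_half y" then show "x = y" by (cases x; cases y) auto
  qed
  show "inj lower_half"
  proof (rule injI)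
    fix x y assume "lower_half x = lower_half y" then show "x = y" by (cases x; cases y) auto
  qed
qed

lemma half_eq_iff [simp]:
  "LowerPt i = lower_half x \<longleftrightarrow> x = Bot i" "MiddlePt i = lower_half x \<longleftrightarrow> x = Top i"
  "UpperPt i = lower_half x \<longleftrightarrow> False"
  "LowerPt i = upper_half x \<longleftrightarrow> False" "MiddlePt i = upper_half x \<longleftrightarrow> x = Bot i"
  "UpperPt i = upper_half x \<longleftrightarrow> x = Top i"
  by (cases x; auto)+

lemma in_half_image [simp]:
  "LowerPt i \<in> lower_half ` e \<longleftrightarrow> Bot i \<in> e" "MiddlePt i \<in> lower_half ` e \<longleftrightarrow> Top i \<in> e"
  "UpperPt i \<notin> lower_half ` e"
  "LowerPt i \<notin> upper_half ` e" "MiddlePt i \<in> upper_half ` e \<longleftrightarrow> Bot i \<in> e"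
  "UpperPt i \<in> upper_half ` e \<longleftrightarrow> Top i \<in> e"
  by (auto simp: image_iff)

lemma Union_glued:
  assumes "a \<in> crossingless q r" "b \<in> crossingless p q"
  shows "\<Union>(glued a b) = LowerPt ` {1..p} \<union> MiddlePt ` {1..q} \<union> UpperPt ` {1..r}"
proof -
  have "\<Union>(glued a b) = upper_half ` points q r \<union> lower_half ` points p q"
    unfolding glued_def by (simp add: crossinglessD(2)[OF assms(1), symmetric]
      crossinglessD(2)[OF assms(2), symmetric] image_Union)
  then show ?thesis by (auto simp: points_def image_Un image_image)
qed

lemma finite_component:
  assumes "a \<in> crossingless q r" "b \<in> crossingless p q" "D \<in> components a b"
  shows "finite D"
proof -
  have "D \<subseteq> \<Union>(glued a b)" using assms(3) by (simp add: components_eq comps_iff)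
  then show ?thesis unfolding Union_glued[OF assms(1,2)] by (rule finite_subset) simp
qed

text \<open>A middle point belongs to an arc of \<open>b\<close> as well as to an arc of \<open>a\<close>, so both halves of a
  component are unions of complete arcs.\<close>
lemma half_vimage_component:
  assumes a: "a \<in> crossingless q r" and b: "b \<in> crossingless p q" and D: "D \<in> components a b"
  shows "lower_half -` D = \<Union>{e \<in> b. lower_half ` e \<subseteq> D}"
    and "upper_half -` D = \<Union>{e \<in> a. upper_half ` e \<subseteq> D}"
proof -
  have D': "D \<in> comps (glued a b)" using D by (simp add: components_eq)
  have sub: "D \<subseteq> LowerPt ` {1..p} \<union> MiddlePt ` {1..q} \<union> UpperPt ` {1..r}"
    using D' Union_glued[OF a b] by (simp add: comps_iff)
  show "lower_half -` D = \<Union>{e \<in> b. lower_half ` e \<subseteq> D}"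
  proof (intro equalityI subsetI)
    fix x assume x: "x \<in> lower_half -` D"
    then have "lower_half x \<in> LowerPt ` {1..p} \<union> MiddlePt ` {1..q} \<union> UpperPt ` {1..r}"
      using sub by blast
    then have "x \<in> points p q" by (cases x) auto
    then obtain e where e: "e \<in> b" "x \<in> e" using crossinglessD(2)[OF b] by blast
    have "lower_half ` e \<in> glued a b" using e by (auto simp: glued_def)
    then have "lower_half ` e \<subseteq> D" using comps_saturated[OF D'] e x by blast
    then show "x \<in> \<Union>{e \<in> b. lower_half ` e \<subseteq> D}" using e by blast
  qed auto
  show "upper_half -` D = \<Union>{e \<in> a. upper_half ` e \<subseteq> D}"
  proof (intro equalityI subsetI)
    fix x assume x: "x \<in> upper_half -` D"
    then have "upper_half x \<in> LowerPt ` {1..p} \<union> MiddlePt ` {1..q} \<union> UpperPt ` {1..r}"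
      using sub by blast
    then have "x \<in> points q r" by (cases x) auto
    then obtain e where e: "e \<in> a" "x \<in> e" using crossinglessD(2)[OF a] by blast
    have "upper_half ` e \<in> glued a b" using e by (auto simp: glued_def)
    then have "upper_half ` e \<subseteq> D" using comps_saturated[OF D'] e x by blast
    then show "x \<in> \<Union>{e \<in> a. upper_half ` e \<subseteq> D}" using e by blast
  qed auto
qed

lemma half_vimage_split:
  "lower_half -` D = Bot ` {i. LowerPt i \<in> D} \<union> Top ` {i. MiddlePt i \<in> D}"
  "upper_half -` D = Bot ` {i. MiddlePt i \<in> D} \<union> Top ` {i. UpperPt i \<in> D}"
  "outer -` D = Bot ` {i. LowerPt i \<in> D} \<union> Top ` {i. UpperPt i \<in> D}"
proof -
  have *: "f -` D = Bot ` {i. f (Bot i) \<in> D} \<union> Top ` {i. f (Top i) \<in> D}" for f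
  proof (rule Set.set_eqI)
    fix x show "x \<in> f -` D \<longleftrightarrow> x \<in> Bot ` {i. f (Bot i) \<in> D} \<union> Top ` {i. f (Top i) \<in> D}"
      by (cases x) auto
  qed
  show "lower_half -` D = Bot ` {i. LowerPt i \<in> D} \<union> Top ` {i. MiddlePt i \<in> D}"
  "upper_half -` D = Bot ` {i. MiddlePt i \<in> D} \<union> Top ` {i. UpperPt i \<in> D}"
  "outer -` D = Bot ` {i. LowerPt i \<in> D} \<union> Top ` {i. UpperPt i \<in> D}"
    by (simp_all add: *[of lower_half] *[of upper_half] *[of outer])
qed

lemma finite_levels:
  assumes "finite D"
  shows "finite {i. LowerPt i \<in> D}" "finite {i. MiddlePt i \<in> D}" "finite {i. UpperPt i \<in> D}"
proof -
  have "finite (f -` D)" if "inj f" for f :: "nat \<Rightarrow> glued_pt"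
    by (rule finite_vimageI[OF assms that])
  from this[of LowerPt] this[of MiddlePt] this[of UpperPt]
  show "finite {i. LowerPt i \<in> D}" "finite {i. MiddlePt i \<in> D}" "finite {i. UpperPt i \<in> D}"
    by (simp_all add: inj_on_def vimage_def)
qed

lemma card_split: "finite L \<Longrightarrow> finite M \<Longrightarrow> card (Bot ` L \<union> Top ` M) = card L + card M"
  by (subst card_Un_disjoint) (auto simp: card_image inj_on_def)

lemma card_Union_arcs:
  assumes "x \<in> crossingless p q" "F \<subseteq> x"
  shows "card (\<Union>F) = 2 * card F"
proof -
  have "card (\<Union>F) = sum card F"
    using assms crossinglessD[OF assms(1)]
    by (intro card_Union_disjoint) (auto simp: pairwise_def disjoint_def disjnt_def subset_iff)
  also have "\<dots> = 2 * card F"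
    using assms crossinglessD(3)[OF assms(1)] by (simp add: subset_iff)
  finally show ?thesis .
qed

text \<open>A component is either a path between two outer points or a closed loop. Middle points have
  degree two and outer points degree one, so there are $m+(l+u)/2$ edges. A connected graph
  with $l+m+u$ vertices has at least $l+m+u-1$ edges, which leaves at most two outer points.\<close>
lemma component_counts:
  fixes D
  assumes a: "a \<in> crossingless q r" and b: "b \<in> crossingless p q" and D: "D \<in> components a b"
  defines "l \<equiv> card {i. LowerPt i \<in> D}" and "m \<equiv> card {i. MiddlePt i \<in> D}"
    and "u \<equiv> card {i. UpperPt i \<in> D}"
  shows "even (l + m)" "even (m + u)" "l + u \<le> 2"
proof -
  define A where "A = {e \<in> a. upper_half ` e \<subseteq> D}"
  define B where "B = {e \<in> b. lower_half ` e \<subseteq> D}"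
  have finD: "finite D" using finite_component[OF a b D] .
  note fin = finite_levels[OF finD]
  have lm: "l + m = 2 * card B"
    using card_Union_arcs[OF b, of B] half_vimage_component(1)[OF a b D] card_split[OF fin(1,2)]
    by (simp add: B_def l_def m_def half_vimage_split)
  have mu: "m + u = 2 * card A"
    using card_Union_arcs[OF a, of A] half_vimage_component(2)[OF a b D] card_split[OF fin(2,3)]
    by (simp add: A_def m_def u_def half_vimage_split)
  show "even (l + m)" "even (m + u)" using lm mu by simp_all
  have "D = LowerPt ` {i. LowerPt i \<in> D} \<union> MiddlePt ` {i. MiddlePt i \<in> D} \<union> UpperPt ` {i. UpperPt i \<in> D}"
    (is "D = ?R")
  proof (rule Set.set_eqI)
    fix x show "x \<in> D \<longleftrightarrow> x \<in> ?R" by (cases x) auto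
  qed
  then have "card D = card ?R" by (rule arg_cong)
  also have "\<dots> = l + m + u"
    using fin by (subst card_Un_disjoint; (subst card_Un_disjoint)?)
      (auto simp: card_image inj_on_def l_def m_def u_def)
  finally have cD: "card D = l + m + u" .
  have two: "card e = 2" if "e \<in> glued a b" for e
  proof -
    have "card (h ` f) = card f" if "inj h" for h :: "pt \<Rightarrow> glued_pt" and f
      using that by (intro card_image) (simp add: inj_on_def)
    then show ?thesis
      using that crossinglessD(3)[OF a] crossinglessD(3)[OF b] inj_halves unfolding glued_def by auto
  qed
  have "{e \<in> glued a b. e \<subseteq> D} = (`) upper_half ` A \<union> (`) lower_half ` B"
    by (auto simp: glued_def A_def B_def)
  moreover have "finite A" "finite B" using crossinglessD(5)[OF a] crossinglessD(5)[OF b]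
    by (simp_all add: A_def B_def)
  ultimately have "card {e \<in> glued a b. e \<subseteq> D} \<le> card A + card B"
    using card_Un_le[of "(`) upper_half ` A" "(`) lower_half ` B"]
      card_image_le[of A "(`) upper_half"] card_image_le[of B "(`) lower_half"] by simp
  then have "card D \<le> card A + card B + 1"
    using card_component_le[of D "glued a b"] D finD two by (simp add: components_eq)
  then show "l + u \<le> 2" using cD lm mu by linarith
qed

text \<open>This is a combinatorial Jordan curve argument: two disjoint components do not interlace on
  the outer boundary. The parity count is applied to the lower and to the upper half. The middle
  points occur in opposite orders in the two halves, so together they contribute the number of
  all pairs of middle points.\<close>
lemma even_forward_pairs_components:
  assumes a: "a \<in> crossingless q r" and b: "b \<in> crossingless p q"
    and D: "D \<in> components a b" and D': "D' \<in> components a b" and ne: "D \<noteq> D'"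
  shows "even (forward_pairs (outer -` D) (outer -` D'))"
proof -
  note fin = finite_levels[OF finite_component[OF a b D]] finite_levels[OF finite_component[OF a b D']]
  have disj: "D \<inter> D' = {}" 
    using comps_disjoint[of D "glued a b" D'] D D' ne unfolding components_eq by blast
  have half: "even (forward_pairs (h -` D) (h -` D'))"
    if x: "x \<in> crossingless s t" and h: "inj h"
      and DU: "h -` D = \<Union>{e \<in> x. h ` e \<subseteq> D}" "h -` D' = \<Union>{e \<in> x. h ` e \<subseteq> D'}"
    for x s t and h :: "pt \<Rightarrow> glued_pt"
  proof -
    note X = crossinglessD[OF x]
    have "forward_pairs (h -` D) (h -` D')
        = (\<Sum>e\<in>{e \<in> x. h ` e \<subseteq> D}. \<Sum>f\<in>{e \<in> x. h ` e \<subseteq> D'}. forward_pairs e f)"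
      unfolding DU by (rule forward_pairs_Union) (use X in \<open>auto simp: disjoint_def\<close>)
    also have "even \<dots>"
    proof (intro dvd_sum)
      fix e f assume "e \<in> {e \<in> x. h ` e \<subseteq> D}" "f \<in> {e \<in> x. h ` e \<subseteq> D'}"
      moreover from this have "e \<inter> f = {}" using disj by blast
      ultimately show "even (forward_pairs e f)"
        using X(3,4) by (intro even_forward_pairs_arcs[of x]) auto
    qed
    finally show ?thesis .
  qed
  define L M U where "L = {i. LowerPt i \<in> D}" and "M = {i. MiddlePt i \<in> D}" and "U = {i. UpperPt i \<in> D}"
  define L' M' U' where "L' = {i. LowerPt i \<in> D'}" and "M' = {i. MiddlePt i \<in> D'}" and "U' = {i. UpperPt i \<in> D'}"
  note defs = L_def M_def U_def L'_def M'_def U'_def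
  have lower: "even (less_pairs L L' + card L * card M' + less_pairs M' M)"
    using half[OF b inj_halves(2) half_vimage_component(1)[OF a b D] half_vimage_component(1)[OF a b D']]
    unfolding half_vimage_split using fin by (simp add: forward_pairs_split defs)
  have upper: "even (less_pairs M M' + card M * card U' + less_pairs U' U)"
    using half[OF a inj_halves(1) half_vimage_component(2)[OF a b D] half_vimage_component(2)[OF a b D']]
    unfolding half_vimage_split using fin by (simp add: forward_pairs_split defs)
  have mid: "less_pairs M M' + less_pairs M' M = card M * card M'"
    by (rule less_pairs_swap) (use fin disj in \<open>auto simp: defs\<close>)
  have par: "even (card L + card M)" "even (card M + card U)"
      "even (card L' + card M')" "even (card M' + card U')"
    using component_counts[OF a b D] component_counts[OF a b D'] by (simp_all add: defs)
  \<comment> \<open>Modulo 2, the numbers of points on the three levels agree for each component. So the sum of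
    the counts in the two halves reduces to the count on the outer boundary.\<close>
  have "even (less_pairs L L' + card L * card U' + less_pairs U' U)"
  proof -
    have "even (card M * card M') \<longleftrightarrow> even (less_pairs M M' + less_pairs M' M)" using mid by simp
    with lower upper par show ?thesis by (auto simp: even_add)
  qed
  then show ?thesis
    unfolding half_vimage_split using fin by (simp add: forward_pairs_split defs)
qed

lemma outer_arc_card:
  assumes a: "a \<in> crossingless q r" and b: "b \<in> crossingless p q" and D: "D \<in> components a b"
    and ne: "outer -` D \<noteq> {}"
  shows "card (outer -` D) = 2"
proof -
  note fin = finite_levels[OF finite_component[OF a b D]]
  define l m u where "l = card {i. LowerPt i \<in> D}" and "m = card {i. MiddlePt i \<in> D}"
    and "u = card {i. UpperPt i \<in> D}"
  have "even (l + m)" "even (m + u)" "l + u \<le> 2"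
    using component_counts[OF a b D] by (simp_all add: l_def m_def u_def)
  moreover have "card (outer -` D) = l + u"
    unfolding half_vimage_split l_def u_def using fin by (simp add: card_split)
  moreover have "card (outer -` D) \<noteq> 0"
    using ne fin unfolding half_vimage_split by simp
  ultimately show ?thesis by presburger
qed

theorem diagram_mult_crossingless:
  assumes a: "a \<in> crossingless q r" and b: "b \<in> crossingless p q"
  shows "diagram_mult a b \<in> crossingless p r"
proof -
  have mem: "\<exists>D\<in>components a b. e = outer -` D \<and> e \<noteq> {}" if "e \<in> diagram_mult a b" for e
    using that by (auto simp: diagram_mult_def)
  have two: "card e = 2" if "e \<in> diagram_mult a b" for e
    using mem[OF that] outer_arc_card[OF a b] by blast
  have "partition_on (points p r) (diagram_mult a b)"
  proof (rule partition_onI)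
    have "\<Union>(diagram_mult a b) = outer -` \<Union>(components a b)"
      by (auto simp: diagram_mult_def)
    also have "\<Union>(components a b) = \<Union>(glued a b)"
      using partition_onD1[OF partition_on_comps[of "glued a b"]] by (simp add: components_eq)
    also have "outer -` \<Union>(glued a b) = points p r"
      unfolding half_vimage_split Union_glued[OF a b] points_def by auto
    finally show "\<Union>(diagram_mult a b) = points p r" .
    show "disjnt e f" if ef: "e \<in> diagram_mult a b" "f \<in> diagram_mult a b" "e \<noteq> f" for e f
    proof (rule ccontr)
      assume "\<not> disjnt e f"
      then obtain x where x: "x \<in> e" "x \<in> f" by (auto simp: disjnt_def)
      obtain D D' where "D \<in> components a b" "D' \<in> components a b" "e = outer -` D" "f = outer -` D'"
        using mem[OF ef(1)] mem[OF ef(2)] by blast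
      then show False
        using x ef(3) comps_disjoint[of D "glued a b" D'] unfolding components_eq by auto
    qed
    show "{} \<notin> diagram_mult a b" by (auto simp: diagram_mult_def)
  qed
  moreover have "noncrossing (diagram_mult a b)"
    unfolding noncrossing_def
  proof (intro notI, elim bexE conjE)
    fix e f x x' y y'
    assume e: "e \<in> diagram_mult a b" and f: "f \<in> diagram_mult a b"
      and x: "x \<in> e" "x' \<in> e" and y: "y \<in> f" "y' \<in> f"
      and lt: "bdry_less x y" "bdry_less y x'" "bdry_less x' y'"
    obtain D D' where D: "D \<in> components a b" "e = outer -` D" "D' \<in> components a b" "f = outer -` D'"
      using mem[OF e] mem[OF f] by blast
    show False
    proof (cases "D = D'")
      case True
      then have "{x, x', y} \<subseteq> e" using x y D by auto
      moreover have "card {x, x', y} = 3"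
        using lt bdry_trans bdry_irrefl by (metis card_3_iff)
      moreover have "finite e" using two[OF e] card.infinite by fastforce
      ultimately show False using card_mono[of e "{x, x', y}"] two[OF e] by simp
    next
      case False
      then have "even (forward_pairs e f)"
        using even_forward_pairs_components[OF a b] D by simp
      then show False
        using odd_forward_pairs_crossing[OF lt two[OF e] two[OF f] x y] by simp
    qed
  qed
  ultimately show ?thesis using two by (simp add: crossingless_def)
qed

section \<open>Cap-free matchings and their pairing\<close>

lemma crossingless_subset_eq:
  "x \<in> crossingless p q \<Longrightarrow> y \<in> crossingless p q \<Longrightarrow> x \<subseteq> y \<Longrightarrow> x = y"
  using partition_on_subset_eq crossinglessD(1) by metis

lemma flip_flip [simp]: "flip_pt (flip_pt x) = x"
  by (cases x) auto

lemma inj_flip: "inj flip_pt"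
  by (rule inj_on_inverseI[of _ flip_pt]) simp

lemma bdry_less_flip [simp]: "bdry_less (flip_pt x) (flip_pt y) \<longleftrightarrow> bdry_less y x"
  by (cases x; cases y) auto

lemma reflect_crossingless:
  assumes x: "x \<in> crossingless p q"
  shows "reflect x \<in> crossingless q p"
proof -
  note X = crossinglessD[OF x]
  have "partition_on (flip_pt ` points p q) ((`) flip_pt ` x - {{}})"
    by (rule partition_on_inj_image[OF X(1) inj_on_subset[OF inj_flip subset_UNIV]])
  moreover have "{} \<notin> (`) flip_pt ` x" using partition_onD3[OF X(1)] by auto
  moreover have "flip_pt ` points p q = points q p" by (auto simp: points_def image_Un image_image)
  ultimately have "partition_on (points q p) (reflect x)" by (simp add: reflect_def)
  moreover have "card (flip_pt ` e) = card e" for e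
    using inj_flip by (intro card_image) (simp add: inj_on_def)
  moreover have "noncrossing (reflect x)"
    unfolding noncrossing_def
  proof (intro notI, elim bexE conjE)
    fix e f u u' v v'
    assume e: "e \<in> reflect x" and f: "f \<in> reflect x"
      and u: "u \<in> e" "u' \<in> e" and v: "v \<in> f" "v' \<in> f"
      and lt: "bdry_less u v" "bdry_less v u'" "bdry_less u' v'"
    obtain e' f' where ef: "e' \<in> x" "e = flip_pt ` e'" "f' \<in> x" "f = flip_pt ` f'"
      using e f by (auto simp: reflect_def)
    have "flip_pt u \<in> e'" "flip_pt u' \<in> e'" "flip_pt v \<in> f'" "flip_pt v' \<in> f'"
      using u v ef by auto
    moreover have "bdry_less (flip_pt v') (flip_pt u')" "bdry_less (flip_pt u') (flip_pt v)"
      "bdry_less (flip_pt v) (flip_pt u)" using lt by simp_all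
    ultimately show False using noncrossingD[OF X(4) ef(3,1)] by metis
  qed
  ultimately show ?thesis using X(3) by (auto simp: crossingless_def reflect_def)
qed

lemma pair_in_reflect: "{x, y} \<in> a \<Longrightarrow> {flip_pt x, flip_pt y} \<in> reflect a"
proof -
  assume "{x, y} \<in> a"
  then have "flip_pt ` {x, y} \<in> reflect a" unfolding reflect_def by (rule imageI)
  then show ?thesis by simp
qed

lemma id_matching_image: "id_matching k = (\<lambda>i. {Bot i, Top i}) ` {1..k}"
  by (auto simp: id_matching_def)

lemma reflect_id [simp]: "reflect (id_matching k) = id_matching k"
  by (simp add: reflect_def id_matching_image image_image insert_commute)

lemma id_crossingless: "id_matching k \<in> crossingless k k"
proof -
  have "partition_on (points k k) (id_matching k)"
    by (rule partition_onI) (auto simp: id_matching_image points_def disjnt_def)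
  moreover have "noncrossing (id_matching k)"
    by (auto simp: noncrossing_def id_matching_def)
  moreover have "\<forall>e\<in>id_matching k. card e = 2"
    by (auto simp: id_matching_def)
  ultimately show ?thesis by (simp add: crossingless_def)
qed

lemma no_cap_id: "e \<in> id_matching k \<Longrightarrow> \<not> is_cap e"
  by (auto simp: id_matching_def is_cap_def)

lemma cellD:
  assumes "x \<in> cell k n"
  shows "x \<in> crossingless k n" "e \<in> x \<Longrightarrow> \<not> is_cap e"
  using assms by (auto simp: cell_def)

lemma arc_cases:
  assumes "x \<in> crossingless p q" "u \<in> points p q"
  obtains v where "{u, v} \<in> x" "v \<noteq> u" "v \<in> points p q"
proof -
  obtain e where e: "e \<in> x" "u \<in> e" using assms crossinglessD(2) by blast
  then have "card e = 2" using crossinglessD(3)[OF assms(1)] by blast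
  then obtain v where v: "e = {u, v}" "v \<noteq> u" using e(2) by (auto simp: card_2_iff)
  have "v \<in> points p q" using crossinglessD(2)[OF assms(1)] e v by blast
  then show ?thesis using that e v by blast
qed

lemma cell_through:
  assumes "x \<in> cell k n" "i \<in> {1..k}"
  obtains j where "{Bot i, Top j} \<in> x" "j \<in> {1..n}"
proof -
  obtain v where v: "{Bot i, v} \<in> x" "v \<noteq> Bot i" "v \<in> points k n"
    using arc_cases[OF cellD(1)[OF assms(1)], of "Bot i"] assms(2) by auto
  then have "\<not> is_cap {Bot i, v}" using cellD(2)[OF assms(1)] by blast
  then obtain j where "v = Top j" by (cases v) (auto simp: is_cap_def)
  then show ?thesis using that v by auto
qed

lemma arc_unique:
  assumes "x \<in> crossingless p q" "e \<in> x" "f \<in> x" "u \<in> e" "u \<in> f"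
  shows "e = f"
  using crossinglessD(8)[OF assms(1)] assms(2-5) by (auto dest: disjointD)

text \<open>All \<open>k\<close> bottom points are joined to top points, and noncrossing arcs do this in increasing
  order. An increasing self-map of \<open>{1..k}\<close> is the identity.\<close>
lemma cell_self:
  assumes w: "w \<in> cell k k"
  shows "w = id_matching k"
proof -
  note W = cellD(1)[OF w]
  have "\<exists>j. {Bot i, Top j} \<in> w \<and> j \<in> {1..k}" if "i \<in> {1..k}" for i
    using cell_through[OF w that] by metis
  then obtain f where f: "\<And>i. i \<in> {1..k} \<Longrightarrow> {Bot i, Top (f i)} \<in> w \<and> f i \<in> {1..k}" by metis
  have less: "f i < f j" if ij: "i \<in> {1..k}" "j \<in> {1..k}" "i < j" for i j
  proof -
    have "f i \<noteq> f j"
    proof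
      assume "f i = f j"
      then have "{Bot i, Top (f i)} = {Bot j, Top (f j)}"
        using f[OF ij(1)] f[OF ij(2)] by (intro arc_unique[OF W, of _ _ "Top (f i)"]) simp_all
      then show False using ij(3) by (auto simp: doubleton_eq_iff)
    qed
    moreover have "\<not> f j < f i"
    proof
      assume "f j < f i"
      then have "bdry_less (Bot i) (Bot j)" "bdry_less (Bot j) (Top (f i))"
        "bdry_less (Top (f i)) (Top (f j))" using ij by auto
      then show False
        using noncrossingD[OF crossinglessD(4)[OF W], of "{Bot i, Top (f i)}" "{Bot j, Top (f j)}"]
          f[OF ij(1)] f[OF ij(2)] by blast
    qed
    ultimately show ?thesis by simp
  qed
  then have inj: "inj_on f {1..k}" by (intro linorder_inj_onI) (auto simp: neq_iff)
  have fi: "f i = i" if i: "i \<in> {1..k}" for i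
  proof (rule antisym)
    have "card {i..k} \<le> card {f i..k}"
    proof (rule card_inj_on_le)
      show "inj_on f {i..k}" using i by (intro inj_on_subset[OF inj]) auto
      show "f ` {i..k} \<subseteq> {f i..k}"
      proof
        fix y assume "y \<in> f ` {i..k}"
        then obtain j where j: "y = f j" "i \<le> j" "j \<le> k" by auto
        then have "j \<in> {1..k}" using i by auto
        then show "y \<in> {f i..k}" using j f[of j] less[OF i, of j] by (cases "i = j") auto
      qed
    qed simp
    then show "f i \<le> i" using i f[OF i] by auto
    have "card {1..i} \<le> card {1..f i}"
    proof (rule card_inj_on_le)
      show "inj_on f {1..i}" using i by (intro inj_on_subset[OF inj]) auto
      show "f ` {1..i} \<subseteq> {1..f i}"
      proof
        fix y assume "y \<in> f ` {1..i}"
        then obtain j where j: "y = f j" "1 \<le> j" "j \<le> i" by auto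
        then have "j \<in> {1..k}" using i by auto
        then show "y \<in> {1..f i}" using j f[of j] less[OF _ i, of j] by (cases "i = j") auto
      qed
    qed simp
    then show "i \<le> f i" by simp
  qed
  have "id_matching k \<subseteq> w"
    unfolding id_matching_def
  proof safe
    fix i assume "i \<in> {1..k}"
    then show "{Bot i, Top i} \<in> w" using f[of i] fi[of i] by simp
  qed
  then show ?thesis using crossingless_subset_eq[OF id_crossingless W] by simp
qed

lemma product_arcI:
  assumes a: "a \<in> crossingless q r" and b: "b \<in> crossingless p q"
    and D: "D \<in> components a b" and xy: "outer x \<in> D" "outer y \<in> D" "x \<noteq> y"
  shows "{x, y} \<in> diagram_mult a b"
proof -
  have xy': "x \<in> outer -` D" "y \<in> outer -` D" using xy by auto
  then have "card (outer -` D) = 2" using outer_arc_card[OF a b D] by blast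
  then have "{x, y} = outer -` D"
    using xy' xy(3) by (intro card_subset_eq) (auto intro: card_ge_0_finite)
  then show ?thesis using D unfolding diagram_mult_def by blast
qed

lemma component_of_upper:
  assumes "e \<in> a" "x \<in> e"
  obtains D where "D \<in> components a b" "upper_half ` e \<subseteq> D"
proof -
  have e: "upper_half ` e \<in> glued a b" using assms by (auto simp: glued_def)
  obtain D where "D \<in> comps (glued a b)" "upper_half x \<in> D"
    using comps_cover[OF e imageI[OF assms(2)]] by blast
  then show ?thesis using that comps_saturated[OF _ e imageI[OF assms(2)]] unfolding components_eq by blast
qed

lemma component_lower_subset:
  assumes "D \<in> components a b" "e \<in> b" "x \<in> e" "lower_half x \<in> D"
  shows "lower_half ` e \<subseteq> D"
proof -
  have "lower_half ` e \<in> glued a b" using assms(2) by (auto simp: glued_def)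
  then show ?thesis using comps_saturated[OF assms(1)[unfolded components_eq]] assms(3,4) by blast
qed

lemma component_upper_subset:
  assumes "D \<in> components a b" "e \<in> a" "x \<in> e" "upper_half x \<in> D"
  shows "upper_half ` e \<subseteq> D"
proof -
  have "upper_half ` e \<in> glued a b" using assms(2) by (auto simp: glued_def)
  then show ?thesis using comps_saturated[OF assms(1)[unfolded components_eq]] assms(3,4) by blast
qed

lemma component_of_lower:
  assumes "e \<in> b" "x \<in> e"
  obtains D where "D \<in> components a b" "lower_half ` e \<subseteq> D"
proof -
  have e: "lower_half ` e \<in> glued a b" using assms by (auto simp: glued_def)
  obtain D where "D \<in> comps (glued a b)" "lower_half x \<in> D"
    using comps_cover[OF e imageI[OF assms(2)]] by blast
  then show ?thesis using that comps_saturated[OF _ e imageI[OF assms(2)]] unfolding components_eq by blast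
qed

text \<open>A cap of \<open>b\<close> is an arc of the product as well.\<close>
lemma no_cap_of_product:
  assumes a: "a \<in> crossingless q r" and b: "b \<in> crossingless p q"
    and nc: "\<And>e. e \<in> diagram_mult a b \<Longrightarrow> \<not> is_cap e"
  shows "b \<in> cell p q"
proof -
  have "\<not> is_cap e" if e: "e \<in> b" for e
  proof
    assume cap: "is_cap e"
    obtain u v where uv: "e = {u, v}" "u \<noteq> v" using crossinglessD(3)[OF b e] by (auto simp: card_2_iff)
    then obtain i j where ij: "u = Bot i" "v = Bot j" using cap by (auto simp: is_cap_def)
    obtain D where D: "D \<in> components a b" "lower_half ` e \<subseteq> D"
      using component_of_lower[OF e] uv by blast
    then have "outer (Bot i) \<in> D" "outer (Bot j) \<in> D" using uv ij by auto
    then have "e \<in> diagram_mult a b" using product_arcI[OF a b D(1)] uv ij by blast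
    then show False using nc cap by blast
  qed
  then show ?thesis using b by (simp add: cell_def)
qed

lemma mult_id_right:
  assumes z: "z \<in> crossingless k n"
  shows "diagram_mult z (id_matching k) = z"
proof -
  let ?w = "id_matching k"
  have "z \<subseteq> diagram_mult z ?w"
  proof
    fix e assume e: "e \<in> z"
    obtain u v where uv: "e = {u, v}" "u \<noteq> v" using crossinglessD(3)[OF z e] by (auto simp: card_2_iff)
    obtain D where D: "D \<in> components z ?w" "upper_half ` e \<subseteq> D"
      using component_of_upper[OF e] uv by blast
    have "outer t \<in> D" if t: "t \<in> e" for t
    proof (cases t)
      case (Bot i)
      have "t \<in> points k n" using crossinglessD(2)[OF z] e t by blast
      then have "{Bot i, Top i} \<in> ?w" using Bot by (auto simp: id_matching_def)
      moreover have "lower_half (Top i) \<in> D" using D(2) t Bot by force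
      ultimately have "lower_half ` {Bot i, Top i} \<subseteq> D"
        using component_lower_subset[OF D(1)] by blast
      then show ?thesis using Bot by simp
    next
      case (Top i)
      then show ?thesis using D(2) t by force
    qed
    then show "e \<in> diagram_mult z ?w"
      using product_arcI[OF z id_crossingless D(1)] uv by blast
  qed
  then show ?thesis
    using crossingless_subset_eq[OF z diagram_mult_crossingless[OF z id_crossingless]] by simp
qed

text \<open>A closed loop passes through a middle point. From there an arc of \<open>z\<close> leads to the top.\<close>
lemma loops_cell:
  assumes z: "z \<in> cell k n" and b: "b \<in> crossingless p k"
  shows "loops z b = 0"
proof -
  note Z = cellD(1)[OF z]
  have "outer -` D \<noteq> {}" if D: "D \<in> components z b" for D
  proof
    assume empty: "outer -` D = {}"
    have D': "D \<noteq> {}" "D \<subseteq> LowerPt ` {1..p} \<union> MiddlePt ` {1..k} \<union> UpperPt ` {1..n}"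
      using D Union_glued[OF Z b] by (auto simp: components_eq comps_iff)
    have no: "LowerPt i \<notin> D" "UpperPt i \<notin> D" for i
      using empty outer.simps by (metis empty_iff vimage_eq)+
    obtain j where j: "j \<in> {1..k}" "MiddlePt j \<in> D" using D' no by blast
    obtain t where t: "{Bot j, Top t} \<in> z" using cell_through[OF z j(1)] .
    have "upper_half ` {Bot j, Top t} \<subseteq> D"
      by (rule component_upper_subset[OF D t, of "Bot j"]) (use j(2) in simp_all)
    then show False using no by simp
  qed
  then have "{C \<in> components z b. outer -` C = {}} = {}" by blast
  then show ?thesis by (simp only: loops_def card.empty)
qed

text \<open>This is the condition under which the form $\langle x,y\rangle_k$ does not vanish by
  definition.\<close>
definition paired :: "nat \<Rightarrow> matching \<Rightarrow> matching \<Rightarrow> bool" where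
  "paired k x y \<longleftrightarrow> diagram_mult (reflect x) y = id_matching k"

lemma paired_sym: "paired k x y \<longleftrightarrow> paired k y x"
  unfolding paired_def by (metis reflect_diagram_mult reflect_id reflect_reflect)

lemma loops_paired_sym: "loops (reflect x) y = loops (reflect y) x"
  using loops_reflect[where a = "reflect x" and b = y] by simp

text \<open>For a through strand of \<open>x\<close> from $i$ to $j$, the mirrored strand continues it from $j$ to $i$.\<close>
lemma paired_self:
  assumes x: "x \<in> cell k n"
  shows "paired k x x"
proof -
  note X = cellD(1)[OF x]
  note X' = reflect_crossingless[OF X]
  have "id_matching k \<subseteq> diagram_mult (reflect x) x"
    unfolding id_matching_def
  proof safe
    fix i assume i: "i \<in> {1..k}"
    obtain j where j: "{Bot i, Top j} \<in> x" using cell_through[OF x i] .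
    then have j': "{Bot j, Top i} \<in> reflect x" 
      using pair_in_reflect[OF j] by (simp add: insert_commute)
    obtain D where D: "D \<in> components (reflect x) x" "lower_half ` {Bot i, Top j} \<subseteq> D"
      using component_of_lower[OF j] by blast
    have "upper_half ` {Bot j, Top i} \<subseteq> D"
      using component_upper_subset[OF D(1) j', of "Bot j"] D(2) by simp
    then show "{Bot i, Top i} \<in> diagram_mult (reflect x) x"
      using D(2) by (intro product_arcI[OF X' X D(1)]) auto
  qed
  then show ?thesis unfolding paired_def
    using crossingless_subset_eq[OF id_crossingless diagram_mult_crossingless[OF X' X]] by simp
qed

text \<open>By associativity $y^*(ax)=(a^*y)^*x$. If this product is the identity, then it has no caps,
  and therefore its right factor $ax$ has none.\<close>
lemma paired_adjointD:
  assumes a: "a \<in> crossingless n n" and x: "x \<in> cell k n" and y: "y \<in> cell k n"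
    and p: "paired k y (diagram_mult a x)"
  shows "diagram_mult a x \<in> cell k n"
    and "paired k (diagram_mult (reflect a) y) x"
    and "loops a x + loops (reflect y) (diagram_mult a x)
      = loops (reflect a) y + loops (reflect (diagram_mult (reflect a) y)) x"
proof -
  note X = cellD(1)[OF x]
  note Y = reflect_crossingless[OF cellD(1)[OF y]]
  have id: "diagram_mult (reflect y) (diagram_mult a x) = id_matching k"
    using p by (simp add: paired_def)
  show "diagram_mult a x \<in> cell k n"
    using no_cap_of_product[OF Y diagram_mult_crossingless[OF a X]] no_cap_id unfolding id by blast
  have r: "reflect (diagram_mult (reflect a) y) = diagram_mult (reflect y) a"
    by (simp add: reflect_diagram_mult)
  show "paired k (diagram_mult (reflect a) y) x"
    using id by (simp add: paired_def r diagram_mult_assoc)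
  show "loops a x + loops (reflect y) (diagram_mult a x)
      = loops (reflect a) y + loops (reflect (diagram_mult (reflect a) y)) x"
    using loops_assoc[of "reflect y" a x] crossinglessD(6)[OF a] crossinglessD(6)[OF X]
      crossinglessD(6)[OF Y] loops_paired_sym[of a y]
    by (simp add: r)
qed

lemma paired_adjoint:
  assumes "a \<in> crossingless n n" "x \<in> cell k n" "y \<in> cell k n"
  shows "paired k y (diagram_mult a x) \<longleftrightarrow> paired k (diagram_mult (reflect a) y) x"
  using paired_adjointD(2)[OF assms]
    paired_adjointD(2)[OF reflect_crossingless[OF assms(1)] assms(3,2)]
  by (auto simp: paired_sym)

text \<open>The product $(zy^*)x$ is $z(y^*x)$. A matching $y^*x$ different from the identity has a cap,
  which survives in the product with \<open>z\<close>.\<close>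
lemma sandwich:
  assumes z: "z \<in> cell k n" and y: "y \<in> cell k n" and x: "x \<in> cell k n"
  defines "s \<equiv> diagram_mult z (reflect y)"
  shows "s \<in> crossingless n n"
    and "diagram_mult s x \<in> cell k n \<longleftrightarrow> paired k y x"
    and "paired k y x \<Longrightarrow> diagram_mult s x = z"
    and "loops s x = loops (reflect y) x"
proof -
  note Z = cellD(1)[OF z] and X = cellD(1)[OF x]
  note Y = reflect_crossingless[OF cellD(1)[OF y]]
  note yx = diagram_mult_crossingless[OF Y X]
  show "s \<in> crossingless n n" unfolding s_def by (rule diagram_mult_crossingless[OF Z Y])
  have s: "diagram_mult s x = diagram_mult z (diagram_mult (reflect y) x)"
    by (simp add: s_def diagram_mult_assoc)
  show sz: "diagram_mult s x = z" if "paired k y x"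
    using that by (simp add: s paired_def mult_id_right[OF Z])
  show "diagram_mult s x \<in> cell k n \<longleftrightarrow> paired k y x"
  proof
    assume "diagram_mult s x \<in> cell k n"
    then have "diagram_mult (reflect y) x \<in> cell k k"
      using no_cap_of_product[OF Z yx] cellD(2) unfolding s by blast
    then show "paired k y x" unfolding paired_def by (rule cell_self)
  qed (use sz z in simp)
  show "loops s x = loops (reflect y) x"
    using loops_assoc[of z "reflect y" x] crossinglessD(6)[OF Z] crossinglessD(6)[OF Y]
      crossinglessD(6)[OF X] loops_cell[OF z Y] loops_cell[OF z yx]
    by (simp add: s_def)
qed

lemma cell_add_cup:
  assumes x: "x \<in> cell k n"
  shows "insert {Top (n + 1), Top (n + 2)} x \<in> cell k (n + 2)"
proof -
  note X = crossinglessD[OF cellD(1)[OF x]]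
  let ?c = "{Top (n + 1), Top (n + 2)}"
  have old: "\<not> (bdry_less u p \<and> bdry_less p u')" if "u \<in> ?c" "u' \<in> ?c" "p \<in> e" "e \<in> x" for u u' p e
  proof -
    have "p \<in> points k n" using X(2) that by blast
    then show ?thesis using that(1,2) by (cases p) auto
  qed
  have new: "\<not> (bdry_less u v \<and> bdry_less v u' \<and> bdry_less u' v')"
    if "u \<in> ?c" "u' \<in> ?c" "v \<in> ?c" "v' \<in> ?c" for u u' v v'
    using that by auto
  have "disjnt ?c (\<Union>x)" unfolding X(2) by (auto simp: disjnt_def)
  moreover have "points k (n + 2) - ?c = points k n" by (auto simp: points_def)
  moreover have "?c \<subseteq> points k (n + 2)" by simp
  ultimately have "partition_on (points k (n + 2)) (insert ?c x)"
    using X(1) by (subst partition_on_insert) auto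
  moreover have "noncrossing (insert ?c x)"
    unfolding noncrossing_def
  proof (intro notI, elim bexE conjE)
    fix e f u u' v v'
    assume *: "e \<in> insert ?c x" "f \<in> insert ?c x" "u \<in> e" "u' \<in> e" "v \<in> f" "v' \<in> f"
      and lt: "bdry_less u v" "bdry_less v u'" "bdry_less u' v'"
    consider "e = ?c" "f = ?c" | "e = ?c" "f \<in> x" | "e \<in> x" "f = ?c" | "e \<in> x" "f \<in> x"
      using *(1,2) by blast
    then show False
    proof cases
      case 1
      then show ?thesis using new[of u u' v v'] * lt by blast
    next
      case 2
      then show ?thesis using old[of u u' v f] * lt by blast
    next
      case 3
      then show ?thesis using old[of v v' u' e] * lt by blast
    next
      case 4
      then show ?thesis using noncrossingD[OF X(4)] * lt by metis
    qed
  qed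
  ultimately show ?thesis
    using X(3) cellD(2)[OF x] by (auto simp: cell_def crossingless_def is_cap_def)
qed

text \<open>The identity on \<open>k\<close> points may be extended by $(n-k)/2$ adjacent cups.\<close>
lemma cell_nonempty:
  assumes "k \<le> n" "k mod 2 = n mod 2"
  shows "cell k n \<noteq> {}"
proof -
  have "cell k (k + 2 * d) \<noteq> {}" for d
  proof (induction d)
    case 0
    then show ?case using id_crossingless no_cap_id by (auto simp: cell_def)
  next
    case (Suc d)
    then show ?case using cell_add_cup by fastforce
  qed
  moreover obtain d where "n = k + 2 * d"
  proof -
    have "even (n - k)" using assms by (metis even_diff_nat mod_2_eq_odd even_iff_mod_2_eq_zero odd_iff_mod_2_eq_one dvd_diff_nat even_add le_add_diff_inverse)
    then show ?thesis using that assms(1) by (metis dvdE le_add_diff_inverse)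
  qed
  ultimately show ?thesis by simp
qed

lemma finite_cell: "finite (cell k n)"
proof -
  have "cell k n \<subseteq> Pow (Pow (points k n))"
    using crossinglessD(2) cellD(1) by fastforce
  moreover have "finite (points k n)" by (simp add: points_def)
  ultimately show ?thesis by (meson finite_Pow_iff finite_subset)
qed

section \<open>The form and its radical\<close>

locale cell_rep =
  fixes K :: "('a, 'b) ring_scheme" (structure) and n m k :: nat and \<zeta> :: 'a
  assumes field_K: "field K"
    and m_pos: "1 \<le> m" and k_le: "k \<le> n" and k_mod: "k mod 2 = n mod 2"
    and zeta_closed: "\<zeta> \<in> carrier K" and zeta_pow: "\<zeta> [^] m = \<one>"
begin

sublocale field K by (rule field_K)

abbreviation B where "B \<equiv> cell k n"
abbreviation W where "W \<equiv> free_space K B"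
abbreviation e where "e \<equiv> basis_vec K B"
abbreviation C where "C \<equiv> cyclic_char K \<zeta>"
abbreviation Zm where "Zm \<equiv> carrier (integer_mod_group m)"

sublocale W: vectorspace K W by (rule vectorspace_free_space[OF field_K])

lemma Zm: "Zm = {0..<int m}"
  using m_pos by (simp add: carrier_integer_mod_group)

lemma e_closed: "e x \<in> carrier W"
  by (rule basis_vec_closed[OF field_K])

lemma C_sel: "carrier C = carrier K" "add C = add K" "zero C = zero K" "smult C = monoid.mult K"
  "act C g c = (\<zeta> [^] g) \<otimes> c"
  by (simp_all add: cyclic_char_def)

lemma vectorspace_C: "vectorspace K C"
  by (rule vs_criteria[OF field_K])
    (auto simp: C_sel m_assoc l_distr r_distr a_ac intro: r_neg a_inv_closed)

sublocale C: vectorspace K C by (rule vectorspace_C)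

lemma zeta_unit: "\<zeta> \<noteq> \<zero>"
proof
  assume "\<zeta> = \<zero>"
  then have "\<zeta> [^] m = \<zero>" using m_pos by (metis nat_pow_zero not_one_le_zero)
  then show False using zeta_pow by simp
qed

lemma zeta_pow_closed [simp]: "\<zeta> [^] (i :: nat) \<in> carrier K"
  using zeta_closed by simp

lemma zeta_pow_nonzero: "\<zeta> [^] (i :: nat) \<noteq> \<zero>"
  using zeta_unit zeta_closed by (induction i) (auto simp: integral_iff)

lemma zeta_pow_mod: "\<zeta> [^] (i mod m) = \<zeta> [^] i"
proof -
  have "\<zeta> [^] i = \<zeta> [^] (m * (i div m) + i mod m)" by simp
  also have "\<dots> = (\<zeta> [^] m) [^] (i div m) \<otimes> \<zeta> [^] (i mod m)"
    using zeta_closed by (simp only: nat_pow_mult[symmetric] nat_pow_pow)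
  finally show ?thesis using zeta_closed zeta_pow by simp
qed

definition gram where
  "gram y x = (if paired k y x then \<zeta> [^] loops (reflect y) x else \<zero>)"

definition form where "form y = lin_ext K B C (gram y)"

definition radical where "radical = {u \<in> carrier W. \<forall>y\<in>B. form y u = \<zero>}"

text \<open>The action of the monoid on $\Delta(k)\otimes K$ in terms of the basis $B_k^n$.\<close>
definition twisted_act where
  "twisted_act s = (case s of (a, i) \<Rightarrow> lin_ext K B W
     (\<lambda>x. if diagram_mult a x \<in> B then \<zeta> [^] (nat i + loops a x) \<odot>\<^bsub>W\<^esub> e (diagram_mult a x)
          else \<zero>\<^bsub>W\<^esub>))"

lemma gram_closed [simp]: "gram y x \<in> carrier K"
  by (simp add: gram_def)

lemma gram_sym: "gram y x = gram x y"
  by (simp add: gram_def paired_sym[of k y x] loops_paired_sym[of y x])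

lemma linear_form: "linear_map K W C (form y)"
  unfolding form_def by (rule C.linear_map_lin_ext) (simp add: C_sel)

lemma form_closed [simp]: "u \<in> carrier W \<Longrightarrow> form y u \<in> carrier K"
  using linear_mapD(1)[OF linear_form] by (simp add: C_sel)

lemma form_e: "x \<in> B \<Longrightarrow> form y (e x) = gram y x"
  unfolding form_def by (rule C.lin_ext_basis_vec) (simp_all add: C_sel)

lemma linear_twisted_act: "linear_map K W W (twisted_act s)"
  unfolding twisted_act_def split_beta
  by (rule W.linear_map_lin_ext) (simp add: e_closed)

lemma twisted_act_e:
  "x \<in> B \<Longrightarrow> twisted_act (a, i) (e x) =
    (if diagram_mult a x \<in> B then \<zeta> [^] (nat i + loops a x) \<odot>\<^bsub>W\<^esub> e (diagram_mult a x) else \<zero>\<^bsub>W\<^esub>)"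
  unfolding twisted_act_def prod.case by (rule W.lin_ext_basis_vec) (simp_all add: e_closed)

text \<open>Up to the factor $\zeta^i$ this is contravariance of the form,
  $\langle y,ax\rangle=\langle a^*y,x\rangle$, where a product that leaves the cell counts as
  zero.\<close>
lemma form_twisted_act:
  assumes a: "a \<in> crossingless n n" and y: "y \<in> B" and u: "u \<in> carrier W"
  shows "form y (twisted_act (a, i) u) =
    (if diagram_mult (reflect a) y \<in> B
     then \<zeta> [^] (nat i + loops (reflect a) y) \<otimes> form (diagram_mult (reflect a) y) u else \<zero>)"
proof -
  let ?y = "diagram_mult (reflect a) y"
  have a': "reflect a \<in> crossingless n n" by (rule reflect_crossingless[OF a])
  have lhs: "linear_map K W C (\<lambda>u. form y (twisted_act (a, i) u))"
    by (rule linear_map_comp[OF linear_twisted_act linear_form])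
  have lhs_e: "form y (twisted_act (a, i) (e x)) =
      (if paired k y (diagram_mult a x)
       then \<zeta> [^] (nat i + loops a x + loops (reflect y) (diagram_mult a x)) else \<zero>)"
    if x: "x \<in> B" for x
  proof (cases "diagram_mult a x \<in> B")
    case True
    then have "form y (twisted_act (a, i) (e x)) = \<zeta> [^] (nat i + loops a x) \<otimes> gram y (diagram_mult a x)"
      using x by (simp add: twisted_act_e linear_mapD(3)[OF linear_form] e_closed form_e C_sel)
    then show ?thesis using zeta_closed by (simp add: gram_def nat_pow_mult)
  next
    case False
    then have "\<not> paired k y (diagram_mult a x)" using paired_adjointD(1)[OF a x y] by blast
    then show ?thesis using False x by (simp add: twisted_act_e linear_mapD(4)[OF linear_form] C_sel)
  qed
  show ?thesis
  proof (cases "?y \<in> B")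
    case True
    have "form y (twisted_act (a, i) u) = \<zeta> [^] (nat i + loops (reflect a) y) \<odot>\<^bsub>C\<^esub> form ?y u"
    proof (rule linear_maps_eqI[OF lhs linear_map_scale[OF linear_form] _ u])
      fix x assume x: "x \<in> B"
      have "paired k y (diagram_mult a x) \<Longrightarrow> loops a x + loops (reflect y) (diagram_mult a x)
          = loops (reflect a) y + loops (reflect ?y) x"
        by (rule paired_adjointD(3)[OF a x y])
      then show "form y (twisted_act (a, i) (e x)) = \<zeta> [^] (nat i + loops (reflect a) y) \<odot>\<^bsub>C\<^esub> form ?y (e x)"
        unfolding lhs_e[OF x] form_e[OF x] using zeta_closed
        by (simp add: gram_def C_sel paired_adjoint[OF a x y] nat_pow_mult add.assoc)
    qed simp
    then show ?thesis using True by (simp add: C_sel)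
  next
    case False
    have "form y (twisted_act (a, i) u) = \<zero>\<^bsub>C\<^esub>"
    proof (rule linear_maps_eqI[OF lhs linear_map_zero _ u])
      fix x assume x: "x \<in> B"
      have "\<not> paired k ?y x"
        using paired_adjointD(1)[OF a' y x] False paired_sym[of k ?y x] by blast
      then show "form y (twisted_act (a, i) (e x)) = \<zero>\<^bsub>C\<^esub>"
        unfolding lhs_e[OF x] using paired_adjoint[OF a x y] by (simp add: C_sel)
    qed unfold_locales
    then show ?thesis using False by (simp add: C_sel)
  qed
qed

lemma radical_subset: "radical \<subseteq> carrier W"
  by (auto simp: radical_def)

lemma radical_invariant:
  assumes "a \<in> crossingless n n" "u \<in> radical"
  shows "twisted_act (a, i) u \<in> radical"
  using assms by (auto simp: radical_def form_twisted_act linear_mapD[OF linear_twisted_act])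

lemma subspace_radical: "subspace K radical W"
  by (rule subspaceI)
    (auto simp: radical_def linear_mapD[OF linear_form] C_sel W.vectorspace_axioms)

text \<open>As $\zeta$ is a unit, $\langle x,x\rangle$ is invertible.\<close>
lemma e_not_in_radical:
  assumes "x \<in> B"
  shows "e x \<notin> radical"
  using assms paired_self[OF assms] zeta_pow_nonzero by (auto simp: radical_def form_e gram_def)

text \<open>On a basis vector \<open>x\<close> both sides are $\langle y,x\rangle z$: the product $(zy^*)x$ leaves the cell
  if the form vanishes, and otherwise it is \<open>z\<close> and exactly the loops of $y^*x$ are deleted.\<close>
lemma sandwich_act:
  assumes y: "y \<in> B" and z: "z \<in> B" and u: "u \<in> carrier W"
  shows "twisted_act (diagram_mult z (reflect y), 0) u = form y u \<odot>\<^bsub>W\<^esub> e z"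
proof (rule linear_maps_eqI[OF linear_twisted_act _ _ u])
  show "linear_map K W W (\<lambda>u. form y u \<odot>\<^bsub>W\<^esub> e z)"
    by (rule linear_mapI)
      (auto simp: linear_mapD[OF linear_form] C_sel e_closed W.smult_l_distr W.smult_assoc1
        intro: W.vectorspace_axioms)
  fix x assume x: "x \<in> B"
  show "twisted_act (diagram_mult z (reflect y), 0) (e x) = form y (e x) \<odot>\<^bsub>W\<^esub> e z"
    using sandwich[OF z y x] x by (auto simp: twisted_act_e form_e gram_def e_closed)
qed

lemma TL_form_eq:
  assumes u: "u \<in> carrier W" and v: "v \<in> carrier W"
  shows "TL_form K n k \<zeta> u v = (\<Oplus>y\<in>B. v y \<otimes> form y u)"
proof -
  have uK: "u \<in> B \<rightarrow> carrier K" and vK: "v \<in> B \<rightarrow> carrier K"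
    using u v by (auto simp: free_space_sel[OF field_K])
  have form: "form y u = (\<Oplus>x\<in>B. u x \<otimes> gram y x)" for y
  proof -
    have "form y u = (\<Oplus>\<^bsub>C\<^esub>x\<in>B. u x \<odot>\<^bsub>C\<^esub> gram y x)"
      unfolding form_def by (rule C.lin_ext_superset) (use finite_cell uK in \<open>auto simp: C_sel\<close>)
    also have "\<dots> = (\<Oplus>x\<in>B. u x \<otimes> gram y x)"
      by (simp add: finsum_def C_sel finprod_def)
    finally show ?thesis .
  qed
  have "TL_form K n k \<zeta> u v = (\<Oplus>x\<in>B. \<Oplus>y\<in>B. u x \<otimes> v y \<otimes> gram x y)"
    unfolding TL_form_def gram_def paired_def ..
  also have "\<dots> = (\<Oplus>y\<in>B. \<Oplus>x\<in>B. u x \<otimes> v y \<otimes> gram x y)"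
    using uK vK by (intro finsum_finsum_swap finite_cell) (auto simp: Pi_def)
  also have "\<dots> = (\<Oplus>y\<in>B. v y \<otimes> form y u)"
  proof (intro add.finprod_cong' refl)
    fix y assume y: "y \<in> B"
    have "(\<Oplus>x\<in>B. u x \<otimes> v y \<otimes> gram x y) = (\<Oplus>x\<in>B. v y \<otimes> (u x \<otimes> gram y x))"
      using uK vK y by (intro add.finprod_cong' refl) (auto simp: Pi_def gram_sym[of _ y] m_ac)
    also have "\<dots> = v y \<otimes> (\<Oplus>x\<in>B. u x \<otimes> gram y x)"
      using uK vK y by (intro finsum_rdistr[symmetric] finite_cell) (auto simp: Pi_def)
    finally show "(\<Oplus>x\<in>B. u x \<otimes> v y \<otimes> gram x y) = v y \<otimes> form y u" by (simp add: form)
  qed (use vK linear_mapD(1)[OF linear_form u] in \<open>auto simp: C_sel Pi_def\<close>)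
  finally show ?thesis .
qed

lemma W_TL_sel:
  "carrier (W_TL K n k \<zeta>) = carrier W" "zero (W_TL K n k \<zeta>) = zero W"
  "add (W_TL K n k \<zeta>) = add W" "smult (W_TL K n k \<zeta>) = smult W"
  by (simp_all add: W_TL_def Let_def module.defs)

text \<open>It suffices to test a vector against the basis vectors.\<close>
lemma R_TL_eq: "R_TL K n k \<zeta> = radical"
proof (intro equalityI subsetI)
  fix u assume "u \<in> R_TL K n k \<zeta>"
  then have u: "u \<in> carrier W" and orth: "\<And>v. v \<in> carrier W \<Longrightarrow> TL_form K n k \<zeta> u v = \<zero>"
    by (auto simp: R_TL_def W_TL_sel)
  have "form y u = \<zero>" if y: "y \<in> B" for y
  proof -
    have fK: "form z u \<in> carrier K" for z
      using linear_mapD(1)[OF linear_form u] by (simp add: C_sel)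
    have "\<zero> = (\<Oplus>z\<in>B. e y z \<otimes> form z u)"
      using orth[OF e_closed] TL_form_eq[OF u e_closed] by simp
    also have "\<dots> = (\<Oplus>z\<in>B. if y = z then form z u else \<zero>)"
      by (rule add.finprod_cong') (auto simp: basis_vec_def fK)
    also have "\<dots> = form y u"
      using y fK finite_cell by (intro add.finprod_singleton) auto
    finally show ?thesis by simp
  qed
  then show "u \<in> radical" using u by (simp add: radical_def)
next
  fix u assume u: "u \<in> radical"
  have "TL_form K n k \<zeta> u v = \<zero>" if v: "v \<in> carrier W" for v
  proof -
    have vK: "v \<in> B \<rightarrow> carrier K"
      using v by (auto simp: free_space_sel[OF field_K])
    have "TL_form K n k \<zeta> u v = (\<Oplus>y\<in>B. \<zero>)"
      unfolding TL_form_eq[OF subsetD[OF radical_subset u] v]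
      using u vK by (intro add.finprod_cong') (auto simp: radical_def Pi_def)
    then show ?thesis by simp
  qed
  then show "u \<in> R_TL K n k \<zeta>" using u radical_subset by (auto simp: R_TL_def W_TL_sel)
qed

section \<open>The induced representation is the cell representation\<close>

abbreviation XD where "XD \<equiv> B \<times> Zm"
abbreviation FD where "FD \<equiv> free_space K XD"
abbreviation D where "D \<equiv> Delta K m n k"
abbreviation eD where "eD \<equiv> basis_vec K XD"

sublocale FD: vectorspace K FD by (rule vectorspace_free_space[OF field_K])

lemma D_sel: "carrier D = carrier FD" "zero D = zero FD" "add D = add FD" "smult D = smult FD"
  by (simp_all add: Delta_def Let_def module.defs rep.defs birep.defs)

lemma act_D: "act D (a, i) = lin_ext K XD FD
    (\<lambda>(x, j). if diagram_mult a x \<in> B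
       then eD (diagram_mult a x, (i + j + int (loops a x)) mod int m) else \<zero>\<^bsub>FD\<^esub>)"
  by (simp add: Delta_def Let_def module.defs rep.defs birep.defs)

lemma ract_D: "ract D v g = lin_ext K XD FD (\<lambda>(x, j). eD (x, (j + g) mod int m)) v"
  by (simp add: Delta_def Let_def module.defs rep.defs birep.defs)

lemma eD_closed: "eD p \<in> carrier FD"
  by (rule basis_vec_closed[OF field_K])

lemma id_FD_D: "linear_map K FD D (\<lambda>v. v)" and id_D_FD: "linear_map K D FD (\<lambda>v. v)"
  using linear_map_same_space[OF FD.vectorspace_axioms D_sel] by blast+

lemma vectorspace_D: "vectorspace K D"
  using linear_map_vectorspaces(2)[OF id_FD_D] .

sublocale D: vectorspace K D by (rule vectorspace_D)

lemma linear_act_FD: "linear_map K FD FD (act D s)"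
proof (cases s)
  case (Pair a i)
  show ?thesis unfolding Pair act_D
    by (rule FD.linear_map_lin_ext) (auto simp: eD_closed)
qed

lemma linear_act_D: "linear_map K D D (act D s)"
  using linear_map_comp[OF linear_map_comp[OF id_D_FD linear_act_FD] id_FD_D] .

lemma act_D_e: "x \<in> B \<Longrightarrow> j \<in> Zm \<Longrightarrow> act D (a, i) (eD (x, j)) =
    (if diagram_mult a x \<in> B
     then eD (diagram_mult a x, (i + j + int (loops a x)) mod int m) else \<zero>\<^bsub>FD\<^esub>)"
  unfolding act_D by (subst FD.lin_ext_basis_vec) (auto simp: eD_closed)

lemma linear_ract_D: "linear_map K FD FD (\<lambda>v. ract D v g)"
  unfolding ract_D by (rule FD.linear_map_lin_ext) (auto simp: eD_closed)

lemma ract_D_e: "x \<in> B \<Longrightarrow> j \<in> Zm \<Longrightarrow> ract D (eD (x, j)) g = eD (x, (j + g) mod int m)"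
  unfolding ract_D by (subst FD.lin_ext_basis_vec) (auto simp: eD_closed)

text \<open>The relation $(x,j)\otimes 1=\zeta^j\,(x,0)\otimes 1$ dictates the coefficients of this map.\<close>
definition untwist where
  "untwist = lin_ext K XD W (\<lambda>(x, j). \<zeta> [^] nat j \<odot>\<^bsub>W\<^esub> e x)"

lemma linear_untwist: "linear_map K FD W untwist"
  unfolding untwist_def by (rule W.linear_map_lin_ext) (auto simp: e_closed)

lemma untwist_e: "x \<in> B \<Longrightarrow> j \<in> Zm \<Longrightarrow> untwist (eD (x, j)) = \<zeta> [^] nat j \<odot>\<^bsub>W\<^esub> e x"
  unfolding untwist_def by (subst W.lin_ext_basis_vec) (auto simp: e_closed)

lemma mod_Zm: "i mod int m \<in> Zm"
  using m_pos by (simp add: Zm)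

lemma zeta_pow_nat_mod: "0 \<le> i \<Longrightarrow> \<zeta> [^] nat (i mod int m) = \<zeta> [^] nat i"
  using zeta_pow_mod[of "nat i"] by (simp add: nat_mod_distrib)

lemma untwist_act:
  assumes i: "0 \<le> i" and v: "v \<in> carrier FD"
  shows "untwist (act D (a, i) v) = twisted_act (a, i) (untwist v)"
proof (rule linear_maps_eqI[OF linear_map_comp[OF linear_act_FD linear_untwist]
      linear_map_comp[OF linear_untwist linear_twisted_act] _ v])
  fix p assume "p \<in> XD"
  then obtain x j where p: "p = (x, j)" and x: "x \<in> B" and j: "j \<in> Zm" by auto
  have j0: "0 \<le> j" using j by (simp add: Zm)
  have "\<zeta> [^] nat ((i + j + int (loops a x)) mod int m) = \<zeta> [^] nat j \<otimes> \<zeta> [^] (nat i + loops a x)"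
    using i j0 zeta_closed by (simp add: zeta_pow_nat_mod nat_pow_mult nat_add_distrib add_ac del: pow_nat)
  then show "untwist (act D (a, i) (eD p)) = twisted_act (a, i) (untwist (eD p))"
    unfolding p using x j by (simp add: act_D_e untwist_e mod_Zm twisted_act_e
      linear_mapD[OF linear_twisted_act] linear_mapD(4)[OF linear_untwist] e_closed W.smult_assoc1)
qed

lemma untwist_ract:
  assumes g: "g \<in> Zm" and v: "v \<in> carrier FD"
  shows "untwist (ract D v g) = \<zeta> [^] nat g \<odot>\<^bsub>W\<^esub> untwist v"
proof (rule linear_maps_eqI[OF linear_map_comp[OF linear_ract_D linear_untwist]
      linear_map_scale[OF linear_untwist] _ v])
  fix p assume "p \<in> XD"
  then obtain x j where p: "p = (x, j)" and x: "x \<in> B" and j: "j \<in> Zm" by auto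
  have "0 \<le> j" "0 \<le> g" using j g by (simp_all add: Zm)
  then have "\<zeta> [^] nat ((j + g) mod int m) = \<zeta> [^] nat g \<otimes> \<zeta> [^] nat j"
    using zeta_closed by (simp add: zeta_pow_nat_mod nat_pow_mult nat_add_distrib add_ac del: pow_nat)
  then show "untwist (ract D (eD p) g) = \<zeta> [^] nat g \<odot>\<^bsub>W\<^esub> untwist (eD p)"
    unfolding p using x j by (simp add: ract_D_e untwist_e mod_Zm e_closed W.smult_assoc1)
qed simp

definition X where "X = carrier D \<times> carrier C"
abbreviation F where "F \<equiv> free_space K X"
abbreviation t where "t v w \<equiv> basis_vec K X (v, w)"
abbreviation rels where "rels \<equiv> tensor_rels K Zm D C"
abbreviation T where "T \<equiv> tensor K Zm D C"

sublocale F: vectorspace K F by (rule vectorspace_free_space[OF field_K])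

text \<open>The space of formal combinations of pairs with the left action; its quotient by \<open>N\<close> is the
  tensor product.\<close>
definition formal_rep where
  "formal_rep = module.extend F (rep.fields (\<lambda>s. lin_ext K X F (\<lambda>(v, w). t (act D s v) w)))"

definition N where "N = F.span rels"

lemma T_eq: "T = quot_rep formal_rep N"
  by (simp add: tensor_def formal_rep_def N_def X_def Let_def)

lemma formal_rep_sel: "carrier formal_rep = carrier F" "zero formal_rep = zero F" "add formal_rep = add F" "smult formal_rep = smult F"
  "act formal_rep s = lin_ext K X F (\<lambda>(v, w). t (act D s v) w)"
  by (simp_all add: formal_rep_def module.defs rep.defs)

lemma t_closed: "t v w \<in> carrier F"
  by (rule basis_vec_closed[OF field_K])

lemma id_F_formal_rep: "linear_map K F formal_rep (\<lambda>v. v)" and id_formal_rep_F: "linear_map K formal_rep F (\<lambda>v. v)"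
  using linear_map_same_space[OF F.vectorspace_axioms formal_rep_sel(1-4)] by blast+

lemma rels_closed: "rels \<subseteq> carrier F"
  unfolding tensor_rels_def Let_def X_def[symmetric] by (auto simp: t_closed)

lemma subspace_N_F: "subspace K N F"
  unfolding N_def by (rule F.span_is_subspace[OF rels_closed])

lemma subspace_N: "subspace K N formal_rep"
  by (rule subspace_same_space[OF subspace_N_F linear_map_vectorspaces(2)[OF id_F_formal_rep] formal_rep_sel(1-4)])

lemma rels_N: "r \<in> rels \<Longrightarrow> r \<in> N"
  using F.in_own_span[OF rels_closed] unfolding N_def by blast

definition q where "q f = N +>\<^bsub>formal_rep\<^esub> f"

lemma linear_q: "linear_map K F T q"
  using linear_map_comp[OF id_F_formal_rep linear_map_quot_rep(1)[OF subspace_N]]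
  by (simp add: T_eq q_def[abs_def])

lemma q_surj: "q ` carrier F = carrier T"
  using linear_map_quot_rep(2)[OF subspace_N] by (simp add: T_eq q_def formal_rep_sel)

lemma q_zero_iff: "f \<in> carrier F \<Longrightarrow> q f = \<zero>\<^bsub>T\<^esub> \<longleftrightarrow> f \<in> N"
  using linear_map_quot_rep(3)[OF subspace_N, of f] by (simp add: T_eq q_def formal_rep_sel)

lemma vectorspace_T: "vectorspace K T"
  using linear_map_vectorspaces(2)[OF linear_q] .

sublocale T: vectorspace K T by (rule vectorspace_T)

lemma q_eqI: "f \<in> carrier F \<Longrightarrow> g \<in> carrier F \<Longrightarrow> f \<ominus>\<^bsub>F\<^esub> g \<in> rels \<Longrightarrow> q f = q g"
  using q_zero_iff[of "f \<ominus>\<^bsub>F\<^esub> g"] rels_N linear_mapD(1,5)[OF linear_q] by simp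

definition tens where "tens v w = q (t v w)"

lemma tens_closed: "tens v w \<in> carrier T"
  unfolding tens_def by (rule linear_mapD(1)[OF linear_q t_closed])

lemma tens_add_left:
  assumes "v \<in> carrier D" "v' \<in> carrier D" "w \<in> carrier C"
  shows "tens (v \<oplus>\<^bsub>D\<^esub> v') w = tens v w \<oplus>\<^bsub>T\<^esub> tens v' w"
proof -
  have "t (v \<oplus>\<^bsub>D\<^esub> v') w \<ominus>\<^bsub>F\<^esub> (t v w \<oplus>\<^bsub>F\<^esub> t v' w) \<in> rels"
    unfolding tensor_rels_def Let_def X_def[symmetric] using assms by blast
  from q_eqI[OF _ _ this] show ?thesis
    by (simp add: tens_def t_closed linear_mapD(2)[OF linear_q])
qed

lemma tens_smult_left:
  assumes "c \<in> carrier K" "v \<in> carrier D" "w \<in> carrier C"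
  shows "tens (c \<odot>\<^bsub>D\<^esub> v) w = c \<odot>\<^bsub>T\<^esub> tens v w"
proof -
  have "t (c \<odot>\<^bsub>D\<^esub> v) w \<ominus>\<^bsub>F\<^esub> c \<odot>\<^bsub>F\<^esub> t v w \<in> rels"
    unfolding tensor_rels_def Let_def X_def[symmetric] using assms by blast
  from q_eqI[OF _ _ this] show ?thesis
    using assms(1) by (simp add: tens_def t_closed linear_mapD(3)[OF linear_q])
qed

lemma tens_smult_right:
  assumes "c \<in> carrier K" "v \<in> carrier D" "w \<in> carrier C"
  shows "tens v (c \<odot>\<^bsub>C\<^esub> w) = c \<odot>\<^bsub>T\<^esub> tens v w"
proof -
  have "t v (c \<odot>\<^bsub>C\<^esub> w) \<ominus>\<^bsub>F\<^esub> c \<odot>\<^bsub>F\<^esub> t v w \<in> rels"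
    unfolding tensor_rels_def Let_def X_def[symmetric] using assms by blast
  from q_eqI[OF _ _ this] show ?thesis
    using assms(1) by (simp add: tens_def t_closed linear_mapD(3)[OF linear_q])
qed

lemma tens_balanced:
  assumes "g \<in> Zm" "v \<in> carrier D" "w \<in> carrier C"
  shows "tens (ract D v g) w = tens v (act C g w)"
proof -
  have "t (ract D v g) w \<ominus>\<^bsub>F\<^esub> t v (act C g w) \<in> rels"
    unfolding tensor_rels_def Let_def X_def[symmetric] using assms by blast
  from q_eqI[OF _ _ this] show ?thesis by (simp add: tens_def t_closed)
qed

lemma act_C: "g \<in> Zm \<Longrightarrow> act C g c = \<zeta> [^] nat g \<otimes> c"
  using int_pow_int[of K \<zeta> "nat g"] by (simp add: C_sel Zm)

text \<open>The map induced by the balanced bilinear map $(v,w)\mapsto w\cdot\mathit{untwist}(v)$. It vanishes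
  on \<open>N\<close> and provides the inverse of \<open>\<sigma>\<close>.\<close>
definition collapse where "collapse = lin_ext K X W (\<lambda>(v, w). w \<odot>\<^bsub>W\<^esub> untwist v)"

lemma linear_collapse: "linear_map K F W collapse"
  unfolding collapse_def
  by (rule W.linear_map_lin_ext) (auto simp: X_def C_sel D_sel linear_mapD(1)[OF linear_untwist])

lemma collapse_t:
  "v \<in> carrier D \<Longrightarrow> w \<in> carrier K \<Longrightarrow> collapse (t v w) = w \<odot>\<^bsub>W\<^esub> untwist v"
  unfolding collapse_def
  by (subst W.lin_ext_basis_vec) (auto simp: X_def C_sel D_sel linear_mapD(1)[OF linear_untwist])

lemma collapse_eqI:
  "f \<in> carrier F \<Longrightarrow> g \<in> carrier F \<Longrightarrow> collapse f = collapse g \<Longrightarrow> collapse (f \<ominus>\<^bsub>F\<^esub> g) = \<zero>\<^bsub>W\<^esub>"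
  by (simp add: linear_mapD[OF linear_collapse])

lemma collapse_rels:
  assumes "r \<in> rels"
  shows "collapse r = \<zero>\<^bsub>W\<^esub>"
proof -
  note lin = linear_mapD[OF linear_collapse] linear_mapD[OF linear_untwist]
    linear_mapD(1)[OF linear_ract_D]
  show ?thesis
    using assms unfolding tensor_rels_def Let_def X_def[symmetric]
    by (auto intro!: collapse_eqI
        simp: t_closed collapse_t lin C_sel(1-4) act_C D_sel W.smult_l_distr W.smult_r_distr
          W.smult_assoc1[symmetric] untwist_ract m_ac)
qed

lemma collapse_N: "f \<in> N \<Longrightarrow> collapse f = \<zero>\<^bsub>W\<^esub>"
proof -
  interpret c: linear_map K F W collapse by (rule linear_collapse)
  have "rels \<subseteq> c.ker" using collapse_rels rels_closed by (auto simp: c.ker_def)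
  then have "N \<subseteq> c.ker" unfolding N_def using F.span_is_subset c.ker_is_submodule by blast
  then show "f \<in> N \<Longrightarrow> collapse f = \<zero>\<^bsub>W\<^esub>" by (auto simp: c.ker_def)
qed

definition \<sigma> where "\<sigma> = lin_ext K B T (\<lambda>x. tens (eD (x, 0)) \<one>)"

lemma linear_\<sigma>: "linear_map K W T \<sigma>"
  unfolding \<sigma>_def by (rule T.linear_map_lin_ext) (simp add: tens_closed)

lemma \<sigma>_e: "x \<in> B \<Longrightarrow> \<sigma> (e x) = tens (eD (x, 0)) \<one>"
  unfolding \<sigma>_def by (rule T.lin_ext_basis_vec) (simp_all add: tens_closed)

lemma zero_Zm: "0 \<in> Zm"
  using m_pos by (simp add: Zm)

text \<open>Balancing moves the second component of a basis vector $(x,j)$ over to the right factor.\<close>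
lemma tens_eq_\<sigma>:
  assumes v: "v \<in> carrier D" and w: "w \<in> carrier K"
  shows "tens v w = w \<odot>\<^bsub>T\<^esub> \<sigma> (untwist v)"
proof -
  have lin: "linear_map K FD T (\<lambda>v. tens v w)"
    by (rule linear_map_comp[OF id_FD_D])
      (auto intro!: linear_mapI vectorspace_D vectorspace_T
        simp: tens_closed tens_add_left tens_smult_left w C_sel(1))
  show ?thesis
  proof (rule linear_maps_eqI[OF lin linear_map_scale[OF linear_map_comp[OF linear_untwist linear_\<sigma>] w]])
    show "v \<in> carrier FD" using v by (simp add: D_sel)
    fix p assume "p \<in> XD"
    then obtain x j where p: "p = (x, j)" and x: "x \<in> B" and j: "j \<in> Zm" by auto
    have "eD (x, j) = ract D (eD (x, 0)) j"
      using x j zero_Zm ract_D_e[OF x zero_Zm, of j] by (simp add: Zm)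
    then have "tens (eD (x, j)) w = tens (eD (x, 0)) ((\<zeta> [^] nat j \<otimes> w) \<odot>\<^bsub>C\<^esub> \<one>)"
      using tens_balanced[OF j, of "eD (x, 0)" w] w by (simp add: D_sel eD_closed C_sel(1,4) act_C[OF j])
    also have "\<dots> = (\<zeta> [^] nat j \<otimes> w) \<odot>\<^bsub>T\<^esub> \<sigma> (e x)"
      using w x by (subst tens_smult_right) (simp_all add: D_sel eD_closed C_sel(1) \<sigma>_e)
    finally show "tens (eD p) w = w \<odot>\<^bsub>T\<^esub> \<sigma> (untwist (eD p))"
      unfolding p using x j w
      by (simp add: untwist_e linear_mapD[OF linear_\<sigma>] e_closed T.smult_assoc1[symmetric] m_comm)
  qed
qed

lemma q_eq_\<sigma>_collapse: "f \<in> carrier F \<Longrightarrow> q f = \<sigma> (collapse f)"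
proof (rule linear_maps_eqI[OF linear_q linear_map_comp[OF linear_collapse linear_\<sigma>]])
  fix p assume "p \<in> X"
  then obtain v w where p: "p = (v, w)" and v: "v \<in> carrier D" and w: "w \<in> carrier K"
    by (auto simp: X_def C_sel)
  show "q (basis_vec K X p) = \<sigma> (collapse (basis_vec K X p))"
    unfolding p using tens_eq_\<sigma>[OF v w] v w
    by (simp add: tens_def collapse_t linear_mapD(3)[OF linear_\<sigma>] linear_mapD(1)[OF linear_untwist] D_sel)
qed

lemma collapse_section:
  assumes w: "w \<in> carrier W"
  shows "\<exists>f\<in>carrier F. collapse f = w"
proof
  let ?s = "lin_ext K B F (\<lambda>x. t (eD (x, 0)) \<one>)"
  have s: "linear_map K W F ?s" by (rule F.linear_map_lin_ext) (simp add: t_closed)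
  show "?s w \<in> carrier F" using linear_mapD(1)[OF s w] .
  have id: "linear_map K W W (\<lambda>w. w)" by (rule linear_map_same_space(1)) (simp_all add: W.vectorspace_axioms)
  show "collapse (?s w) = w"
  proof (rule linear_maps_eqI[OF linear_map_comp[OF s linear_collapse] id _ w])
    fix x assume x: "x \<in> B"
    have "?s (e x) = t (eD (x, 0)) \<one>"
      by (rule F.lin_ext_basis_vec) (simp_all add: t_closed x)
    then show "collapse (?s (e x)) = e x"
      using x zero_Zm by (simp add: collapse_t D_sel eD_closed untwist_e e_closed)
  qed
qed

lemma \<sigma>_surj: "\<sigma> ` carrier W = carrier T"
proof
  show "\<sigma> ` carrier W \<subseteq> carrier T" using linear_mapD(1)[OF linear_\<sigma>] by blast
  show "carrier T \<subseteq> \<sigma> ` carrier W"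
    unfolding q_surj[symmetric] using q_eq_\<sigma>_collapse linear_mapD(1)[OF linear_collapse] by auto
qed

lemma \<sigma>_inj: "inj_on \<sigma> (carrier W)"
proof (rule inj_onI)
  fix u w assume u: "u \<in> carrier W" and w: "w \<in> carrier W" and eq: "\<sigma> u = \<sigma> w"
  obtain f where f: "f \<in> carrier F" "collapse f = u \<ominus>\<^bsub>W\<^esub> w"
    using collapse_section[of "u \<ominus>\<^bsub>W\<^esub> w"] u w by auto
  have "q f = \<sigma> u \<ominus>\<^bsub>T\<^esub> \<sigma> w"
    using q_eq_\<sigma>_collapse[OF f(1)] f(2) u w by (simp add: linear_mapD(5)[OF linear_\<sigma>])
  then have "q f = \<zero>\<^bsub>T\<^esub>" using eq linear_mapD(1)[OF linear_\<sigma>] u w by simp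
  then have "u \<ominus>\<^bsub>W\<^esub> w = \<zero>\<^bsub>W\<^esub>" using collapse_N q_zero_iff f by metis
  then show "u = w" using u w by simp
qed

lemma linear_act_formal_rep: "linear_map K F F (act formal_rep s)"
  unfolding formal_rep_sel by (rule F.linear_map_lin_ext) (auto simp: t_closed)

lemma collapse_act:
  assumes i: "0 \<le> i" and f: "f \<in> carrier F"
  shows "collapse (act formal_rep (a, i) f) = twisted_act (a, i) (collapse f)"
proof (rule linear_maps_eqI[OF linear_map_comp[OF linear_act_formal_rep linear_collapse]
      linear_map_comp[OF linear_collapse linear_twisted_act] _ f])
  fix p assume "p \<in> X"
  then obtain v w where p: "p = (v, w)" and v: "v \<in> carrier D" and w: "w \<in> carrier K"
    by (auto simp: X_def C_sel)
  have "act formal_rep (a, i) (t v w) = t (act D (a, i) v) w"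
  proof -
    have "(v, w) \<in> X" using v w by (simp add: X_def C_sel)
    then show ?thesis unfolding formal_rep_sel by (subst F.lin_ext_basis_vec) (auto simp: t_closed)
  qed
  then show "collapse (act formal_rep (a, i) (basis_vec K X p)) = twisted_act (a, i) (collapse (basis_vec K X p))"
    unfolding p using v w
    by (simp add: collapse_t linear_mapD(1)[OF linear_act_D] linear_mapD(3)[OF linear_twisted_act]
        linear_mapD(1)[OF linear_untwist] untwist_act[OF i] D_sel linear_mapD(1)[OF linear_act_FD])
qed

lemma act_\<sigma>:
  assumes i: "0 \<le> i" and w: "w \<in> carrier W"
  shows "act T (a, i) (\<sigma> w) = \<sigma> (twisted_act (a, i) w)"
proof -
  obtain f where f: "f \<in> carrier F" "collapse f = w" using collapse_section[OF w] by blast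
  have act_F: "act formal_rep (a, i) g \<in> carrier F" if "g \<in> carrier F" for g
    by (rule linear_mapD(1)[OF linear_act_formal_rep that])
  have "act formal_rep (a, i) g \<in> N" if g: "g \<in> N" for g
  proof -
    have gF: "g \<in> carrier F" using subspaceD(1)[OF subspace_N_F] g by blast
    have "q (act formal_rep (a, i) g) = \<sigma> (twisted_act (a, i) (collapse g))"
      using q_eq_\<sigma>_collapse[OF act_F[OF gF]] collapse_act[OF i gF] by simp
    also have "\<dots> = \<zero>\<^bsub>T\<^esub>"
      by (simp add: collapse_N[OF g] linear_mapD(4)[OF linear_twisted_act] linear_mapD(4)[OF linear_\<sigma>])
    finally show ?thesis using q_zero_iff[OF act_F[OF gF]] by simp
  qed
  moreover have "linear_map K formal_rep formal_rep (act formal_rep (a, i))"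
    using linear_map_comp[OF linear_map_comp[OF id_formal_rep_F linear_act_formal_rep] id_F_formal_rep] .
  ultimately have "act T (a, i) (q f) = q (act formal_rep (a, i) f)"
    unfolding T_eq q_def using f(1) by (intro act_quot_rep[OF subspace_N]) (simp_all add: formal_rep_sel(1))
  then show ?thesis
    using q_eq_\<sigma>_collapse[OF f(1)] q_eq_\<sigma>_collapse[OF act_F[OF f(1)]] collapse_act[OF i f(1)] f(2)
    by simp
qed

section \<open>The head of the induced representation\<close>

abbreviation S where "S \<equiv> carrier (cyclic_TL m n)"

lemma S_eq: "S = crossingless n n \<times> Zm"
  by (simp add: cyclic_TL_def)

lemma subrep_radical: "subrep K S T (\<sigma> ` radical)"
  unfolding subrep_def
proof (intro conjI ballI)
  note R = subspaceD[OF subspace_radical]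
  show "subspace K (\<sigma> ` radical) T"
  proof (rule subspaceI[OF vectorspace_T])
    show "\<sigma> ` radical \<subseteq> carrier T" using R(1) \<sigma>_surj by blast
    show "\<zero>\<^bsub>T\<^esub> \<in> \<sigma> ` radical" using R(2) linear_mapD(4)[OF linear_\<sigma>] by (metis imageI)
    show "u \<oplus>\<^bsub>T\<^esub> v \<in> \<sigma> ` radical" if uv: "u \<in> \<sigma> ` radical" "v \<in> \<sigma> ` radical" for u v
    proof -
      obtain u' v' where *: "u' \<in> radical" "v' \<in> radical" "u = \<sigma> u'" "v = \<sigma> v'" using uv by blast
      then have "u \<oplus>\<^bsub>T\<^esub> v = \<sigma> (u' \<oplus>\<^bsub>W\<^esub> v')" using R(1) linear_mapD(2)[OF linear_\<sigma>] by auto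
      then show ?thesis using R(3) * by blast
    qed
    show "c \<odot>\<^bsub>T\<^esub> v \<in> \<sigma> ` radical" if c: "c \<in> carrier K" and v: "v \<in> \<sigma> ` radical" for c v
    proof -
      obtain v' where *: "v' \<in> radical" "v = \<sigma> v'" using v by blast
      then have "c \<odot>\<^bsub>T\<^esub> v = \<sigma> (c \<odot>\<^bsub>W\<^esub> v')" using R(1) linear_mapD(3)[OF linear_\<sigma> c] by auto
      then show ?thesis using R(4)[OF c] * by blast
    qed
  qed
  fix s v assume "s \<in> S" "v \<in> \<sigma> ` radical"
  then obtain a i u where *: "s = (a, i)" "a \<in> crossingless n n" "0 \<le> i" "u \<in> radical" "v = \<sigma> u"
    by (auto simp: S_eq Zm)
  then have "act T s v = \<sigma> (twisted_act (a, i) u)" using act_\<sigma> R(1) by auto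
  then show "act T s v \<in> \<sigma> ` radical" using radical_invariant[OF *(2,4)] by simp
qed

lemma radical_proper: "\<sigma> ` radical \<noteq> carrier T"
proof
  assume eq: "\<sigma> ` radical = carrier T"
  obtain x where x: "x \<in> B" using cell_nonempty[OF k_le k_mod] by blast
  have "\<sigma> (e x) \<in> \<sigma> ` radical" using linear_mapD(1)[OF linear_\<sigma> e_closed] eq by simp
  then have "e x \<in> radical" using inj_on_image_mem_iff[OF \<sigma>_inj e_closed radical_subset] by simp
  then show False using e_not_in_radical[OF x] by simp
qed

text \<open>A vector outside the radical pairs nontrivially with some $y\in B_k^n$. The diagrams $zy^*$ then
  take it to nonzero multiples of all basis vectors.\<close>
lemma subrep_le_radical:
  assumes M: "subrep K S T M" and proper: "M \<noteq> carrier T"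
  shows "M \<subseteq> \<sigma> ` radical"
proof (rule ccontr)
  assume "\<not> M \<subseteq> \<sigma> ` radical"
  then obtain v where v: "v \<in> M" "v \<notin> \<sigma> ` radical" by blast
  have M': "subspace K M T" and inv: "\<And>s v. s \<in> S \<Longrightarrow> v \<in> M \<Longrightarrow> act T s v \<in> M"
    using M by (auto simp: subrep_def)
  note Ms = subspaceD[OF M']
  obtain u where u: "u \<in> carrier W" "v = \<sigma> u" using v(1) Ms(1) \<sigma>_surj by blast
  then obtain y where y: "y \<in> B" "form y u \<noteq> \<zero>" using v(2) by (auto simp: radical_def)
  define c where "c = form y u"
  have c: "c \<in> carrier K" "c \<noteq> \<zero>" using y(2) u(1) by (simp_all add: c_def)
  have \<sigma>e: "\<sigma> (e z) \<in> M" if z: "z \<in> B" for z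
  proof -
    have "(diagram_mult z (reflect y), 0) \<in> S"
      using sandwich(1)[OF z y(1) y(1)] zero_Zm by (simp add: S_eq)
    then have "act T (diagram_mult z (reflect y), 0) (\<sigma> u) \<in> M" using inv v(1) u(2) by blast
    then have "c \<odot>\<^bsub>T\<^esub> \<sigma> (e z) \<in> M"
      using c(1) by (simp add: act_\<sigma>[OF _ u(1)] sandwich_act[OF y(1) z u(1)]
        linear_mapD(3)[OF linear_\<sigma>] e_closed flip: c_def)
    then have "inv c \<odot>\<^bsub>T\<^esub> (c \<odot>\<^bsub>T\<^esub> \<sigma> (e z)) \<in> M" using Ms(4) c by simp
    moreover have "inv c \<otimes> c = \<one>" using c by (simp add: field_Units)
    ultimately show ?thesis
      using c linear_mapD(1)[OF linear_\<sigma> e_closed] by (simp add: T.smult_assoc1[symmetric])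
  qed
  have "\<sigma> w \<in> M" if w: "w \<in> carrier W" for w
  proof -
    have wK: "w \<in> B \<rightarrow> carrier K" using w by (auto simp: free_space_sel[OF field_K])
    show ?thesis
      unfolding linear_map_eq_lin_ext[OF linear_\<sigma> w] lin_ext_def
      by (rule subspace_finsum[OF M']) (use \<sigma>e wK Ms(4) in auto)
  qed
  then have "carrier T \<subseteq> M" unfolding \<sigma>_surj[symmetric] by blast
  then show False using proper Ms(1) by blast
qed

theorem dim_L_cyclic: "vectorspace.dim K (L_cyclic K m n k \<zeta>) = vectorspace.dim K (L_TL K n k \<zeta>)"
proof -
  have "rep_radical K S T = \<sigma> ` radical"
    by (rule rep_radical_unique_maximal[OF subrep_radical radical_proper subrep_le_radical])
  then have "L_cyclic K m n k \<zeta> = quot_rep T (\<sigma> ` radical)"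
    by (simp add: L_cyclic_def rep_head_def)
  moreover have "vectorspace.dim K (quot_rep T (\<sigma> ` radical))
      = vectorspace.dim K (quot_rep (W_TL K n k \<zeta>) radical)"
  proof (rule dim_head_transfer[OF linear_\<sigma> \<sigma>_surj \<sigma>_inj radical_subset])
    show "subspace K (\<sigma> ` radical) T" using subrep_radical by (simp add: subrep_def)
    show id: "linear_map K W (W_TL K n k \<zeta>) (\<lambda>v. v)"
      by (rule linear_map_same_space(1)[OF W.vectorspace_axioms W_TL_sel])
    show "subspace K radical (W_TL K n k \<zeta>)"
      by (rule subspace_same_space[OF subspace_radical linear_map_vectorspaces(2)[OF id] W_TL_sel])
  qed (rule W_TL_sel)
  ultimately show ?thesis by (simp add: L_TL_def R_TL_eq)
qed

end

theorem theorem3p5p3: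
  fixes K :: "('a, 'b) ring_scheme" and n m k :: nat and \<zeta> :: 'a
  assumes "field K"
    and "1 \<le> n" and "1 \<le> m"
    and "k \<le> n" and "k mod 2 = n mod 2"
    and "\<exists>\<omega>\<in>carrier K. primitive_root_of_unity K m \<omega>"
    and "\<zeta> \<in> carrier K" and "\<zeta> [^]\<^bsub>K\<^esub> m = \<one>\<^bsub>K\<^esub>"
  shows "vectorspace.dim K (L_cyclic K m n k \<zeta>) = vectorspace.dim K (L_TL K n k \<zeta>)"
proof -
  interpret cell_rep K n m k \<zeta>
    by (rule cell_rep.intro) (use assms in simp_all)
  show ?thesis by (rule dim_L_cyclic)
qed

end
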